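(* Let $k$ be a differential field of characteristic zero with derivations $\Delta=\{\delta_1,\dots,\delta_m\}$, $R=k\{y_1,\ldots,y_l\}$, and fix an orderly ranking. Let $I$ be a radical differential ideal of $R$ satisfying the property of consistency, i.e. there is a Kolchin characteristic set $\mathbb{C}\subset I$ of $I$ with $1\notin[\mathbb{C}]:H_{\mathbb{C}}^\infty$. Let $I=\bigcap_{i=1}^n[\mathbb{C}_i]:H_{\mathbb{C}_i}^\infty$ be a characteristic decomposition of $I$ with respect to this ranking, $\mathbb{C}_i=C_i^1,\ldots,C_i^{p_i}$, and let $h$ be the maximal order of a derivative appearing in the elements of $\mathbb{C}_1,\ldots,\mathbb{C}_n$. In the polynomial ring $R_h=k[\theta y_j:\ 1\le j\le l,\ \theta\in\Theta,\ \operatorname{ord}\theta\le h]$ consider $$I'=\bigcap_{i=1}^n\big(\theta C_i^j:\ 1\le j\le p_i,\ \theta\in\Theta,\ \operatorname{ord}(\theta u_{C_i^j})\le h\big):H_{\mathbb{C}_i}^\infty.$$ Let $\mathbb{C}'$ be an algebraic characteristic set of $I'$ with respect to the ordering of the variables of $R_h$ induced by the ranking. Then the differentially autoreduced subset of $\mathbb{C}'$ of lowest rank is a Kolchin characteristic set of $I$ with respect to the orderly ranking.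
   Context: $\Theta$ is the free commutative monoid of operators $\theta=\delta_1^{k_1}\cdots\delta_m^{k_m}$, $\operatorname{ord}\theta=\sum k_i$; $R$ is the polynomial ring over $k$ in the derivatives $\theta y_j$, the order of $\theta y_j$ being $\operatorname{ord}\theta$. A ranking is a total order on $\{\theta y_j\}$ with $\theta u\ge u$ and $u\ge v\Rightarrow\theta u\ge\theta v$; orderly if $\operatorname{ord}u>\operatorname{ord}v\Rightarrow u>v$. For $f\notin k$: leader $u_f$ = highest ranked derivative in $f$, initial $I_f$ = leading coefficient in $u_f$, separant $S_f=\partial f/\partial u_f$. $f$ is reduced w.r.t. $g$ if no proper derivative of $u_g$ appears in $f$ and $\deg_{u_g}f<\deg_{u_g}g$. A (differentially) autoreduced set is a set disjoint from $k$ each of whose elements is reduced w.r.t. the others; elements are listed in increasing rank ($f<g$ if $u_f<u_g$, or same leader and smaller degree), autoreduced sets compared lexicographically with a proper extension having lower rank. A (Kolchin) characteristic set of a differential ideal is an autoreduced subset of lowest rank. Algebraic notions (algebraically autoreduced set, algebraic characteristic set of a polynomial ideal) are the same with "reduced" meaning only $\deg_{u_g}f<\deg_{u_g}g$. $H_{\mathbb{A}}$ is the product of all initials and separants of elements of $\mathbb{A}$; $J:S^\infty=\{a:\exists s\in S^\infty, sa\in J\}$ with $S^\infty$ the multiplicative set generated by $S$; $[F]$ is the differential ideal generated by $F$. A radical differential ideal $J$ is characterizable if it has a Kolchin characteristic set $\mathbb{A}$ with $J=[\mathbb{A}]:H_{\mathbb{A}}^\infty$. A characteristic decomposition of a radical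 differential ideal $I$ is a representation $I=\bigcap_i[\mathbb{C}_i]:H_{\mathbb{C}_i}^\infty$ where each $[\mathbb{C}_i]:H_{\mathbb{C}_i}^\infty$ is characterizable with Kolchin characteristic set $\mathbb{C}_i$. *)

theory Defs
  imports Main "HOL-Library.Poly_Mapping"
begin

text \<open>A derivative theta y_j is represented by the pair (theta, j), where the derivative
operator theta = delta_1^k_1 ... delta_m^k_m is the finitely supported exponent vector
(nat =>0 nat) with support in the indices 0..m-1 (delta_(i+1) has index i), and j < l
is the index of the indeterminate y_(j+1).\<close>

type_synonym dvar = "(nat \<Rightarrow>\<^sub>0 nat) \<times> nat"

type_synonym 'k dpoly = "(dvar \<Rightarrow>\<^sub>0 nat) \<Rightarrow>\<^sub>0 'k"

definition op_ord :: "(nat \<Rightarrow>\<^sub>0 nat) \<Rightarrow> nat" where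
  "op_ord \<theta> = (\<Sum>i\<in>Poly_Mapping.keys \<theta>. Poly_Mapping.lookup \<theta> i)"

definition var_ord :: "dvar \<Rightarrow> nat" where
  "var_ord v = op_ord (fst v)"

definition valid_op :: "nat \<Rightarrow> (nat \<Rightarrow>\<^sub>0 nat) \<Rightarrow> bool" where
  "valid_op m \<theta> \<longleftrightarrow> Poly_Mapping.keys \<theta> \<subseteq> {..<m}"

definition valid_var :: "nat \<Rightarrow> nat \<Rightarrow> dvar \<Rightarrow> bool" where
  "valid_var m l v \<longleftrightarrow> valid_op m (fst v) \<and> snd v < l"

definition op_var :: "(nat \<Rightarrow>\<^sub>0 nat) \<Rightarrow> dvar \<Rightarrow> dvar" where
  "op_var \<theta> v = (\<theta> + fst v, snd v)"

definition vars :: "'k::zero dpoly \<Rightarrow> dvar set" where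
  "vars f = (\<Union>mon\<in>Poly_Mapping.keys f. Poly_Mapping.keys mon)"

definition Rset :: "nat \<Rightarrow> nat \<Rightarrow> 'k::zero dpoly set" where
  "Rset m l = {f. \<forall>v\<in>vars f. valid_var m l v}"

definition Rh :: "nat \<Rightarrow> nat \<Rightarrow> nat \<Rightarrow> 'k::zero dpoly set" where
  "Rh m l h = {f. \<forall>v\<in>vars f. valid_var m l v \<and> var_ord v \<le> h}"

definition Var :: "dvar \<Rightarrow> 'k::{zero,one} dpoly" where
  "Var v = Poly_Mapping.single (Poly_Mapping.single v 1) 1"

definition deg_in :: "dvar \<Rightarrow> 'k::zero dpoly \<Rightarrow> nat" where
  "deg_in v f = Max (insert 0 ((\<lambda>mon. Poly_Mapping.lookup mon v) ` Poly_Mapping.keys f))"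

definition pderiv_var :: "dvar \<Rightarrow> 'k::comm_ring_1 dpoly \<Rightarrow> 'k dpoly" where
  "pderiv_var v f = (\<Sum>mon\<in>Poly_Mapping.keys f.
      Poly_Mapping.single (Poly_Mapping.update v (Poly_Mapping.lookup mon v - 1) mon)
        (of_nat (Poly_Mapping.lookup mon v) * Poly_Mapping.lookup f mon))"

definition lcoeff_var :: "dvar \<Rightarrow> 'k::comm_ring_1 dpoly \<Rightarrow> 'k dpoly" where
  "lcoeff_var v f = (\<Sum>mon\<in>{mon\<in>Poly_Mapping.keys f. Poly_Mapping.lookup mon v = deg_in v f}.
      Poly_Mapping.single (Poly_Mapping.update v 0 mon) (Poly_Mapping.lookup f mon))"

definition is_derivation :: "('k::comm_ring_1 \<Rightarrow> 'k) \<Rightarrow> bool" where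
  "is_derivation d \<longleftrightarrow> (\<forall>a b. d (a + b) = d a + d b) \<and> (\<forall>a b. d (a * b) = d a * b + a * d b)"

definition diff_field :: "nat \<Rightarrow> (nat \<Rightarrow> 'k::field \<Rightarrow> 'k) \<Rightarrow> bool" where
  "diff_field m \<delta> \<longleftrightarrow> (\<forall>i<m. is_derivation (\<delta> i)) \<and>
     (\<forall>i<m. \<forall>j<m. \<forall>a. \<delta> i (\<delta> j a) = \<delta> j (\<delta> i a))"

text \<open>Extension of delta_i to differential polynomials: the derivation acting on
coefficients by delta_i and sending theta y_j to delta_i theta y_j.\<close>
definition D :: "(nat \<Rightarrow> 'k::comm_ring_1 \<Rightarrow> 'k) \<Rightarrow> nat \<Rightarrow> 'k dpoly \<Rightarrow> 'k dpoly" where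
  "D \<delta> i f = (\<Sum>mon\<in>Poly_Mapping.keys f. Poly_Mapping.single mon (\<delta> i (Poly_Mapping.lookup f mon)))
     + (\<Sum>v\<in>vars f. pderiv_var v f * Var (op_var (Poly_Mapping.single i 1) v))"

definition apply_op :: "(nat \<Rightarrow> 'k::comm_ring_1 \<Rightarrow> 'k) \<Rightarrow> nat \<Rightarrow> (nat \<Rightarrow>\<^sub>0 nat) \<Rightarrow> 'k dpoly \<Rightarrow> 'k dpoly" where
  "apply_op \<delta> m \<theta> f = foldr (\<lambda>i g. (D \<delta> i ^^ Poly_Mapping.lookup \<theta> i) g) [0..<m] f"

definition is_ideal_in :: "'k::comm_ring_1 dpoly set \<Rightarrow> 'k dpoly set \<Rightarrow> bool" where
  "is_ideal_in S J \<longleftrightarrow> J \<subseteq> S \<and> 0 \<in> J \<and> (\<forall>a\<in>J. \<forall>b\<in>J. a + b \<in> J) \<and>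
     (\<forall>a\<in>J. \<forall>s\<in>S. s * a \<in> J)"

definition ideal_gen :: "'k::comm_ring_1 dpoly set \<Rightarrow> 'k dpoly set \<Rightarrow> 'k dpoly set" where
  "ideal_gen S G = \<Inter>{J. is_ideal_in S J \<and> G \<subseteq> J}"

definition is_diff_ideal :: "(nat \<Rightarrow> 'k::field \<Rightarrow> 'k) \<Rightarrow> nat \<Rightarrow> nat \<Rightarrow> 'k dpoly set \<Rightarrow> bool" where
  "is_diff_ideal \<delta> m l J \<longleftrightarrow> is_ideal_in (Rset m l) J \<and> (\<forall>i<m. \<forall>a\<in>J. D \<delta> i a \<in> J)"

definition is_radical_in :: "'k::comm_ring_1 dpoly set \<Rightarrow> 'k dpoly set \<Rightarrow> bool" where
  "is_radical_in S J \<longleftrightarrow> (\<forall>a\<in>S. \<forall>n. a ^ n \<in> J \<longrightarrow> a \<in> J)"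

definition is_radical_diff_ideal :: "(nat \<Rightarrow> 'k::field \<Rightarrow> 'k) \<Rightarrow> nat \<Rightarrow> nat \<Rightarrow> 'k dpoly set \<Rightarrow> bool" where
  "is_radical_diff_ideal \<delta> m l J \<longleftrightarrow> is_diff_ideal \<delta> m l J \<and> is_radical_in (Rset m l) J"

definition diff_ideal_gen :: "(nat \<Rightarrow> 'k::field \<Rightarrow> 'k) \<Rightarrow> nat \<Rightarrow> nat \<Rightarrow> 'k dpoly set \<Rightarrow> 'k dpoly set" where
  "diff_ideal_gen \<delta> m l F = \<Inter>{J. is_diff_ideal \<delta> m l J \<and> F \<subseteq> J}"

definition saturation :: "'k::comm_ring_1 dpoly set \<Rightarrow> 'k dpoly set \<Rightarrow> 'k dpoly set \<Rightarrow> 'k dpoly set" where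
  "saturation S J T = {a\<in>S. \<exists>xs. set xs \<subseteq> T \<and> prod_list xs * a \<in> J}"

text \<open>rk u v means u \<le> v in the ranking.\<close>
definition is_ranking :: "nat \<Rightarrow> nat \<Rightarrow> (dvar \<Rightarrow> dvar \<Rightarrow> bool) \<Rightarrow> bool" where
  "is_ranking m l rk \<longleftrightarrow>
     (\<forall>u. valid_var m l u \<longrightarrow> rk u u) \<and>
     (\<forall>u v. valid_var m l u \<longrightarrow> valid_var m l v \<longrightarrow> rk u v \<longrightarrow> rk v u \<longrightarrow> u = v) \<and>
     (\<forall>u v w. valid_var m l u \<longrightarrow> valid_var m l v \<longrightarrow> valid_var m l w \<longrightarrow> rk u v \<longrightarrow> rk v w \<longrightarrow> rk u w) \<and>
     (\<forall>u v. valid_var m l u \<longrightarrow> valid_var m l v \<longrightarrow> rk u v \<or> rk v u) \<and>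
     (\<forall>\<theta> u. valid_op m \<theta> \<longrightarrow> valid_var m l u \<longrightarrow> rk u (op_var \<theta> u)) \<and>
     (\<forall>\<theta> u v. valid_op m \<theta> \<longrightarrow> valid_var m l u \<longrightarrow> valid_var m l v \<longrightarrow> rk v u \<longrightarrow>
         rk (op_var \<theta> v) (op_var \<theta> u))"

definition is_orderly_ranking :: "nat \<Rightarrow> nat \<Rightarrow> (dvar \<Rightarrow> dvar \<Rightarrow> bool) \<Rightarrow> bool" where
  "is_orderly_ranking m l rk \<longleftrightarrow> is_ranking m l rk \<and>
     (\<forall>u v. valid_var m l u \<longrightarrow> valid_var m l v \<longrightarrow> var_ord u > var_ord v \<longrightarrow> rk v u \<and> u \<noteq> v)"

definition leader :: "(dvar \<Rightarrow> dvar \<Rightarrow> bool) \<Rightarrow> 'k::zero dpoly \<Rightarrow> dvar" where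
  "leader rk f = (THE u. u \<in> vars f \<and> (\<forall>v\<in>vars f. rk v u))"

definition initial :: "(dvar \<Rightarrow> dvar \<Rightarrow> bool) \<Rightarrow> 'k::comm_ring_1 dpoly \<Rightarrow> 'k dpoly" where
  "initial rk f = lcoeff_var (leader rk f) f"

definition separant :: "(dvar \<Rightarrow> dvar \<Rightarrow> bool) \<Rightarrow> 'k::comm_ring_1 dpoly \<Rightarrow> 'k dpoly" where
  "separant rk f = pderiv_var (leader rk f) f"

definition H :: "(dvar \<Rightarrow> dvar \<Rightarrow> bool) \<Rightarrow> 'k::comm_ring_1 dpoly set \<Rightarrow> 'k dpoly" where
  "H rk A = (\<Prod>f\<in>A. initial rk f * separant rk f)"

definition proper_derivative :: "dvar \<Rightarrow> dvar \<Rightarrow> bool" where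
  "proper_derivative v u \<longleftrightarrow> (\<exists>\<theta>. \<theta> \<noteq> 0 \<and> v = op_var \<theta> u)"

definition diff_reduced :: "(dvar \<Rightarrow> dvar \<Rightarrow> bool) \<Rightarrow> 'k::zero dpoly \<Rightarrow> 'k dpoly \<Rightarrow> bool" where
  "diff_reduced rk f g \<longleftrightarrow>
     (\<forall>v\<in>vars f. \<not> proper_derivative v (leader rk g)) \<and>
     deg_in (leader rk g) f < deg_in (leader rk g) g"

definition alg_reduced :: "(dvar \<Rightarrow> dvar \<Rightarrow> bool) \<Rightarrow> 'k::zero dpoly \<Rightarrow> 'k dpoly \<Rightarrow> bool" where
  "alg_reduced rk f g \<longleftrightarrow> deg_in (leader rk g) f < deg_in (leader rk g) g"

definition diff_autoreduced :: "'k::zero dpoly set \<Rightarrow> (dvar \<Rightarrow> dvar \<Rightarrow> bool) \<Rightarrow> 'k dpoly set \<Rightarrow> bool" where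
  "diff_autoreduced S rk A \<longleftrightarrow> finite A \<and> A \<subseteq> S \<and> (\<forall>f\<in>A. vars f \<noteq> {}) \<and>
     (\<forall>f\<in>A. \<forall>g\<in>A. f \<noteq> g \<longrightarrow> diff_reduced rk f g)"

definition alg_autoreduced :: "'k::zero dpoly set \<Rightarrow> (dvar \<Rightarrow> dvar \<Rightarrow> bool) \<Rightarrow> 'k dpoly set \<Rightarrow> bool" where
  "alg_autoreduced S rk A \<longleftrightarrow> finite A \<and> A \<subseteq> S \<and> (\<forall>f\<in>A. vars f \<noteq> {}) \<and>
     (\<forall>f\<in>A. \<forall>g\<in>A. f \<noteq> g \<longrightarrow> alg_reduced rk f g)"

definition poly_rank_less :: "(dvar \<Rightarrow> dvar \<Rightarrow> bool) \<Rightarrow> 'k::zero dpoly \<Rightarrow> 'k dpoly \<Rightarrow> bool" where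
  "poly_rank_less rk f g \<longleftrightarrow>
     (rk (leader rk f) (leader rk g) \<and> leader rk f \<noteq> leader rk g) \<or>
     (leader rk f = leader rk g \<and> deg_in (leader rk f) f < deg_in (leader rk g) g)"

definition poly_rank_eq :: "(dvar \<Rightarrow> dvar \<Rightarrow> bool) \<Rightarrow> 'k::zero dpoly \<Rightarrow> 'k dpoly \<Rightarrow> bool" where
  "poly_rank_eq rk f g \<longleftrightarrow>
     leader rk f = leader rk g \<and> deg_in (leader rk f) f = deg_in (leader rk g) g"

definition as_list :: "(dvar \<Rightarrow> dvar \<Rightarrow> bool) \<Rightarrow> 'k::zero dpoly set \<Rightarrow> 'k dpoly list" where
  "as_list rk A = (THE xs. set xs = A \<and> distinct xs \<and> sorted_wrt (poly_rank_less rk) xs)"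

definition set_rank_less :: "(dvar \<Rightarrow> dvar \<Rightarrow> bool) \<Rightarrow> 'k::zero dpoly set \<Rightarrow> 'k dpoly set \<Rightarrow> bool" where
  "set_rank_less rk A B \<longleftrightarrow>
     (let xs = as_list rk A; ys = as_list rk B in
       (\<exists>i < min (length xs) (length ys).
          (\<forall>j<i. poly_rank_eq rk (xs ! j) (ys ! j)) \<and> poly_rank_less rk (xs ! i) (ys ! i)) \<or>
       (length ys < length xs \<and> (\<forall>j<length ys. poly_rank_eq rk (xs ! j) (ys ! j))))"

definition kolchin_charset :: "nat \<Rightarrow> nat \<Rightarrow> (dvar \<Rightarrow> dvar \<Rightarrow> bool) \<Rightarrow> 'k::zero dpoly set \<Rightarrow> 'k dpoly set \<Rightarrow> bool" where
  "kolchin_charset m l rk J A \<longleftrightarrow> diff_autoreduced (Rset m l) rk A \<and> A \<subseteq> J \<and>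
     (\<forall>B. diff_autoreduced (Rset m l) rk B \<and> B \<subseteq> J \<longrightarrow> \<not> set_rank_less rk B A)"

definition alg_charset :: "'k::zero dpoly set \<Rightarrow> (dvar \<Rightarrow> dvar \<Rightarrow> bool) \<Rightarrow> 'k dpoly set \<Rightarrow> 'k dpoly set \<Rightarrow> bool" where
  "alg_charset S rk J A \<longleftrightarrow> alg_autoreduced S rk A \<and> A \<subseteq> J \<and>
     (\<forall>B. alg_autoreduced S rk B \<and> B \<subseteq> J \<longrightarrow> \<not> set_rank_less rk B A)"

definition characterizable_by :: "(nat \<Rightarrow> 'k::field \<Rightarrow> 'k) \<Rightarrow> nat \<Rightarrow> nat \<Rightarrow> (dvar \<Rightarrow> dvar \<Rightarrow> bool) \<Rightarrow> 'k dpoly set \<Rightarrow> 'k dpoly set \<Rightarrow> bool" where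
  "characterizable_by \<delta> m l rk J A \<longleftrightarrow> is_radical_diff_ideal \<delta> m l J \<and> kolchin_charset m l rk J A \<and>
     J = saturation (Rset m l) (diff_ideal_gen \<delta> m l A) {H rk A}"

end

(*
Put J_i = [C_i] : H_(C_i)^oo. Since C_i is a characteristic set of J_i, every element of J_i has
remainder 0 modulo C_i; as the ranking is orderly, reducing an element of R_h only involves
derivatives of C_i of order at most h. Hence the i-th component of I' is the intersection of J_i
with R_h, and I' is the intersection of I with R_h; no coherence argument (Rosenfeld's lemma) is needed.

Let C_0 be the given characteristic set of I. By consistency no product of initials and separants
of C_0 has remainder 0 modulo C_0. This has two consequences.
- The leaders of C_0 have order at most h. For each i, either H_(C_0) lies in J_i, or every
  leader of C_0 is a derivative of a leader of C_i; if in the latter case some leader of C_i is not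
  a derivative of a leader of C_0, then linear algebra yields a nonzero element of J_i not involving
  any derivative of a leader of C_0.
- By induction along the ranking, the leaders of C' are exactly the derivatives of order at most h
  of leaders of C_0, with the degree of the corresponding element of C_0 for the leaders of C_0
  themselves and with degree 1 for their proper derivatives.
So the elements of C' that share their leader with an element of C_0 form a differentially
autoreduced set of the same rank as C_0.
*)
theory Submission
  imports Defs "HOL-Library.Product_Lexorder"
begin

text \<open>The obstacle is that reduction may destroy a leader. Where a leader v has to survive,
  the coefficient of the top power of v and the remaining part are reduced separately, with one
  common multiplier, and reassembled; v is still the leader as soon as the remainder p of the
  coefficient is nonzero. For a separant of \<open>C0\<close> consistency gives p \<noteq> 0; for a
  characterizable ideal p = 0 means that the coefficient itself lies in the ideal. Both halves of
  the argument on leaders rest on this device. Since I is an intersection and need not equal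
  [C0]:H^oo, the product H of the initials and separants of \<open>C0\<close> may lie in some J_i;
  those components are handled by a remainder of H instead of by a relation. Contradictions come
  from nonzero reduced elements. Minimality of a characteristic set excludes only nonconstant ones,
  so properness of each J_i has to be proved as well; it is not part of the definition of
  characterizable and is obtained by evaluation at a point of the base field.\<close>

abbreviation lk :: "('a \<Rightarrow>\<^sub>0 'b::zero) \<Rightarrow> 'a \<Rightarrow> 'b" where
  "lk \<equiv> Poly_Mapping.lookup"

abbreviation mons :: "('a \<Rightarrow>\<^sub>0 'b::zero) \<Rightarrow> 'a set" where
  "mons \<equiv> Poly_Mapping.keys"

subsection \<open>Variables and degrees\<close>

text \<open>The subring k[X]. \<open>Rset\<close>, \<open>Rh\<close> and the rings of initial
  segments of the ranking all have this form, so their closure properties are proved once.\<close>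

definition polys :: "dvar set \<Rightarrow> 'k::zero dpoly set" where
  "polys X = {f. vars f \<subseteq> X}"

lemma Rset_eq_polys: "Rset m l = polys {v. valid_var m l v}"
  by (auto simp: Rset_def polys_def)

lemma Rh_eq_polys: "Rh m l h = polys {v. valid_var m l v \<and> var_ord v \<le> h}"
  by (auto simp: Rh_def polys_def)

lemma finite_vars [simp]: "finite (vars f)"
  by (auto simp: vars_def)

lemma in_vars_iff: "v \<in> vars f \<longleftrightarrow> (\<exists>mon\<in>mons f. lk mon v \<noteq> 0)"
  by (auto simp: vars_def in_keys_iff)

lemma vars_add: "vars (f + g) \<subseteq> vars f \<union> vars g"
  using keys_add[of f g] by (auto simp: vars_def)

lemma vars_mult: "vars (f * g) \<subseteq> vars f \<union> vars (g :: 'k::comm_ring_1 dpoly)"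
proof
  fix v assume "v \<in> vars (f * g)"
  then obtain mon where "mon \<in> mons (f * g)" "v \<in> mons mon" by (auto simp: vars_def)
  then obtain a b where ab: "a \<in> mons f" "b \<in> mons g" "v \<in> mons (a + b)"
    using keys_mult[of f g] by auto
  then have "v \<in> mons a \<or> v \<in> mons b" using keys_add[of a b] by auto
  then show "v \<in> vars f \<union> vars g" using ab by (auto simp: vars_def)
qed

lemma vars_uminus [simp]: "vars (- f) = vars (f :: 'k::comm_ring_1 dpoly)"
  by (simp add: vars_def in_keys_iff set_eq_iff)

lemma vars_0 [simp]: "vars 0 = {}"
  by (simp add: vars_def)

lemma vars_single: "vars (Poly_Mapping.single mon c) \<subseteq> mons mon"
  by (auto simp: vars_def split: if_splits)

lemma vars_1 [simp]: "vars (1 :: 'k::comm_ring_1 dpoly) = {}"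
  by (auto simp: vars_def)

lemma vars_Var: "vars (Var v :: 'k::comm_ring_1 dpoly) \<subseteq> {v}"
  unfolding Var_def using vars_single by fastforce

lemma polys_mono: "X \<subseteq> Y \<Longrightarrow> f \<in> polys X \<Longrightarrow> f \<in> polys Y"
  by (auto simp: polys_def)

lemma polys_add: "f \<in> polys X \<Longrightarrow> g \<in> polys X \<Longrightarrow> f + g \<in> polys X"
  using vars_add[of f g] by (auto simp: polys_def)

lemma polys_mult: "f \<in> polys X \<Longrightarrow> g \<in> polys X \<Longrightarrow> f * g \<in> polys X"
  for f :: "'k::comm_ring_1 dpoly"
  using vars_mult[of f g] by (auto simp: polys_def)

lemma polys_uminus: "f \<in> polys X \<Longrightarrow> - f \<in> polys X" for f :: "'k::comm_ring_1 dpoly"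
  by (auto simp: polys_def)

lemma polys_diff: "f \<in> polys X \<Longrightarrow> g \<in> polys X \<Longrightarrow> f - g \<in> polys X"
  for f :: "'k::comm_ring_1 dpoly"
  using polys_add[of f X "- g"] polys_uminus[of g X] by simp

lemma polys_0 [simp]: "0 \<in> polys X"
  by (simp add: polys_def)

lemma polys_1 [simp]: "(1 :: 'k::comm_ring_1 dpoly) \<in> polys X"
  by (simp add: polys_def)

lemma polys_Var: "v \<in> X \<Longrightarrow> (Var v :: 'k::comm_ring_1 dpoly) \<in> polys X"
  using vars_Var[of v] by (auto simp: polys_def)

lemma polys_single: "mons mon \<subseteq> X \<Longrightarrow> Poly_Mapping.single mon c \<in> polys X"
  using vars_single[of mon c] by (auto simp: polys_def)

lemma polys_sum: "(\<And>a. a \<in> A \<Longrightarrow> f a \<in> polys X) \<Longrightarrow> sum f A \<in> polys X"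
  for f :: "'a \<Rightarrow> 'k::comm_ring_1 dpoly"
  by (induction A rule: infinite_finite_induct) (auto intro: polys_add)

lemma polys_prod: "(\<And>a. a \<in> A \<Longrightarrow> f a \<in> polys X) \<Longrightarrow> prod f A \<in> polys X"
  for f :: "'a \<Rightarrow> 'k::comm_ring_1 dpoly"
  by (induction A rule: infinite_finite_induct) (auto intro: polys_mult)

lemma polys_power: "f \<in> polys X \<Longrightarrow> f ^ n \<in> polys X" for f :: "'k::comm_ring_1 dpoly"
  by (induction n) (auto intro: polys_mult)

lemma deg_in_le_iff: "deg_in v f \<le> e \<longleftrightarrow> (\<forall>mon\<in>mons f. lk mon v \<le> e)"
  unfolding deg_in_def by (subst Max_le_iff) auto

lemma deg_in_less_iff: "deg_in v f < e \<longleftrightarrow> 0 < e \<and> (\<forall>mon\<in>mons f. lk mon v < e)"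
  unfolding deg_in_def by (subst Max_less_iff) auto

lemma lookup_le_deg_in: "mon \<in> mons f \<Longrightarrow> lk mon v \<le> deg_in v f"
  using deg_in_le_iff by blast

lemma deg_in_eq_0_iff: "deg_in v f = 0 \<longleftrightarrow> v \<notin> vars f"
  using deg_in_le_iff[of v f 0] by (auto simp: in_vars_iff)

lemma deg_in_pos_iff: "0 < deg_in v f \<longleftrightarrow> v \<in> vars f"
  using deg_in_eq_0_iff[of v f] by auto

lemma deg_in_add: "deg_in v (f + g) \<le> max (deg_in v f) (deg_in v g)"
  unfolding deg_in_le_iff
  using keys_add[of f g] lookup_le_deg_in[of _ f v] lookup_le_deg_in[of _ g v]
  by (fastforce simp: le_max_iff_disj)

lemma deg_in_uminus [simp]: "deg_in v (- f) = deg_in v (f :: 'k::comm_ring_1 dpoly)"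
proof -
  have "mons (- f) = mons f" by (auto simp: in_keys_iff)
  then show ?thesis by (simp add: deg_in_def)
qed

lemma deg_in_diff: "deg_in v (f - g) \<le> max (deg_in v f) (deg_in v g)"
  for f :: "'k::comm_ring_1 dpoly"
  using deg_in_add[of v f "- g"] by simp

lemma deg_in_mult: "deg_in v (f * g) \<le> deg_in v f + deg_in v g"
  for f :: "'k::comm_ring_1 dpoly"
  unfolding deg_in_le_iff
proof
  fix mon assume "mon \<in> mons (f * g)"
  then obtain a b where "a \<in> mons f" "b \<in> mons g" "mon = a + b"
    using keys_mult[of f g] by auto
  then show "lk mon v \<le> deg_in v f + deg_in v g"
    by (simp add: lookup_add add_mono lookup_le_deg_in)
qed

lemma deg_in_sum: "(\<And>a. a \<in> A \<Longrightarrow> deg_in v (f a) \<le> e) \<Longrightarrow> deg_in v (sum f A) \<le> e"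
proof (induction A rule: infinite_finite_induct)
  case (insert a A)
  then show ?case using deg_in_add[of v "f a" "sum f A"] by fastforce
qed (auto simp: deg_in_def)

lemma Var_power: "Var v ^ p = Poly_Mapping.single (Poly_Mapping.single v p) (1 :: 'k::comm_ring_1)"
  by (induction p) (auto simp: Var_def mult_single simp flip: single_add)

lemma deg_in_single: "deg_in v (Poly_Mapping.single mon c) \<le> lk mon v"
  by (simp add: deg_in_le_iff)

lemma deg_in_Var_power: "deg_in x (Var v ^ p :: 'k::comm_ring_1 dpoly) \<le> (if x = v then p else 0)"
  using deg_in_single[of x "Poly_Mapping.single v p" "1 :: 'k"]
  by (auto simp: Var_power lookup_single when_def)

lemma poly_eq_sum_single: "f = (\<Sum>mon\<in>mons f. Poly_Mapping.single mon (lk f mon))"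
proof (rule poly_mapping_eqI)
  fix k
  have "(\<Sum>mon\<in>mons f. lk (Poly_Mapping.single mon (lk f mon)) k)
      = (\<Sum>mon\<in>mons f. if mon = k then lk f k else 0)"
    by (intro sum.cong) (auto simp: lookup_single when_def)
  also have "\<dots> = lk f k" by (auto simp: in_keys_iff)
  finally show "lk f k = lk (\<Sum>mon\<in>mons f. Poly_Mapping.single mon (lk f mon)) k"
    by (simp add: lookup_sum)
qed

text \<open>Extends \<open>lcoeff_var\<close> to an arbitrary exponent: pseudo-division removes the
  coefficient of a prescribed top power, which may be zero.\<close>

definition coeff_var :: "dvar \<Rightarrow> nat \<Rightarrow> 'k::comm_ring_1 dpoly \<Rightarrow> 'k dpoly" where
  "coeff_var v p f = (\<Sum>mon\<in>{mon\<in>mons f. lk mon v = p}.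
      Poly_Mapping.single (Poly_Mapping.update v 0 mon) (lk f mon))"

lemma lcoeff_var_eq: "lcoeff_var v f = coeff_var v (deg_in v f) f"
  by (simp add: lcoeff_var_def coeff_var_def)

lemma vars_coeff_var: "vars (coeff_var v p f) \<subseteq> vars f - {v}"
proof -
  have "coeff_var v p f \<in> polys (vars f - {v})"
    unfolding coeff_var_def
    by (intro polys_sum polys_single) (auto simp: keys_update vars_def)
  then show ?thesis by (simp add: polys_def)
qed

text \<open>Here p is only an upper bound for the degree. The bounds in all other variables x are
  recorded because successive reductions must not raise the degree in variables above the one being
  reduced.\<close>

lemma split_coeff_var:
  fixes f :: "'k::comm_ring_1 dpoly"
  assumes "deg_in v f \<le> p"
  obtains q where "f = coeff_var v p f * Var v ^ p + q" "p > 0 \<Longrightarrow> deg_in v q < p"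
    "p = 0 \<Longrightarrow> q = 0" "vars q \<subseteq> vars f" "\<And>x. deg_in x q \<le> deg_in x f"
    "\<And>x. deg_in x (coeff_var v p f) \<le> deg_in x f"
proof
  define q where "q = (\<Sum>mon\<in>{mon\<in>mons f. lk mon v \<noteq> p}. Poly_Mapping.single mon (lk f mon))"
  have kq: "mons q \<subseteq> {mon\<in>mons f. lk mon v \<noteq> p}"
  proof
    fix k assume k: "k \<in> mons q"
    show "k \<in> {mon\<in>mons f. lk mon v \<noteq> p}"
    proof (rule ccontr)
      assume "\<not> ?thesis"
      then have "lk q k = 0" unfolding q_def lookup_sum
        by (intro sum.neutral) (auto simp: lookup_single when_def)
      with k show False by (simp add: in_keys_iff)
    qed
  qed
  have upd: "Poly_Mapping.update v 0 mon + Poly_Mapping.single v (lk mon v) = mon" for mon :: "dvar \<Rightarrow>\<^sub>0 nat"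
    by (rule poly_mapping_eqI) (auto simp: lookup_add lookup_update lookup_single when_def)
  have "coeff_var v p f * Var v ^ p
      = (\<Sum>mon\<in>{mon\<in>mons f. lk mon v = p}. Poly_Mapping.single mon (lk f mon))"
    unfolding coeff_var_def sum_distrib_right
  proof (rule sum.cong)
    fix mon assume "mon \<in> {mon\<in>mons f. lk mon v = p}"
    then show "Poly_Mapping.single (Poly_Mapping.update v 0 mon) (lk f mon) * Var v ^ p
        = Poly_Mapping.single mon (lk f mon)"
      using upd[of mon] by (simp add: Var_power mult_single)
  qed auto
  moreover have "(\<Sum>mon\<in>mons f. Poly_Mapping.single mon (lk f mon)) =
     (\<Sum>mon\<in>{mon\<in>mons f. lk mon v = p}. Poly_Mapping.single mon (lk f mon)) + q"
    unfolding q_def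
    by (subst sum.union_disjoint[symmetric]) (auto intro!: sum.cong)
  ultimately show "f = coeff_var v p f * Var v ^ p + q"
    using poly_eq_sum_single[of f] by simp
  show "deg_in v q < p" if "p > 0"
    using that kq assms unfolding deg_in_less_iff deg_in_le_iff by fastforce
  show "q = 0" if "p = 0"
  proof -
    have "mons q = {}" using that kq assms unfolding deg_in_le_iff by fastforce
    then show ?thesis by simp
  qed
  show "vars q \<subseteq> vars f" using kq by (auto simp: vars_def)
  show "deg_in x q \<le> deg_in x f" for x
    using kq lookup_le_deg_in[of _ f x] by (auto simp: deg_in_le_iff)
  show "deg_in x (coeff_var v p f) \<le> deg_in x f" for x
  proof -
    have "deg_in x (Poly_Mapping.single (Poly_Mapping.update v 0 mon) (lk f mon)) \<le> deg_in x f"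
      if "mon \<in> mons f" for mon
      using deg_in_single[of x "Poly_Mapping.update v 0 mon" "lk f mon"] lookup_le_deg_in[OF that, of x]
      by (auto simp: lookup_update split: if_splits)
    then show ?thesis unfolding coeff_var_def by (intro deg_in_sum) auto
  qed
qed

lemma lookup_mult_Var_power:
  fixes p :: "'k::comm_ring_1 dpoly"
  assumes "v \<notin> vars p" "lk mon v = 0"
  shows "lk (p * Var v ^ d) (mon + Poly_Mapping.single v d) = lk p mon"
proof -
  have eq: "k + Poly_Mapping.single v d = mon + Poly_Mapping.single v d \<longleftrightarrow> k = mon" for k
    by simp
  have "p * Var v ^ d = (\<Sum>k\<in>mons p. Poly_Mapping.single (k + Poly_Mapping.single v d) (lk p k))"
    by (subst poly_eq_sum_single[of p]) (simp add: sum_distrib_right Var_power mult_single)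
  then have "lk (p * Var v ^ d) (mon + Poly_Mapping.single v d)
    = (\<Sum>k\<in>mons p. lk p k when k = mon)"
    by (simp add: lookup_sum lookup_single)
  also have "\<dots> = lk p mon"
    by (auto simp: when_def in_keys_iff)
  finally show ?thesis .
qed

lemma deg_in_lead_form:
  fixes p :: "'k::comm_ring_1 dpoly"
  assumes "p \<noteq> 0" "v \<notin> vars p" "deg_in v q < d"
  shows "deg_in v (p * Var v ^ d + q) = d"
proof (rule antisym)
  have "deg_in v (p * Var v ^ d) \<le> d"
    using deg_in_mult[of v p "Var v ^ d"] deg_in_Var_power[of v v d, where 'k = 'k] assms(2)
    unfolding deg_in_eq_0_iff[symmetric] by simp
  then show "deg_in v (p * Var v ^ d + q) \<le> d"
    using deg_in_add[of v "p * Var v ^ d" q] assms(3) by linarith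
  obtain mon where mon: "mon \<in> mons p" using assms(1) by fastforce
  have m0: "lk mon v = 0" using assms(2) mon by (auto simp: in_vars_iff)
  let ?k = "mon + Poly_Mapping.single v d"
  have "lk q ?k = 0"
    using lookup_le_deg_in[of ?k q v] assms(3) m0
    by (auto simp: lookup_add lookup_single in_keys_iff)
  then have "lk (p * Var v ^ d + q) ?k = lk p mon"
    by (simp add: lookup_add lookup_mult_Var_power[OF assms(2) m0])
  with mon have "?k \<in> mons (p * Var v ^ d + q)" by (simp add: in_keys_iff)
  from lookup_le_deg_in[OF this, of v] m0 show "d \<le> deg_in v (p * Var v ^ d + q)"
    by (simp add: lookup_add)
qed

subsection \<open>Comparing autoreduced sets\<close>

text \<open>Justifies the \<open>THE\<close> in \<open>as_list\<close>. Existence: a new element is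
  put between those below and those above it. Uniqueness: the head of each list is its least
  element, so the heads agree.\<close>

lemma ex1_sorted_wrt:
  assumes "finite A"
    and irrefl: "\<And>x. x \<in> A \<Longrightarrow> \<not> P x x"
    and trans: "\<And>x y z. x \<in> A \<Longrightarrow> y \<in> A \<Longrightarrow> z \<in> A \<Longrightarrow> P x y \<Longrightarrow> P y z \<Longrightarrow> P x z"
    and total: "\<And>x y. x \<in> A \<Longrightarrow> y \<in> A \<Longrightarrow> x \<noteq> y \<Longrightarrow> P x y \<or> P y x"
  shows "\<exists>!xs. set xs = A \<and> distinct xs \<and> sorted_wrt P xs"
proof -
  have ex: "\<exists>xs. set xs = B \<and> distinct xs \<and> sorted_wrt P xs" if "B \<subseteq> A" for B
    using finite_subset[OF that \<open>finite A\<close>] that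
  proof (induction B rule: finite_induct)
    case (insert x B)
    then obtain xs where xs: "set xs = B" "distinct xs" "sorted_wrt P xs" by auto
    have asym: "\<not> P x z" if "z \<in> B" "P z x" for z
      using that trans[of z x z] irrefl[of z] insert.prems by auto
    have mid: "P z z'" if "z \<in> B" "z' \<in> B" "P z x" "P x z'" for z z'
      using that trans[of z x z'] insert.prems by auto
    have tot: "P z x \<or> P x z" if "z \<in> B" for z
      using that total[of z x] insert.prems insert.hyps by auto
    let ?ys = "filter (\<lambda>y. P y x) xs @ [x] @ filter (\<lambda>y. P x y) xs"
    have "set ?ys = insert x B" using xs(1) tot by auto
    moreover have "distinct ?ys"
      using xs insert.hyps asym by auto
    moreover have "sorted_wrt P ?ys"
      using xs mid by (simp add: sorted_wrt_append sorted_wrt_filter)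
    ultimately show ?case by blast
  qed auto
  have uniq: "xs = ys"
    if "sorted_wrt P xs" "sorted_wrt P ys" "set xs = set ys" "set xs \<subseteq> A" "distinct xs" "distinct ys" for xs ys
    using that
  proof (induction xs arbitrary: ys)
    case (Cons x xs)
    then obtain y ys' where ys: "ys = y # ys'" by (cases ys) auto
    have inA: "x \<in> A" "y \<in> A" using Cons.prems ys by auto
    have "x = y"
    proof (rule ccontr)
      assume "x \<noteq> y"
      moreover have "y \<in> set (x # xs)" "x \<in> set (y # ys')" using Cons.prems(3) ys by auto
      ultimately have "P x y" "P y x" using Cons.prems(1,2) ys by auto
      then show False using trans[OF inA(1,2,1)] irrefl[OF inA(1)] by blast
    qed
    moreover have "set xs = set ys'"
      using Cons.prems(3,5,6) ys \<open>x = y\<close> by (auto simp: set_eq_iff)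
    ultimately show ?case using Cons.IH[of ys'] Cons.prems ys by simp
  qed auto
  from ex[of A] obtain xs where "set xs = A" "distinct xs" "sorted_wrt P xs" by blast
  then show ?thesis using uniq by (intro ex1I[of _ xs]) simp_all
qed

text \<open>Equal heads drop out of both sets. Of two different heads the smaller one is the least
  element of the symmetric difference, as everything later in either list lies above it. For a
  proper extension the surplus elements are the whole difference.\<close>

lemma lexicographic_sorted_wrt_iff:
  assumes irrefl: "\<And>x. x \<in> T \<Longrightarrow> \<not> P x x"
    and trans: "\<And>x y z. x \<in> T \<Longrightarrow> y \<in> T \<Longrightarrow> z \<in> T \<Longrightarrow> P x y \<Longrightarrow> P y z \<Longrightarrow> P x z"
    and total: "\<And>x y. x \<in> T \<Longrightarrow> y \<in> T \<Longrightarrow> x \<noteq> y \<Longrightarrow> P x y \<or> P y x"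
    and "sorted_wrt P xs" "sorted_wrt P ys" "set xs \<subseteq> T" "set ys \<subseteq> T"
  shows "((\<exists>i<min (length xs) (length ys). (\<forall>j<i. xs ! j = ys ! j) \<and> P (xs ! i) (ys ! i)) \<or>
       (length ys < length xs \<and> (\<forall>j<length ys. xs ! j = ys ! j)))
     \<longleftrightarrow> (\<exists>k\<in>set xs - set ys. \<forall>k'\<in>set xs \<union> set ys. P k' k \<longrightarrow> (k' \<in> set xs \<longleftrightarrow> k' \<in> set ys))"
    (is "?L xs ys \<longleftrightarrow> ?R xs ys")
  using assms(4-)
proof (induction xs arbitrary: ys)
  case Nil
  then show ?case by simp
next
  case (Cons x xs)
  have xT: "x \<in> T" and xs: "\<And>z. z \<in> set xs \<Longrightarrow> P x z" using Cons.prems by auto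
  have noP: "\<not> P z x" if "z \<in> set (x # xs)" for z
    using that xs irrefl[of x] trans[of x z x] Cons.prems by auto
  show ?case
  proof (cases ys)
    case Nil
    have "?R (x # xs) ys" unfolding Nil using noP by (intro bexI[of _ x]) auto
    then show ?thesis unfolding Nil by simp
  next
    case (Cons y ys')
    have yT: "y \<in> T" and ys': "\<And>z. z \<in> set ys' \<Longrightarrow> P y z" "set ys' \<subseteq> T"
      using \<open>sorted_wrt P ys\<close> \<open>set ys \<subseteq> T\<close> Cons by auto
    consider "x = y" | "x \<noteq> y" "P x y" | "x \<noteq> y" "P y x" using total[OF xT yT] by blast
    then show ?thesis
    proof cases
      case 1
      have nx: "x \<notin> set xs" "x \<notin> set ys'" using xs ys' irrefl[OF xT] 1 by auto
      have "?L (x # xs) ys \<longleftrightarrow> ?L xs ys'"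
        unfolding Cons using 1 irrefl[OF xT] by (auto simp: Ex_less_Suc2 All_less_Suc2)
      also have "\<dots> \<longleftrightarrow> ?R xs ys'"
        by (rule Cons.IH) (use Cons.prems Cons in auto)
      also have "\<dots> \<longleftrightarrow> ?R (x # xs) ys"
        unfolding Cons using 1 nx by auto
      finally show ?thesis .
    next
      case 2
      have Py: "P x z" if "z \<in> set ys" for z
        using that Cons 2 ys' trans[of x y z] xT yT by auto
      have "\<not> P z x" if "z \<in> set ys" for z
        using that Py[OF that] trans[of x z x] irrefl[OF xT] xT \<open>set ys \<subseteq> T\<close> by auto
      moreover have "x \<notin> set ys" using Py irrefl[OF xT] by auto
      ultimately have "?R (x # xs) ys" using noP by (intro bexI[of _ x]) auto
      moreover have "?L (x # xs) ys" unfolding Cons using 2 by (auto simp: Ex_less_Suc2)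
      ultimately show ?thesis by blast
    next
      case 3
      have Py: "P y z" if "z \<in> set (x # xs)" for z
        using that 3 xs trans[of y x z] xT yT Cons.prems by auto
      then have "y \<notin> set (x # xs)" using irrefl[OF yT] by blast
      then have "\<not> ?R (x # xs) ys" using Py Cons by auto
      moreover have "\<not> ?L (x # xs) ys"
        unfolding Cons using 3 irrefl trans[of x y x] xT yT by (auto simp: Ex_less_Suc2 All_less_Suc2)
      ultimately show ?thesis by blast
    qed
  qed
qed

text \<open>The rank of a polynomial as a value: \<open>poly_rank_eq\<close> becomes equality of
  keys, and comparing autoreduced sets becomes comparing finite sets of pairs.\<close>

definition key :: "(dvar \<Rightarrow> dvar \<Rightarrow> bool) \<Rightarrow> 'k::zero dpoly \<Rightarrow> dvar \<times> nat" where
  "key rk f = (leader rk f, deg_in (leader rk f) f)"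

definition key_less :: "(dvar \<Rightarrow> dvar \<Rightarrow> bool) \<Rightarrow> dvar \<times> nat \<Rightarrow> dvar \<times> nat \<Rightarrow> bool" where
  "key_less rk a b \<longleftrightarrow> (rk (fst a) (fst b) \<and> fst a \<noteq> fst b) \<or> (fst a = fst b \<and> snd a < snd b)"

text \<open>For finite sets of keys, the lexicographic comparison of their increasing enumerations
  (proper extensions being lower) asks on which side the least element of the symmetric
  difference lies.\<close>
definition keys_less :: "(dvar \<Rightarrow> dvar \<Rightarrow> bool) \<Rightarrow> (dvar \<times> nat) set \<Rightarrow> (dvar \<times> nat) set \<Rightarrow> bool" where
  "keys_less rk K L \<longleftrightarrow> (\<exists>k\<in>K - L. \<forall>k'\<in>K \<union> L. key_less rk k' k \<longrightarrow> (k' \<in> K \<longleftrightarrow> k' \<in> L))"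

lemma poly_rank_less_iff: "poly_rank_less rk f g \<longleftrightarrow> key_less rk (key rk f) (key rk g)"
  by (auto simp: poly_rank_less_def key_less_def key_def)

lemma poly_rank_eq_iff: "poly_rank_eq rk f g \<longleftrightarrow> key rk f = key rk g"
  by (auto simp: poly_rank_eq_def key_def)

section \<open>Orderly rankings, leaders, and the rank of finite sets of polynomials\<close>

locale orderly_ranking =
  fixes m l :: nat and rk :: "dvar \<Rightarrow> dvar \<Rightarrow> bool"
  assumes orderly: "is_orderly_ranking m l rk"
begin

abbreviation valid :: "dvar \<Rightarrow> bool" where
  "valid \<equiv> valid_var m l"

definition lt :: "dvar \<Rightarrow> dvar \<Rightarrow> bool" where
  "lt u v \<longleftrightarrow> rk u v \<and> u \<noteq> v"

lemma ranking: "is_ranking m l rk"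
  using orderly by (simp add: is_orderly_ranking_def)

lemma rk_refl: "valid u \<Longrightarrow> rk u u"
  using ranking unfolding is_ranking_def by blast

lemma rk_antisym: "valid u \<Longrightarrow> valid v \<Longrightarrow> rk u v \<Longrightarrow> rk v u \<Longrightarrow> u = v"
  using ranking unfolding is_ranking_def by blast

lemma rk_trans: "valid u \<Longrightarrow> valid v \<Longrightarrow> valid w \<Longrightarrow> rk u v \<Longrightarrow> rk v w \<Longrightarrow> rk u w"
  using ranking unfolding is_ranking_def by blast

lemma rk_total: "valid u \<Longrightarrow> valid v \<Longrightarrow> rk u v \<or> rk v u"
  using ranking unfolding is_ranking_def by blast

lemma rk_op_var: "valid_op m \<theta> \<Longrightarrow> valid u \<Longrightarrow> rk u (op_var \<theta> u)"
  using ranking unfolding is_ranking_def by blast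

lemma rk_op_var_mono: "valid_op m \<theta> \<Longrightarrow> valid u \<Longrightarrow> valid v \<Longrightarrow> rk v u \<Longrightarrow> rk (op_var \<theta> v) (op_var \<theta> u)"
  using ranking unfolding is_ranking_def by blast

lemma lt_trans: "valid u \<Longrightarrow> valid v \<Longrightarrow> valid w \<Longrightarrow> lt u v \<Longrightarrow> lt v w \<Longrightarrow> lt u w"
  unfolding lt_def using rk_trans rk_antisym by blast

lemma rk_lt_trans: "valid u \<Longrightarrow> valid v \<Longrightarrow> valid w \<Longrightarrow> rk u v \<Longrightarrow> lt v w \<Longrightarrow> lt u w"
  unfolding lt_def using rk_trans rk_antisym by blast

lemma lt_rk_trans: "valid u \<Longrightarrow> valid v \<Longrightarrow> valid w \<Longrightarrow> lt u v \<Longrightarrow> rk v w \<Longrightarrow> lt u w"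
  unfolding lt_def using rk_trans rk_antisym by blast

lemma lt_not_rk: "valid u \<Longrightarrow> valid v \<Longrightarrow> lt u v \<Longrightarrow> \<not> rk v u"
  unfolding lt_def using rk_antisym by blast

lemma lt_imp_rk: "lt u v \<Longrightarrow> rk u v"
  by (simp add: lt_def)

text \<open>The form in which orderliness, beyond the ranking axioms, is used everywhere: it makes
  initial segments finite and keeps reductions inside \<open>Rh\<close>.\<close>

lemma var_ord_mono: "valid u \<Longrightarrow> valid v \<Longrightarrow> rk u v \<Longrightarrow> var_ord u \<le> var_ord v"
  using orderly rk_antisym unfolding is_orderly_ranking_def by (metis linorder_not_le)

lemma op_var_0 [simp]: "op_var 0 v = v"
  by (simp add: op_var_def)

lemma op_var_op_var: "op_var \<theta> (op_var \<theta>' v) = op_var (\<theta> + \<theta>') v"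
  by (simp add: op_var_def add.assoc)

lemma op_var_eq_iff [simp]: "op_var \<theta> u = op_var \<theta> v \<longleftrightarrow> u = v"
  by (auto simp: op_var_def prod_eq_iff)

lemma op_var_eq_self_iff [simp]: "op_var \<theta> u = u \<longleftrightarrow> \<theta> = 0"
  by (auto simp: op_var_def prod_eq_iff)

lemma valid_op_0 [simp]: "valid_op m 0"
  by (simp add: valid_op_def)

lemma valid_op_add: "valid_op m (\<theta> + \<theta>') \<longleftrightarrow> valid_op m \<theta> \<and> valid_op m \<theta>'"
proof -
  have "mons (\<theta> + \<theta>') = mons \<theta> \<union> mons \<theta>'"
    by (auto simp: in_keys_iff lookup_add)
  then show ?thesis by (simp add: valid_op_def)
qed

lemma valid_op_var: "valid (op_var \<theta> u) \<longleftrightarrow> valid_op m \<theta> \<and> valid u"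
  by (auto simp: valid_var_def op_var_def valid_op_add)

lemma lt_op_var: "valid_op m \<theta> \<Longrightarrow> valid u \<Longrightarrow> \<theta> \<noteq> 0 \<Longrightarrow> lt u (op_var \<theta> u)"
  using rk_op_var[of \<theta> u] unfolding lt_def by (metis op_var_eq_self_iff)

lemma lt_op_var_mono: "valid_op m \<theta> \<Longrightarrow> valid u \<Longrightarrow> valid v \<Longrightarrow> lt v u \<Longrightarrow> lt (op_var \<theta> v) (op_var \<theta> u)"
  by (simp add: lt_def rk_op_var_mono)

text \<open>An operator is determined by its list of m exponents, each bounded by the order.\<close>

lemma finite_valid_var_ord: "finite {v. valid v \<and> var_ord v \<le> N}"
proof -
  let ?O = "{\<theta>. valid_op m \<theta> \<and> op_ord \<theta> \<le> N}"
  let ?f = "\<lambda>\<theta>. map (lk \<theta>) [0..<m]"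
  have "inj_on ?f ?O"
  proof (rule inj_onI, rule poly_mapping_eqI)
    fix \<theta> \<theta>' i assume "\<theta> \<in> ?O" "\<theta>' \<in> ?O" "?f \<theta> = ?f \<theta>'"
    then show "lk \<theta> i = lk \<theta>' i"
      by (cases "i < m") (auto simp: valid_op_def in_keys_iff subset_iff map_eq_conv not_less,
        metis gr0I leD)
  qed
  moreover have "?f ` ?O \<subseteq> {xs. set xs \<subseteq> {..N} \<and> length xs = m}"
  proof (clarsimp)
    fix \<theta> i assume "op_ord \<theta> \<le> N"
    moreover have "lk \<theta> i \<le> op_ord \<theta>"
      by (cases "i \<in> mons \<theta>") (auto simp: op_ord_def in_keys_iff intro: member_le_sum)
    ultimately show "lk \<theta> i \<le> N" by simp
  qed
  ultimately have "finite ?O"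
    using finite_lists_length_eq[of "{..N}" m] by (meson finite_atMost finite_imageD finite_subset)
  then have "finite (?O \<times> {..<l})" by simp
  then show ?thesis
    by (rule finite_subset[rotated]) (auto simp: valid_var_def var_ord_def)
qed

lemma finite_below: "valid v \<Longrightarrow> finite {w. valid w \<and> rk w v}"
  by (rule finite_subset[OF _ finite_valid_var_ord[of "var_ord v"]]) (auto intro: var_ord_mono)

text \<open>The measure is the number of derivatives up to v, which is finite because the ranking is
  orderly.\<close>

lemma valid_induct [consumes 1, case_names less]:
  assumes "valid v" and step: "\<And>v. valid v \<Longrightarrow> (\<And>w. valid w \<Longrightarrow> lt w v \<Longrightarrow> P w) \<Longrightarrow> P v"
  shows "P v"
  using assms(1)
proof (induction "card {w. valid w \<and> rk w v}" arbitrary: v rule: less_induct)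
  case less
  show ?case
  proof (rule step[OF less.prems])
    fix w assume w: "valid w" "lt w v"
    have "{x. valid x \<and> rk x w} \<subset> {x. valid x \<and> rk x v}"
      using w less.prems rk_trans[of _ w v] lt_not_rk[of w v] rk_refl[of v] by (auto simp: lt_imp_rk)
    then show "P w"
      using less.hyps w finite_below[OF less.prems] psubset_card_mono by blast
  qed
qed

lemma ex_max:
  assumes "finite Z" "Z \<noteq> {}" "\<And>z. z \<in> Z \<Longrightarrow> valid z"
  obtains w where "w \<in> Z" "\<And>z. z \<in> Z \<Longrightarrow> rk z w"
proof -
  have "\<exists>w\<in>Z. \<forall>z\<in>Z. rk z w"
    using assms
  proof (induction Z rule: finite_ne_induct)
    case (singleton x)
    then show ?case using rk_refl by auto
  next
    case (insert x F)
    then obtain w where w: "w \<in> F" "\<forall>z\<in>F. rk z w" by auto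
    then have "valid w" "valid x" using insert by auto
    then show ?case
      using rk_total[of w x] rk_refl[of x] w insert.prems rk_trans[of _ w x] by (metis insert_iff)
  qed
  then show ?thesis using that by blast
qed

lemma leader_eqI:
  assumes "f \<in> Rset m l" "u \<in> vars f" "\<And>v. v \<in> vars f \<Longrightarrow> rk v u"
  shows "leader rk f = u"
  unfolding leader_def
proof (rule the_equality)
  fix w assume "w \<in> vars f \<and> (\<forall>v\<in>vars f. rk v w)"
  then show "w = u" using assms rk_antisym unfolding Rset_def by auto
qed (use assms in auto)

lemma leader_props:
  assumes "f \<in> Rset m l" "vars f \<noteq> {}"
  shows leader_in_vars: "leader rk f \<in> vars f"
    and rk_leader: "\<And>v. v \<in> vars f \<Longrightarrow> rk v (leader rk f)"
    and valid_leader: "valid (leader rk f)"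
    and deg_leader_pos: "0 < deg_in (leader rk f) f"
proof -
  obtain w where "w \<in> vars f" "\<And>z. z \<in> vars f \<Longrightarrow> rk z w"
    using ex_max[of "vars f"] assms unfolding Rset_def by auto
  moreover from this have "leader rk f = w" using leader_eqI assms by blast
  ultimately show "leader rk f \<in> vars f" "\<And>v. v \<in> vars f \<Longrightarrow> rk v (leader rk f)"
    "valid (leader rk f)" "0 < deg_in (leader rk f) f"
    using assms unfolding Rset_def by (auto simp: deg_in_pos_iff)
qed

lemma key_less_irrefl: "\<not> key_less rk a a"
  by (simp add: key_less_def)

lemma key_less_trans:
  assumes "valid (fst a)" "valid (fst b)" "valid (fst c)" "key_less rk a b" "key_less rk b c"
  shows "key_less rk a c"
  using assms lt_trans[of "fst a" "fst b" "fst c"] unfolding key_less_def lt_def by auto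

lemma key_less_total:
  assumes "valid (fst a)" "valid (fst b)" "a \<noteq> b"
  shows "key_less rk a b \<or> key_less rk b a"
  using assms rk_total[of "fst a" "fst b"] unfolding key_less_def by (auto simp: prod_eq_iff)

text \<open>What makes \<open>as_list\<close> well defined: distinct elements have distinct keys.
  Differentially and algebraically autoreduced sets both satisfy it.\<close>

definition rankable :: "'k::zero dpoly set \<Rightarrow> bool" where
  "rankable A \<longleftrightarrow> finite A \<and> A \<subseteq> Rset m l \<and> (\<forall>f\<in>A. vars f \<noteq> {}) \<and> inj_on (key rk) A"

lemma rankable_valid: "rankable A \<Longrightarrow> f \<in> A \<Longrightarrow> valid (fst (key rk f))"
  using valid_leader[of f] by (auto simp: rankable_def key_def)

lemma as_list_props:
  assumes "rankable A"
  shows "set (as_list rk A) = A" "sorted_wrt (poly_rank_less rk) (as_list rk A)"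
proof -
  have "\<exists>!xs. set xs = A \<and> distinct xs \<and> sorted_wrt (poly_rank_less rk) xs"
  proof (rule ex1_sorted_wrt)
    show "finite A" using assms by (simp add: rankable_def)
    show "poly_rank_less rk f g \<or> poly_rank_less rk g f" if "f \<in> A" "g \<in> A" "f \<noteq> g" for f g
    proof -
      have "key rk f \<noteq> key rk g" using that assms by (auto simp: rankable_def inj_on_def)
      then show ?thesis
        using key_less_total rankable_valid[OF assms] that by (simp add: poly_rank_less_iff)
    qed
    show "poly_rank_less rk f h" if "f \<in> A" "g \<in> A" "h \<in> A" "poly_rank_less rk f g" "poly_rank_less rk g h"
      for f g h
      using that key_less_trans[of "key rk f" "key rk g" "key rk h"] rankable_valid[OF assms]
      by (simp add: poly_rank_less_iff)
  qed (simp add: poly_rank_less_iff key_less_irrefl)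
  from theI'[OF this] show "set (as_list rk A) = A" "sorted_wrt (poly_rank_less rk) (as_list rk A)"
    unfolding as_list_def by auto
qed

lemma set_rank_less_iff:
  assumes "rankable A" "rankable B"
  shows "set_rank_less rk A B \<longleftrightarrow> keys_less rk (key rk ` A) (key rk ` B)"
proof -
  let ?xs = "map (key rk) (as_list rk A)" and ?ys = "map (key rk) (as_list rk B)"
  have "set_rank_less rk A B \<longleftrightarrow>
    ((\<exists>i<min (length ?xs) (length ?ys). (\<forall>j<i. ?xs ! j = ?ys ! j) \<and> key_less rk (?xs ! i) (?ys ! i)) \<or>
       (length ?ys < length ?xs \<and> (\<forall>j<length ?ys. ?xs ! j = ?ys ! j)))"
    unfolding set_rank_less_def Let_def poly_rank_less_iff poly_rank_eq_iff by auto
  also have "\<dots> \<longleftrightarrow> (\<exists>k\<in>set ?xs - set ?ys. \<forall>k'\<in>set ?xs \<union> set ?ys.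
      key_less rk k' k \<longrightarrow> (k' \<in> set ?xs \<longleftrightarrow> k' \<in> set ?ys))"
  proof (rule lexicographic_sorted_wrt_iff[where T = "{k. valid (fst k)}"])
    show "sorted_wrt (key_less rk) ?xs" "sorted_wrt (key_less rk) ?ys"
      using as_list_props(2)[OF assms(1)] as_list_props(2)[OF assms(2)]
      by (simp_all add: sorted_wrt_map poly_rank_less_iff[abs_def])
    show "set ?xs \<subseteq> {k. valid (fst k)}" "set ?ys \<subseteq> {k. valid (fst k)}"
      using as_list_props(1)[OF assms(1)] as_list_props(1)[OF assms(2)] rankable_valid assms by auto
  qed (auto simp: key_less_irrefl key_less_total intro: key_less_trans)
  also have "\<dots> \<longleftrightarrow> keys_less rk (key rk ` A) (key rk ` B)"
    using as_list_props(1)[OF assms(1)] as_list_props(1)[OF assms(2)] by (simp add: keys_less_def)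
  finally show ?thesis .
qed

lemma ex_least_key:
  assumes "finite K" "K \<noteq> {}" "\<And>k. k \<in> K \<Longrightarrow> valid (fst k)"
  shows "\<exists>k\<in>K. \<forall>k'\<in>K. \<not> key_less rk k' k"
  using assms
proof (induction K rule: finite_ne_induct)
  case (singleton x)
  then show ?case by (simp add: key_less_irrefl)
next
  case (insert x F)
  then obtain k where k: "k \<in> F" "\<forall>k'\<in>F. \<not> key_less rk k' k" by auto
  show ?case
  proof (cases "key_less rk x k")
    case True
    then have "\<forall>k'\<in>F. \<not> key_less rk k' x"
      using k insert.prems key_less_trans[of _ x k] by (metis insertCI)
    then show ?thesis by (auto simp: key_less_irrefl)
  next
    case False
    then show ?thesis using k by auto
  qed
qed

text \<open>"Lowest rank" is stated as the absence of a lower set, so comparisons are chained by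
  this cotransitivity. Let k witness K below M. If L agrees with K below k, membership of k in L
  decides; otherwise the least disagreement \<open>k2\<close> of K and L below k does.\<close>

lemma keys_less_cases:
  assumes "keys_less rk K M" "finite K" "finite L"
    and v: "\<And>k. k \<in> K \<union> L \<union> M \<Longrightarrow> valid (fst k)"
  shows "keys_less rk K L \<or> keys_less rk L M"
proof -
  obtain k where k: "k \<in> K" "k \<notin> M" "\<And>z. z \<in> K \<union> M \<Longrightarrow> key_less rk z k \<Longrightarrow> z \<in> K \<longleftrightarrow> z \<in> M"
    using assms(1) unfolding keys_less_def by blast
  define S where "S = {z\<in>K \<union> L. key_less rk z k \<and> \<not> (z \<in> K \<longleftrightarrow> z \<in> L)}"
  show ?thesis
  proof (cases "S = {}")
    case True
    then have agree: "z \<in> K \<longleftrightarrow> z \<in> L" if "key_less rk z k" for z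
      using that unfolding S_def by blast
    show ?thesis
    proof (cases "k \<in> L")
      case True
      with k agree have "keys_less rk L M" unfolding keys_less_def by blast
      then show ?thesis ..
    next
      case False
      with k agree have "keys_less rk K L" unfolding keys_less_def by blast
      then show ?thesis ..
    qed
  next
    case False
    moreover have "finite S" using assms(2,3) by (auto simp: S_def)
    moreover have "valid (fst z)" if "z \<in> S" for z using that v by (auto simp: S_def)
    ultimately obtain k2 where k2: "k2 \<in> S" "\<forall>z\<in>S. \<not> key_less rk z k2"
      using ex_least_key[of S] by blast
    have below: "key_less rk z k" if "key_less rk z k2" "z \<in> K \<union> L \<union> M" for z
      using key_less_trans[of z k2 k] that v k2(1) k(1) by (auto simp: S_def)
    then have agree: "z \<in> K \<longleftrightarrow> z \<in> L" if "key_less rk z k2" for z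
      using that k2(2) below[OF that] unfolding S_def by blast
    show ?thesis
    proof (cases "k2 \<in> L")
      case True
      then have "k2 \<in> L - M" using k2(1) k(3)[of k2] by (auto simp: S_def)
      moreover have "\<forall>z\<in>L \<union> M. key_less rk z k2 \<longrightarrow> (z \<in> L \<longleftrightarrow> z \<in> M)"
        using agree below k(3) by blast
      ultimately have "keys_less rk L M" unfolding keys_less_def by blast
      then show ?thesis ..
    next
      case False
      then have "k2 \<in> K - L" using k2(1) by (auto simp: S_def)
      with agree have "keys_less rk K L" unfolding keys_less_def by blast
      then show ?thesis ..
    qed
  qed
qed

text \<open>Parametrised by the notion of reducedness, so that the minimality argument for
  characteristic sets serves the differential and the algebraic case at once.\<close>

definition autoreduced :: "('k::zero dpoly \<Rightarrow> 'k dpoly \<Rightarrow> bool) \<Rightarrow> 'k dpoly set \<Rightarrow> 'k dpoly set \<Rightarrow> bool" where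
  "autoreduced red S A \<longleftrightarrow> finite A \<and> A \<subseteq> S \<and> (\<forall>f\<in>A. vars f \<noteq> {}) \<and>
     (\<forall>f\<in>A. \<forall>g\<in>A. f \<noteq> g \<longrightarrow> red f g)"

lemma autoreduced_leader_inj:
  assumes "autoreduced red S A" "\<And>f g. red f g \<Longrightarrow> alg_reduced rk f g"
    and "f \<in> A" "g \<in> A" "leader rk f = leader rk g"
  shows "f = g"
proof (rule ccontr)
  assume "f \<noteq> g"
  then have "alg_reduced rk f g" "alg_reduced rk g f" using assms by (auto simp: autoreduced_def)
  then show False using assms(5) by (auto simp: alg_reduced_def)
qed

lemma autoreduced_rankable:
  assumes "autoreduced red S A" "S \<subseteq> Rset m l" "\<And>f g. red f g \<Longrightarrow> alg_reduced rk f g"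
  shows "rankable A"
  using assms(1,2) autoreduced_leader_inj[OF assms(1,3)]
  by (auto simp: rankable_def autoreduced_def inj_on_def key_def)

text \<open>Otherwise f together with the elements of A of rank lower than f would be an autoreduced
  subset of J of rank lower than A. Assumption \<open>low\<close> supplies the reducedness of these
  elements with respect to f.\<close>

lemma charset_not_reduced:
  assumes A: "autoreduced red S A" "A \<subseteq> J" and S: "S \<subseteq> Rset m l"
    and minimal: "\<And>B. autoreduced red S B \<Longrightarrow> B \<subseteq> J \<Longrightarrow> \<not> set_rank_less rk B A"
    and alg: "\<And>f g. red f g \<Longrightarrow> alg_reduced rk f g"
    and low: "\<And>f g. f \<in> S \<Longrightarrow> g \<in> S \<Longrightarrow> vars f \<noteq> {} \<Longrightarrow> vars g \<noteq> {} \<Longrightarrow>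
               lt (leader rk f) (leader rk g) \<Longrightarrow> red f g"
    and f: "f \<in> J" "f \<in> S" "vars f \<noteq> {}"
  shows "\<exists>a\<in>A. \<not> red f a"
proof (rule ccontr)
  assume "\<not> ?thesis"
  then have red: "red f a" if "a \<in> A" for a using that by blast
  define B where "B = insert f {a\<in>A. key_less rk (key rk a) (key rk f)}"
  have "red a f" if "a \<in> A" "key_less rk (key rk a) (key rk f)" for a
  proof -
    have "alg_reduced rk f a" using alg red that by blast
    then have "lt (leader rk a) (leader rk f)"
      using that by (auto simp: key_less_def key_def lt_def alg_reduced_def)
    moreover have "a \<in> S" "vars a \<noteq> {}" using that A by (auto simp: autoreduced_def)
    ultimately show ?thesis using low f by simp
  qed
  then have B: "autoreduced red S B"
    using A f red by (auto simp: autoreduced_def B_def)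
  have "key rk f \<notin> key rk ` A"
  proof
    assume "key rk f \<in> key rk ` A"
    then obtain a where "a \<in> A" "key rk f = key rk a" by blast
    then show False using alg[OF red[of a]] by (auto simp: key_def alg_reduced_def)
  qed
  then have "keys_less rk (key rk ` B) (key rk ` A)"
    unfolding keys_less_def
    by (intro bexI[of _ "key rk f"]) (auto simp: B_def key_less_irrefl)
  then have "set_rank_less rk B A"
    using set_rank_less_iff autoreduced_rankable[OF B S alg] autoreduced_rankable[OF A(1) S alg] by blast
  then show False using minimal[OF B] A(2) f(1) by (auto simp: B_def)
qed

lemma diff_autoreduced_iff: "diff_autoreduced S rk A \<longleftrightarrow> autoreduced (diff_reduced rk) S A"
  by (simp add: diff_autoreduced_def autoreduced_def)

lemma alg_autoreduced_iff: "alg_autoreduced S rk A \<longleftrightarrow> autoreduced (alg_reduced rk) S A"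
  by (simp add: alg_autoreduced_def autoreduced_def)

lemma diff_reduced_imp_alg_reduced: "diff_reduced rk f g \<Longrightarrow> alg_reduced rk f g"
  by (simp add: diff_reduced_def alg_reduced_def)

lemma proper_derivative_lt:
  assumes "valid v" "proper_derivative v u"
  shows "valid u" "lt u v"
proof -
  obtain \<theta> where \<theta>: "\<theta> \<noteq> 0" "v = op_var \<theta> u"
    using assms(2) unfolding proper_derivative_def by blast
  then show "valid u" "lt u v" using assms(1) lt_op_var[of \<theta> u] valid_op_var[of \<theta> u] by simp_all
qed

lemma alg_reduced_of_lt:
  assumes "f \<in> Rset m l" "g \<in> Rset m l" "vars f \<noteq> {}" "vars g \<noteq> {}" "lt (leader rk f) (leader rk g)"
  shows "alg_reduced rk f g"
proof -
  have "leader rk g \<notin> vars f"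
    using assms rk_leader[of f "leader rk g"] lt_not_rk valid_leader by blast
  then show ?thesis
    using deg_leader_pos[of g] assms by (simp add: alg_reduced_def deg_in_eq_0_iff[symmetric])
qed

lemma diff_reduced_of_lt:
  assumes "f \<in> Rset m l" "g \<in> Rset m l" "vars f \<noteq> {}" "vars g \<noteq> {}" "lt (leader rk f) (leader rk g)"
  shows "diff_reduced rk f g"
proof -
  have "\<not> proper_derivative v (leader rk g)" if "v \<in> vars f" for v
  proof
    assume "proper_derivative v (leader rk g)"
    moreover have "valid v" using that assms(1) by (auto simp: Rset_def)
    ultimately have "lt (leader rk g) v" using proper_derivative_lt by blast
    moreover have "rk v (leader rk f)" using that assms rk_leader by blast
    ultimately have "lt (leader rk g) (leader rk f)"
      using lt_rk_trans \<open>valid v\<close> valid_leader assms by blast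
    then show False using assms lt_not_rk valid_leader lt_imp_rk by blast
  qed
  then show ?thesis
    using alg_reduced_of_lt[OF assms] by (simp add: alg_reduced_def diff_reduced_def)
qed

lemma kolchin_charset_not_reduced:
  assumes "kolchin_charset m l rk J A" "f \<in> J" "f \<in> Rset m l" "vars f \<noteq> {}"
  shows "\<exists>a\<in>A. \<not> diff_reduced rk f a"
proof (rule charset_not_reduced[where red = "diff_reduced rk" and S = "Rset m l" and J = J])
  show "autoreduced (diff_reduced rk) (Rset m l) A" "A \<subseteq> J"
    "\<And>B. autoreduced (diff_reduced rk) (Rset m l) B \<Longrightarrow> B \<subseteq> J \<Longrightarrow> \<not> set_rank_less rk B A"
    using assms(1) by (simp_all add: kolchin_charset_def diff_autoreduced_iff)
qed (use assms diff_reduced_imp_alg_reduced diff_reduced_of_lt in simp_all)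

lemma alg_charset_not_reduced:
  assumes "alg_charset S rk J A" "S \<subseteq> Rset m l" "f \<in> J" "f \<in> S" "vars f \<noteq> {}"
  shows "\<exists>a\<in>A. \<not> alg_reduced rk f a"
proof (rule charset_not_reduced[where red = "alg_reduced rk" and S = S and J = J])
  show "autoreduced (alg_reduced rk) S A" "A \<subseteq> J"
    "\<And>B. autoreduced (alg_reduced rk) S B \<Longrightarrow> B \<subseteq> J \<Longrightarrow> \<not> set_rank_less rk B A"
    using assms(1) by (simp_all add: alg_charset_def alg_autoreduced_iff)
  show "alg_reduced rk f g" if "f \<in> S" "g \<in> S" "vars f \<noteq> {}" "vars g \<noteq> {}"
    "lt (leader rk f) (leader rk g)" for f g
    using that assms(2) alg_reduced_of_lt by blast
qed (use assms in simp_all)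

end

subsection \<open>Derivatives of differential polynomials\<close>

lemma lookup_pderiv_var:
  "lk (pderiv_var v f) k = of_nat (lk k v + 1) * lk f (k + Poly_Mapping.single v 1)"
proof -
  let ?k = "k + Poly_Mapping.single v 1"
  have upd: "Poly_Mapping.update v (lk mon v - 1) mon = k \<longleftrightarrow> mon = ?k" if "lk mon v \<noteq> 0" for mon
  proof
    assume "Poly_Mapping.update v (lk mon v - 1) mon = k"
    then have "lk k x = (if x = v then lk mon v - 1 else lk mon x)" for x
      by (auto simp: lookup_update)
    then show "mon = ?k"
      using that by (intro poly_mapping_eqI) (auto simp: lookup_add lookup_single when_def)
  next
    assume "mon = ?k"
    then show "Poly_Mapping.update v (lk mon v - 1) mon = k"
      by (intro poly_mapping_eqI) (auto simp: lookup_add lookup_single lookup_update when_def)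
  qed
  have "lk (pderiv_var v f) k = (\<Sum>mon\<in>mons f.
      (of_nat (lk mon v) * lk f mon when Poly_Mapping.update v (lk mon v - 1) mon = k))"
    by (simp add: pderiv_var_def lookup_sum lookup_single)
  also have "\<dots> = (\<Sum>mon\<in>mons f. if mon = ?k then of_nat (lk ?k v) * lk f ?k else 0)"
  proof (rule sum.cong)
    fix mon
    show "(of_nat (lk mon v) * lk f mon when Poly_Mapping.update v (lk mon v - 1) mon = k)
      = (if mon = ?k then of_nat (lk ?k v) * lk f ?k else 0)"
    \<comment> \<open>For exponent 0 the truncated subtraction in \<open>pderiv_var\<close> leaves
      the monomial unchanged, but its coefficient is then 0.\<close>
    proof (cases "lk mon v = 0")
      case True
      then have "mon \<noteq> ?k" by (auto simp: lookup_add)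
      then show ?thesis using True by simp
    next
      case False
      show ?thesis by (simp only: upd[OF False] when_def) auto
    qed
  qed auto
  also have "\<dots> = of_nat (lk k v + 1) * lk f ?k"
    by (auto simp: in_keys_iff lookup_add)
  finally show ?thesis .
qed

lemma vars_pderiv_var: "vars (pderiv_var v f) \<subseteq> vars f"
proof
  fix x assume "x \<in> vars (pderiv_var v f)"
  then obtain k where "lk (pderiv_var v f) k \<noteq> 0" "lk k x \<noteq> 0"
    by (auto simp: in_vars_iff in_keys_iff)
  then have "k + Poly_Mapping.single v 1 \<in> mons f" "lk (k + Poly_Mapping.single v 1) x \<noteq> 0"
    by (auto simp: lookup_pderiv_var in_keys_iff lookup_add)
  then show "x \<in> vars f" by (auto simp: in_vars_iff)
qed

lemma pderiv_var_linear:
  fixes S T :: "'k::comm_ring_1 dpoly"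
  assumes "u \<notin> vars S" "u \<notin> vars T"
  shows "pderiv_var u (S * Var u + T) = S"
proof (rule poly_mapping_eqI)
  fix k :: "dvar \<Rightarrow>\<^sub>0 nat"
  let ?k = "k + Poly_Mapping.single u 1" and ?f = "S * Var u + T"
  have T: "lk T ?k = 0"
  proof (rule ccontr)
    assume "lk T ?k \<noteq> 0"
    then have "?k \<in> mons T" by (simp add: in_keys_iff)
    then show False using assms(2) by (auto simp: in_vars_iff lookup_add)
  qed
  show "lk (pderiv_var u ?f) k = lk S k"
  proof (cases "lk k u = 0")
    case True
    then show ?thesis
      using lookup_mult_Var_power[OF assms(1), of k 1] T by (simp add: lookup_pderiv_var lookup_add)
  next
    case False
    then have "k \<notin> mons S" using assms(1) unfolding in_vars_iff by blast
    then have "lk S k = 0" by (simp add: in_keys_iff)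
    moreover have "deg_in u (S * Var u) \<le> 1"
      using deg_in_mult[of u S "Var u"] deg_in_Var_power[of u u 1, where 'k = 'k] assms(1)
      unfolding deg_in_eq_0_iff[symmetric] by simp
    then have "lk (S * Var u) ?k = 0"
      using lookup_le_deg_in[of ?k "S * Var u" u] False by (auto simp: in_keys_iff lookup_add)
    ultimately show ?thesis using T by (simp add: lookup_pderiv_var lookup_add)
  qed
qed

text \<open>Follows the fixed order in which \<open>apply_op\<close> performs the derivations. The
  predicate carries the exponent vector accumulated so far, which at the end is \<theta>.\<close>

lemma apply_op_induct:
  assumes "valid_op m \<theta>" "P 0 f"
    and step: "\<And>i \<theta> g. i < m \<Longrightarrow> valid_op m \<theta> \<Longrightarrow> P \<theta> g \<Longrightarrow>
      P (Poly_Mapping.single i 1 + \<theta>) (D \<delta> i g)"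
  shows "P \<theta> (apply_op \<delta> m \<theta> f)"
proof -
  have single: "valid_op m (Poly_Mapping.single i n)" if "i < m" for i n
    using that by (auto simp: valid_op_def)
  have pow: "P (Poly_Mapping.single i n + \<theta>') ((D \<delta> i ^^ n) g) \<and> valid_op m (Poly_Mapping.single i n + \<theta>')"
    if "i < m" "valid_op m \<theta>'" "P \<theta>' g" for i n \<theta>' g
  proof (induction n)
    case 0
    then show ?case using that by simp
  next
    case (Suc n)
    have "Poly_Mapping.single i (Suc n) = Poly_Mapping.single i 1 + Poly_Mapping.single i n"
      by (simp flip: single_add)
    then show ?case
      using Suc step[of i "Poly_Mapping.single i n + \<theta>'"] that keys_add[of "Poly_Mapping.single i 1" "Poly_Mapping.single i n + \<theta>'"]
      by (auto simp: add.assoc valid_op_def)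
  qed
  have "P (\<Sum>i\<leftarrow>xs. Poly_Mapping.single i (lk \<theta> i)) (List.foldr (\<lambda>i g. (D \<delta> i ^^ lk \<theta> i) g) xs f)
      \<and> valid_op m (\<Sum>i\<leftarrow>xs. Poly_Mapping.single i (lk \<theta> i))" if "set xs \<subseteq> {..<m}" for xs
    using that
  proof (induction xs)
    case Nil
    then show ?case using assms(2) by (simp add: valid_op_def)
  next
    case (Cons i xs)
    then have "i < m" and IH: "P (\<Sum>i\<leftarrow>xs. Poly_Mapping.single i (lk \<theta> i)) (List.foldr (\<lambda>i g. (D \<delta> i ^^ lk \<theta> i) g) xs f)
      \<and> valid_op m (\<Sum>i\<leftarrow>xs. Poly_Mapping.single i (lk \<theta> i))" by auto
    then show ?case
      using pow[OF \<open>i < m\<close> IH[THEN conjunct2] IH[THEN conjunct1], of "lk \<theta> i"] by simp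
  qed
  moreover have "set [0..<m] \<subseteq> {..<m}" by auto
  ultimately have "P (\<Sum>i\<leftarrow>[0..<m]. Poly_Mapping.single i (lk \<theta> i)) (apply_op \<delta> m \<theta> f)"
    unfolding apply_op_def by blast
  moreover have "(\<Sum>i\<leftarrow>[0..<m]. Poly_Mapping.single i (lk \<theta> i)) = \<theta>"
  proof -
    have "(\<Sum>i\<leftarrow>[0..<m]. Poly_Mapping.single i (lk \<theta> i)) = (\<Sum>i<m. Poly_Mapping.single i (lk \<theta> i))"
      by (simp add: sum_list_distinct_conv_sum_set atLeast0LessThan)
    also have "\<dots> = \<theta>"
    proof (rule poly_mapping_eqI)
      fix j
      have "(\<Sum>i<m. lk (Poly_Mapping.single i (lk \<theta> i)) j) = (\<Sum>i<m. if i = j then lk \<theta> j else 0)"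
        by (intro sum.cong) (auto simp: lookup_single when_def)
      also have "\<dots> = lk \<theta> j"
        using assms(1) by (auto simp: valid_op_def in_keys_iff subset_iff)
      finally show "lk (\<Sum>i<m. Poly_Mapping.single i (lk \<theta> i)) j = lk \<theta> j"
        by (simp add: lookup_sum)
    qed
    finally show ?thesis .
  qed
  ultimately show ?thesis by simp
qed

lemma apply_op_closed:
  assumes "valid_op m \<theta>" "f \<in> J" "\<And>i g. i < m \<Longrightarrow> g \<in> J \<Longrightarrow> D \<delta> i g \<in> J"
  shows "apply_op \<delta> m \<theta> f \<in> J"
  using apply_op_induct[of m \<theta> "\<lambda>_ g. g \<in> J" f \<delta>] assms by blast

lemma apply_op_0: "apply_op \<delta> m 0 f = f"
proof -
  have "List.foldr (\<lambda>i g. (D \<delta> i ^^ 0) g) xs f = f" for xs :: "nat list"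
    by (induction xs) auto
  then show ?thesis by (simp add: apply_op_def)
qed

context orderly_ranking
begin

definition upto :: "dvar \<Rightarrow> dvar set" where
  "upto v = {w. valid w \<and> rk w v}"

definition below :: "dvar \<Rightarrow> dvar set" where
  "below v = {w. valid w \<and> lt w v}"

lemma upto_subset_below: "valid u \<Longrightarrow> valid v \<Longrightarrow> lt u v \<Longrightarrow> upto u \<subseteq> below v"
  using rk_lt_trans[of _ u v] by (auto simp: upto_def below_def)

lemma in_polys_upto_leader: "f \<in> Rset m l \<Longrightarrow> vars f \<noteq> {} \<Longrightarrow> f \<in> polys (upto (leader rk f))"
  using rk_leader[of f] by (auto simp: polys_def upto_def Rset_def)

text \<open>In the chain-rule sum of \<open>D\<close>, monotonicity of the ranking sends every
  variable below u to a derivative below \<open>u'\<close>, so only the summand of u contributes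
  \<open>u'\<close>. The variables of f are below \<open>u'\<close> as well, since u is.\<close>

lemma D_linear:
  fixes f :: "'k::comm_ring_1 dpoly"
  assumes "valid u" "i < m" "f \<in> polys (upto u)"
  defines "u' \<equiv> op_var (Poly_Mapping.single i 1) u"
  shows "valid u'" "lt u u'" "\<exists>T\<in>polys (below u'). D \<delta> i f = pderiv_var u f * Var u' + T"
proof -
  have vi: "valid_op m (Poly_Mapping.single i 1)" using assms(2) by (simp add: valid_op_def)
  show vu': "valid u'" using vi assms(1) by (simp add: u'_def valid_op_var)
  have "Poly_Mapping.single i (1::nat) \<noteq> 0"
    by (metis lookup_single_eq lookup_zero zero_neq_one)
  then show lt: "lt u u'" using lt_op_var[OF vi assms(1)] by (simp add: u'_def)
  let ?o = "op_var (Poly_Mapping.single i 1)"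
  define T where "T = (\<Sum>mon\<in>mons f. Poly_Mapping.single mon (\<delta> i (lk f mon)))
     + (\<Sum>v\<in>vars f - {u}. pderiv_var v f * Var (?o v))"
  have f: "f \<in> polys (below u')"
    using assms(3) polys_mono[OF upto_subset_below[OF assms(1) vu' lt]] by blast
  have pd: "pderiv_var v f \<in> polys (below u')" for v
    using f vars_pderiv_var[of v f] by (auto simp: polys_def)
  have "T \<in> polys (below u')"
    unfolding T_def
  proof (intro polys_add polys_sum polys_single polys_mult pd polys_Var)
    show "mons mon \<subseteq> below u'" if "mon \<in> mons f" for mon
      using f that by (auto simp: polys_def vars_def)
    show "?o v \<in> below u'" if "v \<in> vars f - {u}" for v
      using that assms(1,3) vi lt_op_var_mono[OF vi assms(1), of v]
      by (auto simp: polys_def upto_def below_def u'_def valid_op_var lt_def)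
  qed
  moreover have "D \<delta> i f = pderiv_var u f * Var u' + T"
  proof (cases "u \<in> vars f")
    case True
    then show ?thesis
      by (simp add: D_def T_def u'_def sum.remove[of "vars f" u] algebra_simps)
  next
    case False
    have "pderiv_var u f = 0"
    proof (rule poly_mapping_eqI)
      fix k :: "dvar \<Rightarrow>\<^sub>0 nat"
      have "lk (k + Poly_Mapping.single u 1) u \<noteq> 0" by (simp add: lookup_add)
      then have "k + Poly_Mapping.single u 1 \<notin> mons f" using False unfolding in_vars_iff by blast
      then show "lk (pderiv_var u f) k = lk 0 k" by (simp add: lookup_pderiv_var in_keys_iff)
    qed
    then show ?thesis using False by (simp add: D_def T_def)
  qed
  ultimately show "\<exists>T\<in>polys (below u'). D \<delta> i f = pderiv_var u f * Var u' + T" by blast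
qed

text \<open>The first derivation makes the polynomial linear in its new leader with the separant as
  coefficient. The partial derivative with respect to that leader is again the separant, so each
  further derivation preserves this shape.\<close>

lemma apply_op_linear:
  fixes f :: "'k::comm_ring_1 dpoly"
  assumes "f \<in> Rset m l" "vars f \<noteq> {}" "valid_op m \<theta>" "\<theta> \<noteq> 0"
  defines "u \<equiv> op_var \<theta> (leader rk f)"
  shows "\<exists>T\<in>polys (below u). apply_op \<delta> m \<theta> f = separant rk f * Var u + T"
    and "separant rk f \<in> polys (below u)"
proof -
  let ?u = "leader rk f" and ?S = "separant rk f"
  have vu: "valid ?u" using valid_leader assms by blast
  have S: "?S \<in> polys (upto ?u)"
    using in_polys_upto_leader[OF assms(1,2)] vars_pderiv_var[of ?u f]
    by (auto simp: polys_def separant_def)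
  \<comment> \<open>The case of the zero operator is kept apart because f itself need not be linear
    in its leader.\<close>
  let ?P = "\<lambda>\<theta> g. valid (op_var \<theta> ?u) \<and>
     (if \<theta> = 0 then g = f else ?S \<in> polys (below (op_var \<theta> ?u)) \<and>
       (\<exists>T\<in>polys (below (op_var \<theta> ?u)). g = ?S * Var (op_var \<theta> ?u) + T))"
  have "?P \<theta> (apply_op \<delta> m \<theta> f)"
  proof (rule apply_op_induct)
    show "valid_op m \<theta>" by fact
    show "?P 0 f" using vu by simp
    fix i \<theta> and g :: "'k dpoly" assume i: "i < m" "valid_op m \<theta>" and P: "?P \<theta> g"
    let ?v = "op_var \<theta> ?u"
    have vv: "valid ?v" using P by simp
    have gS: "g \<in> polys (upto ?v) \<and> pderiv_var ?v g = ?S \<and> ?S \<in> polys (upto ?v)"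
    proof (cases "\<theta> = 0")
      case True
      then show ?thesis using P in_polys_upto_leader[OF assms(1,2)] S by (simp add: separant_def)
    next
      case False
      then obtain T where T: "?S \<in> polys (below ?v)" "T \<in> polys (below ?v)" "g = ?S * Var ?v + T"
        using P by auto
      have sub: "below ?v \<subseteq> upto ?v" "?v \<in> upto ?v"
        using vv rk_refl by (auto simp: below_def upto_def lt_def)
      have "g \<in> polys (upto ?v)" unfolding T(3)
        by (intro polys_add polys_mult polys_Var sub polys_mono[OF sub(1)] T)
      moreover have "pderiv_var ?v g = ?S" unfolding T(3)
        by (rule pderiv_var_linear) (use T in \<open>auto simp: polys_def below_def lt_def\<close>)
      ultimately show ?thesis using polys_mono[OF sub(1) T(1)] by simp
    qed
    note D = D_linear(1,2)[OF vv i(1) gS[THEN conjunct1], unfolded op_var_op_var]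
      D_linear(3)[OF vv i(1) gS[THEN conjunct1], of \<delta>, unfolded op_var_op_var]
    have "Poly_Mapping.single i 1 + \<theta> \<noteq> 0"
      by (metis lookup_add lookup_single_eq lookup_zero add_is_0 zero_neq_one)
    moreover have "?S \<in> polys (below (op_var (Poly_Mapping.single i 1 + \<theta>) ?u))"
      using gS D upto_subset_below[OF vv] polys_mono by blast
    ultimately show "?P (Poly_Mapping.single i 1 + \<theta>) (D \<delta> i g)"
      using D gS by auto
  qed
  then show "\<exists>T\<in>polys (below u). apply_op \<delta> m \<theta> f = separant rk f * Var u + T"
    "separant rk f \<in> polys (below u)" using assms(4) by (simp_all add: u_def)
qed

end

subsection \<open>Pseudo-reduction\<close>

text \<open>Exactly t factors \<open>Iw\<close> are used, even where fewer would do: the multiplier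
  then depends only on a degree bound and can be shared by several f. The last clause keeps degrees
  in variables foreign to g under control.\<close>

lemma pseudo_division:
  fixes f g Iw T :: "'k::comm_ring_1 dpoly"
  assumes g: "g = Iw * Var w ^ e + T" "0 < e" "w \<notin> vars Iw" "deg_in w T < e"
    and "deg_in w f < e + t"
  defines "V \<equiv> vars Iw \<union> vars T \<union> {w}"
  shows "\<exists>q r. Iw ^ t * f = q * g + r \<and> deg_in w r < e \<and> vars q \<subseteq> vars f \<union> V \<and>
    vars r \<subseteq> vars f \<union> V \<and> (\<forall>x. x \<notin> V \<longrightarrow> deg_in x r \<le> deg_in x f)"
  using assms(5)
proof (induction t arbitrary: f)
  case 0
  then show ?case by (intro exI[of _ 0] exI[of _ f]) auto
next
  case (Suc t)
  let ?c = "coeff_var w (e + t) f"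
  obtain f0 where f0: "f = ?c * Var w ^ (e + t) + f0" "deg_in w f0 < e + t"
    "vars f0 \<subseteq> vars f" "\<And>x. deg_in x f0 \<le> deg_in x f" "\<And>x. deg_in x ?c \<le> deg_in x f"
    using split_coeff_var[of w f "e + t"] Suc.prems g(2) by auto
  have c: "vars ?c \<subseteq> vars f - {w}" by (rule vars_coeff_var)
  \<comment> \<open>This is \<open>Iw\<close> * f minus c * w^t * g, in which the terms of degree e
    + t in w have cancelled.\<close>
  define f1 where "f1 = Iw * f0 - ?c * Var w ^ t * T"
  have I0: "deg_in x Iw = 0" if "x \<notin> vars Iw" for x using that by (simp add: deg_in_eq_0_iff)
  have d1: "deg_in x f1 \<le> max (deg_in x Iw + deg_in x f0)
       (deg_in x ?c + (if x = w then t else 0) + deg_in x T)" for x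
    using deg_in_diff[of x "Iw * f0" "?c * Var w ^ t * T"] deg_in_mult[of x Iw f0]
      deg_in_mult[of x "?c * Var w ^ t" T] deg_in_mult[of x ?c "Var w ^ t"]
      deg_in_Var_power[of x w t, where 'k = 'k] unfolding f1_def by linarith
  have "deg_in w ?c = 0" using c by (auto simp: deg_in_eq_0_iff)
  then have "deg_in w f1 < e + t"
    using d1[of w] I0[OF g(3)] f0(2) g(4) by simp
  then obtain q r where qr: "Iw ^ t * f1 = q * g + r" "deg_in w r < e" "vars q \<subseteq> vars f1 \<union> V"
    "vars r \<subseteq> vars f1 \<union> V" "\<forall>x. x \<notin> V \<longrightarrow> deg_in x r \<le> deg_in x f1"
    using Suc.IH by blast
  have "?c \<in> polys (vars f \<union> V)" "f0 \<in> polys (vars f \<union> V)" "Iw \<in> polys (vars f \<union> V)"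
    "T \<in> polys (vars f \<union> V)"
    using c f0(3) by (auto simp: polys_def V_def)
  moreover have "Var w ^ t \<in> (polys (vars f \<union> V) :: 'k dpoly set)"
    by (intro polys_power polys_Var) (simp add: V_def)
  ultimately have U: "?c \<in> polys (vars f \<union> V)" "f0 \<in> polys (vars f \<union> V)" "Iw \<in> polys (vars f \<union> V)"
    "T \<in> polys (vars f \<union> V)" "Var w ^ t \<in> (polys (vars f \<union> V) :: 'k dpoly set)" by blast+
  have f1: "f1 \<in> polys (vars f \<union> V)"
    unfolding f1_def by (intro polys_diff polys_mult U)
  have eq: "Iw * f = ?c * Var w ^ t * g + f1"
    by (subst f0(1)) (simp add: f1_def g(1) algebra_simps power_add)
  have "Iw ^ Suc t * f = Iw ^ t * (Iw * f)" by (simp add: mult_ac)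
  also have "\<dots> = Iw ^ t * (?c * Var w ^ t * g) + Iw ^ t * f1" by (simp only: eq distrib_left)
  also have "\<dots> = (Iw ^ t * ?c * Var w ^ t + q) * g + r"
    by (simp only: qr(1)) (simp add: algebra_simps)
  finally have "Iw ^ Suc t * f = (Iw ^ t * ?c * Var w ^ t + q) * g + r" .
  moreover have "vars (Iw ^ t * ?c * Var w ^ t + q) \<subseteq> vars f \<union> V"
  proof -
    have "q \<in> polys (vars f \<union> V)" using f1 qr(3) by (auto simp: polys_def)
    then have "Iw ^ t * ?c * Var w ^ t + q \<in> polys (vars f \<union> V)"
      by (intro polys_add polys_mult polys_power U(1,3,5))
    then show ?thesis by (simp add: polys_def)
  qed
  moreover have "vars r \<subseteq> vars f \<union> V" using f1 qr(4) by (auto simp: polys_def)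
  moreover have "deg_in x r \<le> deg_in x f" if "x \<notin> V" for x
  proof -
    have "deg_in x Iw = 0" "deg_in x T = 0" "x \<noteq> w" using that by (auto simp: V_def deg_in_eq_0_iff)
    then have "deg_in x f1 \<le> deg_in x f" using d1[of x] f0(4)[of x] f0(5)[of x] by simp
    moreover have "deg_in x r \<le> deg_in x f1" using qr(5) that by blast
    ultimately show ?thesis by linarith
  qed
  ultimately show ?case using qr(2) by blast
qed

lemma ideal_add: "is_ideal_in S J \<Longrightarrow> a \<in> J \<Longrightarrow> b \<in> J \<Longrightarrow> a + b \<in> J"
  by (simp add: is_ideal_in_def)

lemma ideal_mult: "is_ideal_in S J \<Longrightarrow> a \<in> J \<Longrightarrow> s \<in> S \<Longrightarrow> s * a \<in> J"
  by (simp add: is_ideal_in_def)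

lemma ideal_0: "is_ideal_in S J \<Longrightarrow> 0 \<in> J"
  by (simp add: is_ideal_in_def)

lemma ideal_diff:
  assumes "is_ideal_in (polys X) J" "a \<in> J" "b \<in> J"
  shows "a - b \<in> J"
proof -
  have "(-1) * b \<in> J" using ideal_mult[OF assms(1,3)] polys_uminus[OF polys_1] by blast
  then show ?thesis using ideal_add[OF assms(1,2)] by fastforce
qed

context orderly_ranking
begin

text \<open>A single multiplier \<open>s\<close> serves the whole finite family \<open>F\<close>: this is what allows
  relations between the members of \<open>F\<close> to be transported to the remainders.\<close>
lemma reduce_family:
  fixes g Iw T :: "dvar \<Rightarrow> 'k::comm_ring_1 dpoly"
  assumes J: "is_ideal_in (polys Y) J" and X: "X \<subseteq> Y" "\<And>x. x \<in> X \<Longrightarrow> valid x"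
    and M: "1 \<in> M"
    and "finite Z" "Z \<subseteq> X"
    and "\<And>z. z \<in> Z \<Longrightarrow> g z = Iw z * Var z ^ e z + T z \<and> 0 < e z \<and> deg_in z (T z) < e z \<and>
       Iw z \<in> polys (X \<inter> below z) \<and> T z \<in> polys (X \<inter> upto z) \<and> g z \<in> J \<and> (\<forall>s\<in>M. Iw z * s \<in> M)"
    and "finite F" "F \<subseteq> polys X"
  shows "\<exists>s\<in>M \<inter> polys X. \<forall>f\<in>F. \<exists>r\<in>polys X. s * f - r \<in> J \<and> (\<forall>z\<in>Z. deg_in z r < e z) \<and>
     (\<forall>x\<in>X. (\<forall>z\<in>Z. lt z x) \<longrightarrow> deg_in x r \<le> deg_in x f)"
  using assms(5-)
proof (induction Z arbitrary: F rule: finite_psubset_induct)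
  case (psubset Z)
  note Z = psubset.prems(1) and g = psubset.prems(2) and F = psubset.prems(3,4)
  show ?case
  proof (cases "Z = {}")
    case True
    have "\<exists>r\<in>polys X. 1 * f - r \<in> J \<and> (\<forall>x\<in>X. (\<forall>z\<in>Z. lt z x) \<longrightarrow> deg_in x r \<le> deg_in x f)"
      if "f \<in> F" for f
      using that F(2) ideal_0[OF J] by (intro bexI[of _ f]) auto
    then show ?thesis using M True by (intro bexI[of _ 1]) auto
  next
    case False
    \<comment> \<open>The highest variable is treated first: later divisors contain only variables
      below w, so the degree bound in w persists.\<close>
    then obtain w where w: "w \<in> Z" "\<And>z. z \<in> Z \<Longrightarrow> rk z w"
      using ex_max[OF psubset.hyps] Z X(2) by (metis subsetD)
    \<comment> \<open>The sum bounds the degree of every member of F at once, which yields a common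
      exponent for the multiplier.\<close>
    define t where "t = (\<Sum>f\<in>F. deg_in w f)"
    note gw = g[OF w(1)]
    have dt: "deg_in w f < e w + t" if "f \<in> F" for f
    proof -
      have "deg_in w f \<le> t" unfolding t_def using that F(1) by (intro member_le_sum) auto
      then show ?thesis using gw by simp
    qed
    have gw': "g w = Iw w * Var w ^ e w + T w" "0 < e w" "deg_in w (T w) < e w" "w \<notin> vars (Iw w)"
      using gw by (auto simp: polys_def below_def lt_def)
    have "\<exists>q r. Iw w ^ t * f = q * g w + r \<and> deg_in w r < e w \<and>
        vars q \<subseteq> vars f \<union> (vars (Iw w) \<union> vars (T w) \<union> {w}) \<and>
        vars r \<subseteq> vars f \<union> (vars (Iw w) \<union> vars (T w) \<union> {w}) \<and>
       (\<forall>x. x \<notin> vars (Iw w) \<union> vars (T w) \<union> {w} \<longrightarrow> deg_in x r \<le> deg_in x f)" if "f \<in> F" for f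
      by (rule pseudo_division[OF gw'(1,2,4,3) dt[OF that]])
    then obtain q R where R: "\<And>f. f \<in> F \<Longrightarrow> Iw w ^ t * f = q f * g w + R f \<and> deg_in w (R f) < e w \<and>
        vars (q f) \<subseteq> vars f \<union> (vars (Iw w) \<union> vars (T w) \<union> {w}) \<and>
        vars (R f) \<subseteq> vars f \<union> (vars (Iw w) \<union> vars (T w) \<union> {w}) \<and>
       (\<forall>x. x \<notin> vars (Iw w) \<union> vars (T w) \<union> {w} \<longrightarrow> deg_in x (R f) \<le> deg_in x f)"
      by metis
    have VX: "vars (Iw w) \<union> vars (T w) \<union> {w} \<subseteq> X" using gw w(1) Z by (auto simp: polys_def)
    have qR: "q f \<in> polys X" "R f \<in> polys X" if "f \<in> F" for f
      using R[OF that] VX F(2) that unfolding polys_def by blast+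
    have "\<exists>s\<in>M \<inter> polys X. \<forall>f\<in>R ` F. \<exists>r\<in>polys X. s * f - r \<in> J \<and> (\<forall>z\<in>Z - {w}. deg_in z r < e z) \<and>
     (\<forall>x\<in>X. (\<forall>z\<in>Z - {w}. lt z x) \<longrightarrow> deg_in x r \<le> deg_in x f)"
    proof (rule psubset.IH)
      show "finite (R ` F)" "R ` F \<subseteq> polys X" using F qR by auto
      show "Z - {w} \<subset> Z" "Z - {w} \<subseteq> X" using w(1) Z by auto
      fix z assume "z \<in> Z - {w}"
      then show "g z = Iw z * Var z ^ e z + T z \<and> 0 < e z \<and> deg_in z (T z) < e z \<and>
       Iw z \<in> polys (X \<inter> below z) \<and> T z \<in> polys (X \<inter> upto z) \<and> g z \<in> J \<and> (\<forall>s\<in>M. Iw z * s \<in> M)"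
        using g[of z] by blast
    qed
    then obtain s where s: "s \<in> M" "s \<in> polys X"
      and sR: "\<And>f. f \<in> F \<Longrightarrow> \<exists>r\<in>polys X. s * R f - r \<in> J \<and> (\<forall>z\<in>Z - {w}. deg_in z r < e z) \<and>
     (\<forall>x\<in>X. (\<forall>z\<in>Z - {w}. lt z x) \<longrightarrow> deg_in x r \<le> deg_in x (R f))"
      by auto
    have "Iw w ^ n * s \<in> M" for n
      by (induction n) (use s gw in \<open>auto simp: mult.assoc\<close>)
    moreover have "Iw w ^ t * s \<in> polys X"
      using gw s by (intro polys_mult polys_power) (auto intro: polys_mono[rotated])
    moreover have "\<exists>r\<in>polys X. Iw w ^ t * s * f - r \<in> J \<and> (\<forall>z\<in>Z. deg_in z r < e z) \<and>
     (\<forall>x\<in>X. (\<forall>z\<in>Z. lt z x) \<longrightarrow> deg_in x r \<le> deg_in x f)" if f: "f \<in> F" for f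
    proof -
      obtain r where r: "r \<in> polys X" "s * R f - r \<in> J" "\<forall>z\<in>Z - {w}. deg_in z r < e z"
        "\<forall>x\<in>X. (\<forall>z\<in>Z - {w}. lt z x) \<longrightarrow> deg_in x r \<le> deg_in x (R f)"
        using sR[OF f] by blast
      have "Iw w ^ t * s * f - r = s * (Iw w ^ t * f) - r" by (simp add: algebra_simps)
      also have "\<dots> = s * q f * g w + (s * R f - r)" using R[OF f] by (simp add: algebra_simps)
      finally have "Iw w ^ t * s * f - r = s * q f * g w + (s * R f - r)" .
      moreover have "s * q f \<in> polys Y"
        using polys_mono[OF X(1)] polys_mult s(2) qR(1)[OF f] by blast
      ultimately have "Iw w ^ t * s * f - r \<in> J"
        using gw r(2) ideal_add[OF J] ideal_mult[OF J] by metis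
      moreover have "deg_in w r < e w"
      proof -
        \<comment> \<open>The induction hypothesis does not raise degrees in variables above all of
          Z - {w}, and w is one of these.\<close>
        have "\<forall>z\<in>Z - {w}. lt z w" using w by (auto simp: lt_def)
        then have "deg_in w r \<le> deg_in w (R f)" using r(4) w(1) Z by blast
        then show ?thesis using R[OF f] by linarith
      qed
      moreover have "deg_in x r \<le> deg_in x f" if x: "x \<in> X" "\<forall>z\<in>Z. lt z x" for x
      proof -
        have "lt w x" using x w by blast
        then have "\<not> rk x w" using lt_not_rk X(2) x(1) w(1) Z by blast
        then have "x \<notin> vars (Iw w) \<union> vars (T w) \<union> {w}"
          using gw \<open>lt w x\<close> by (auto simp: polys_def below_def upto_def lt_def)
        then have "deg_in x (R f) \<le> deg_in x f" using R[OF f] by blast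
        moreover have "deg_in x r \<le> deg_in x (R f)" using r(4) x by blast
        ultimately show ?thesis by linarith
      qed
      ultimately show ?thesis using r by blast
    qed
    ultimately show ?thesis by blast
  qed
qed

end

section \<open>Reduction modulo a differentially autoreduced set\<close>

context orderly_ranking
begin

definition leader_derivs :: "'k::zero dpoly set \<Rightarrow> dvar set" where
  "leader_derivs A = {op_var \<theta> (leader rk a) | \<theta> a. valid_op m \<theta> \<and> a \<in> A}"

lemma diff_autoreduced_props:
  assumes "diff_autoreduced (Rset m l) rk A"
  shows "finite A" "\<And>a. a \<in> A \<Longrightarrow> a \<in> Rset m l" "\<And>a. a \<in> A \<Longrightarrow> vars a \<noteq> {}"
    "\<And>a b. a \<in> A \<Longrightarrow> b \<in> A \<Longrightarrow> a \<noteq> b \<Longrightarrow> diff_reduced rk a b"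
  using assms by (auto simp: diff_autoreduced_def)

lemma leader_inj:
  assumes "diff_autoreduced (Rset m l) rk A" "a \<in> A" "b \<in> A" "leader rk a = leader rk b"
  shows "a = b"
  using autoreduced_leader_inj[of "diff_reduced rk" "Rset m l" A a b] assms diff_reduced_imp_alg_reduced
  unfolding diff_autoreduced_iff by blast

lemma leader_not_proper_derivative:
  assumes "diff_autoreduced (Rset m l) rk A" "a \<in> A" "b \<in> A"
  shows "\<not> proper_derivative (leader rk a) (leader rk b)"
proof (cases "a = b")
  case True
  then show ?thesis unfolding proper_derivative_def
    using op_var_eq_self_iff[of _ "leader rk b"] by (auto simp: eq_commute[of "leader rk b"])
next
  case False
  then have "diff_reduced rk a b" using diff_autoreduced_props(4)[OF assms(1)] assms by simp
  moreover have "leader rk a \<in> vars a"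
    using diff_autoreduced_props(2,3)[OF assms(1)] assms leader_in_vars[of a] by simp
  ultimately show ?thesis unfolding diff_reduced_def by simp
qed

lemma leader_in_leader_derivs: "a \<in> A \<Longrightarrow> leader rk a \<in> leader_derivs A"
  unfolding leader_derivs_def by (intro CollectI exI[of _ 0] exI[of _ a]) simp

lemma op_var_leader_derivs:
  assumes "v \<in> leader_derivs A" "valid_op m \<theta>"
  shows "op_var \<theta> v \<in> leader_derivs A"
proof -
  obtain \<theta>' a where "v = op_var \<theta>' (leader rk a)" "valid_op m \<theta>'" "a \<in> A"
    using assms(1) unfolding leader_derivs_def by blast
  then show ?thesis using assms(2) unfolding leader_derivs_def
    by (intro CollectI exI[of _ "\<theta> + \<theta>'"] exI[of _ a]) (simp add: op_var_op_var valid_op_add)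
qed

lemma leader_derivs_cases:
  assumes "v \<in> leader_derivs A" "valid v"
  obtains a where "a \<in> A" "v = leader rk a"
  | a \<theta> where "a \<in> A" "valid_op m \<theta>" "\<theta> \<noteq> 0" "v = op_var \<theta> (leader rk a)"
proof -
  obtain \<theta> a where "v = op_var \<theta> (leader rk a)" "valid_op m \<theta>" "a \<in> A"
    using assms(1) unfolding leader_derivs_def by blast
  then show ?thesis using that by (cases "\<theta> = 0") auto
qed

lemma initial_form:
  fixes f :: "'k::comm_ring_1 dpoly"
  assumes "f \<in> Rset m l" "vars f \<noteq> {}"
  defines "u \<equiv> leader rk f"
  obtains T where "f = initial rk f * Var u ^ deg_in u f + T" "deg_in u T < deg_in u f"
    "T \<in> polys (upto u)" "initial rk f \<in> polys (below u)"
proof -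
  have pos: "0 < deg_in u f" using deg_leader_pos assms by (simp add: u_def)
  obtain T where T: "f = coeff_var u (deg_in u f) f * Var u ^ deg_in u f + T"
    "deg_in u T < deg_in u f" "vars T \<subseteq> vars f"
    by (rule split_coeff_var[of u f "deg_in u f"]) (use pos in simp_all)
  have f: "vars f \<subseteq> upto u" using in_polys_upto_leader[OF assms(1,2)] by (simp add: polys_def u_def)
  then have "initial rk f \<in> polys (below u)"
    using vars_coeff_var[of u "deg_in u f" f]
    by (auto simp: initial_def lcoeff_var_eq u_def polys_def upto_def below_def lt_def)
  moreover have "T \<in> polys (upto u)" using T(3) f by (auto simp: polys_def)
  moreover have "f = initial rk f * Var u ^ deg_in u f + T"
    unfolding initial_def lcoeff_var_eq u_def[symmetric] by (rule T(1))
  ultimately show ?thesis using that T(2) by blast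
qed

text \<open>Reassembles separately reduced parts: v is the leader and d the degree once p is
  nonzero; the degree bound on q forces d > 0.\<close>

lemma leader_lead_form:
  fixes p q :: "'k::comm_ring_1 dpoly"
  assumes pq: "p \<in> polys (below v)" "q \<in> polys (upto v)" "deg_in v q < d" "p \<noteq> 0" and v: "valid v"
  defines "f \<equiv> p * Var v ^ d + q"
  shows "vars f \<noteq> {}" "f \<in> polys (upto v)" "leader rk f = v" "deg_in v f = d"
    "\<And>x. x \<noteq> v \<Longrightarrow> deg_in x f \<le> max (deg_in x p) (deg_in x q)"
    "vars f \<subseteq> vars p \<union> vars q \<union> {v}"
proof -
  have vp: "v \<notin> vars p" using pq(1) by (auto simp: polys_def below_def lt_def)
  show deg: "deg_in v f = d" unfolding f_def by (rule deg_in_lead_form) (use vp pq in auto)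
  then have vf: "v \<in> vars f" using pq(3) deg_in_pos_iff[of v f] by simp
  then show "vars f \<noteq> {}" by auto
  show vars: "vars f \<subseteq> vars p \<union> vars q \<union> {v}"
  proof -
    have "p * Var v ^ d \<in> polys (vars p \<union> vars q \<union> {v})"
      by (intro polys_mult polys_power polys_Var) (auto simp: polys_def)
    moreover have "q \<in> polys (vars p \<union> vars q \<union> {v})" by (auto simp: polys_def)
    ultimately have "f \<in> polys (vars p \<union> vars q \<union> {v})" unfolding f_def by (rule polys_add)
    then show ?thesis by (simp add: polys_def)
  qed
  have "below v \<subseteq> upto v" "v \<in> upto v" using v rk_refl by (auto simp: below_def upto_def lt_def)
  then show fup: "f \<in> polys (upto v)" using vars pq by (auto simp: polys_def)
  show "leader rk f = v"
  proof (rule leader_eqI[OF _ vf])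
    show "f \<in> Rset m l" using fup by (auto simp: polys_def Rset_def upto_def)
    show "rk w v" if "w \<in> vars f" for w using fup that by (auto simp: polys_def upto_def)
  qed
  show "deg_in x f \<le> max (deg_in x p) (deg_in x q)" if "x \<noteq> v" for x
    using deg_in_add[of x "p * Var v ^ d" q] deg_in_mult[of x p "Var v ^ d"]
      deg_in_Var_power[of x v d, where 'k = 'k] that unfolding f_def by simp
qed

text \<open>Describes the multipliers that reduction produces. The cofactor is confined to the
  variables of A so that it stays in \<open>Rh\<close> when an ideal is contracted to
  \<open>Rh\<close>.\<close>

definition divides_power :: "'k::comm_ring_1 dpoly set \<Rightarrow> 'k dpoly \<Rightarrow> bool" where
  "divides_power A s \<longleftrightarrow> (\<exists>N q. q \<in> polys (\<Union>(vars ` A)) \<and> q * s = H rk A ^ N)"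

lemma initial_separant_divides_H:
  fixes A :: "'k::comm_ring_1 dpoly set"
  assumes "finite A" "a \<in> A" and s: "s = initial rk a \<or> s = separant rk a"
  obtains q where "q \<in> polys (\<Union>(vars ` A))" "q * s = H rk A"
proof -
  have in_polys: "initial rk b \<in> polys (\<Union>(vars ` A))" "separant rk b \<in> polys (\<Union>(vars ` A))"
    if "b \<in> A" for b
    using that vars_coeff_var[of "leader rk b" "deg_in (leader rk b) b" b]
      vars_pderiv_var[of "leader rk b" b]
    by (auto simp: polys_def initial_def separant_def lcoeff_var_eq)
  \<comment> \<open>The other one of the two factors that a contributes to \<open>H rk A\<close>; if
    initial and separant coincide, either choice is right.\<close>
  define s' where "s' = (if s = initial rk a then separant rk a else initial rk a)"
  let ?q = "(\<Prod>f\<in>A - {a}. initial rk f * separant rk f) * s'"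
  have "?q \<in> polys (\<Union>(vars ` A))"
    using in_polys assms(2) by (intro polys_mult polys_prod) (auto simp: s'_def)
  moreover have "?q * s = H rk A"
    using s unfolding H_def prod.remove[OF assms(1,2)] by (auto simp: s'_def mult_ac)
  ultimately show ?thesis using that by blast
qed

lemma divides_power_1: "divides_power A 1"
  unfolding divides_power_def by (intro exI[of _ 0] exI[of _ 1]) auto

lemma divides_power_mult:
  assumes "divides_power A s" "divides_power A s'"
  shows "divides_power A (s * s')"
proof -
  obtain N q N' q' where "q \<in> polys (\<Union>(vars ` A))" "q * s = H rk A ^ N"
    "q' \<in> polys (\<Union>(vars ` A))" "q' * s' = H rk A ^ N'"
    using assms unfolding divides_power_def by blast
  then have "q * q' \<in> polys (\<Union>(vars ` A))" "(q * s) * (q' * s') = H rk A ^ (N + N')"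
    by (simp_all add: polys_mult power_add)
  then show ?thesis unfolding divides_power_def
    by (intro exI[of _ "N + N'"] exI[of _ "q * q'"]) (simp add: mult_ac)
qed

text \<open>Every derivative of a leader in X gets one divisor: the element of A itself at a leader,
  a proper derivative of an element, linear in z, elsewhere. X is finite, so this is a finite family
  of pseudo-divisions. J is arbitrary and has to contain only the derivatives with leader in X; thus
  the result applies to differential ideals and to the truncated ideals of \<open>Rh\<close>
  alike.\<close>

theorem diff_reduction:
  fixes A :: "'k::comm_ring_1 dpoly set"
  assumes A: "diff_autoreduced (Rset m l) rk A"
    and X: "finite X" "\<And>x. x \<in> X \<Longrightarrow> upto x \<subseteq> X" "\<And>x. x \<in> X \<Longrightarrow> valid x"
    and J: "is_ideal_in (polys Y) J" "X \<subseteq> Y"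
    and gens: "\<And>a \<theta>. a \<in> A \<Longrightarrow> valid_op m \<theta> \<Longrightarrow> op_var \<theta> (leader rk a) \<in> X \<Longrightarrow> apply_op \<delta> m \<theta> a \<in> J"
    and F: "finite F" "F \<subseteq> polys X"
  obtains s where "s \<in> polys X" "divides_power A s"
    "\<forall>f\<in>F. \<exists>r\<in>polys X. s * f - r \<in> J \<and> (\<forall>a\<in>A. diff_reduced rk r a) \<and>
      (\<forall>x\<in>X. (\<forall>z\<in>X \<inter> leader_derivs A. lt z x) \<longrightarrow> deg_in x r \<le> deg_in x f)"
proof -
  note Ap = diff_autoreduced_props[OF A]
  define Z where "Z = X \<inter> leader_derivs A"
  let ?M = "{s. divides_power A s}"
  \<comment> \<open>The last two conjuncts turn the bound by e into differential reducedness: at a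
    leader e does not exceed the degree of the element, at a proper derivative e is 1.\<close>
  let ?Q = "\<lambda>z (g, Iw, e, T). g = Iw * Var z ^ e + T \<and> 0 < e \<and> deg_in z T < e \<and>
       Iw \<in> polys (X \<inter> below z) \<and> T \<in> polys (X \<inter> upto z) \<and> g \<in> J \<and> (\<forall>s\<in>?M. Iw * s \<in> ?M) \<and>
       (\<forall>a\<in>A. leader rk a = z \<longrightarrow> e \<le> deg_in z a) \<and> (z \<notin> leader rk ` A \<longrightarrow> e \<le> 1)"
  have ex: "\<exists>p. ?Q z p" if "z \<in> Z" for z
  proof -
    have zX: "z \<in> X" "valid z" "z \<in> leader_derivs A" using that X(3) by (auto simp: Z_def)
    have up: "upto z \<subseteq> X" "below z \<subseteq> X" using X(2)[OF zX(1)] by (auto simp: below_def upto_def lt_def)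
    then have up': "X \<inter> upto z = upto z" "X \<inter> below z = below z" by auto
    have mult: "\<forall>s\<in>?M. t * s \<in> ?M" if "a \<in> A" "t = initial rk a \<or> t = separant rk a" for a t
    proof -
      have "divides_power A t"
        using initial_separant_divides_H[OF Ap(1) that(1), of t] that(2)
        unfolding divides_power_def by (metis power_one_right)
      then show ?thesis using divides_power_mult by auto
    qed
    from zX(3,2) show ?thesis
    proof (cases rule: leader_derivs_cases)
      case (1 a)
      note a = Ap(2,3)[OF 1(1)]
      obtain T where T: "a = initial rk a * Var z ^ deg_in z a + T" "deg_in z T < deg_in z a"
        "T \<in> polys (upto z)" "initial rk a \<in> polys (below z)"
        unfolding 1(2) by (rule initial_form[OF a])
      have "a \<in> J" using gens[of a 0] 1 zX by (simp add: apply_op_0)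
      moreover have "0 < deg_in z a" using T(2) by simp
      moreover have "deg_in z a \<le> deg_in z b" if "b \<in> A" "leader rk b = z" for b
        using leader_inj[OF A 1(1) that(1)] 1(2) that(2) by simp
      moreover have "z \<in> leader rk ` A" using 1 by blast
      ultimately have "?Q z (a, initial rk a, deg_in z a, T)"
        unfolding prod.case up' using T mult[OF 1(1)] by blast
      then show ?thesis by blast
    next
      case (2 a \<theta>)
      note a = Ap(2,3)[OF 2(1)]
      obtain T where T: "T \<in> polys (below z)" "apply_op \<delta> m \<theta> a = separant rk a * Var z + T"
        "separant rk a \<in> polys (below z)"
        using apply_op_linear(1)[OF a 2(2,3), of \<delta>] apply_op_linear(2)[OF a 2(2,3)] 2(4) by auto
      have "z \<notin> vars T" using T(1) by (auto simp: polys_def below_def lt_def)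
      then have "deg_in z T < 1" by (simp add: deg_in_eq_0_iff)
      moreover have "below z \<subseteq> upto z" by (auto simp: below_def upto_def lt_def)
      then have "T \<in> polys (upto z)" using T(1) polys_mono by blast
      moreover have "apply_op \<delta> m \<theta> a \<in> J" using gens[of a \<theta>] 2 zX by simp
      moreover have "proper_derivative z (leader rk a)" using 2 unfolding proper_derivative_def by blast
      then have "z \<notin> leader rk ` A" using leader_not_proper_derivative[OF A _ 2(1)] by auto
      ultimately have "?Q z (apply_op \<delta> m \<theta> a, separant rk a, 1, T)"
        unfolding prod.case up' power_one_right using T mult[OF 2(1)] by blast
      then show ?thesis by blast
    qed
  qed
  have "\<exists>G. \<forall>z\<in>Z. ?Q z (G z)" by (rule bchoice) (rule ballI, rule ex)
  then obtain G where G: "\<forall>z\<in>Z. ?Q z (G z)" ..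
  define g Iw e T where "g z = fst (G z)" and "Iw z = fst (snd (G z))" and "e z = fst (snd (snd (G z)))"
    and "T z = snd (snd (snd (G z)))" for z
  have GQ: "?Q z (g z, Iw z, e z, T z)" if "z \<in> Z" for z
  proof -
    have eq: "(g z, Iw z, e z, T z) = G z" by (simp add: g_def Iw_def e_def T_def)
    show ?thesis unfolding eq by (rule bspec[OF G that])
  qed
  have "\<exists>s\<in>?M \<inter> polys X. \<forall>f\<in>F. \<exists>r\<in>polys X. s * f - r \<in> J \<and> (\<forall>z\<in>Z. deg_in z r < e z) \<and>
     (\<forall>x\<in>X. (\<forall>z\<in>Z. lt z x) \<longrightarrow> deg_in x r \<le> deg_in x f)"
  proof (rule reduce_family[OF J X(3)])
    show "1 \<in> ?M" using divides_power_1 by simp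
    show "finite Z" "Z \<subseteq> X" using X(1) by (auto simp: Z_def)
    show "g z = Iw z * Var z ^ e z + T z \<and> 0 < e z \<and> deg_in z (T z) < e z \<and>
       Iw z \<in> polys (X \<inter> below z) \<and> T z \<in> polys (X \<inter> upto z) \<and> g z \<in> J \<and> (\<forall>s\<in>?M. Iw z * s \<in> ?M)"
      if "z \<in> Z" for z using GQ[OF that] unfolding prod.case by blast
  qed (use F in blast)+
  then obtain s where s: "divides_power A s" "s \<in> polys X"
    and r: "\<And>f. f \<in> F \<Longrightarrow> \<exists>r\<in>polys X. s * f - r \<in> J \<and> (\<forall>z\<in>Z. deg_in z r < e z) \<and>
     (\<forall>x\<in>X. (\<forall>z\<in>Z. lt z x) \<longrightarrow> deg_in x r \<le> deg_in x f)" by blast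
  have "diff_reduced rk r a" if r: "r \<in> polys X" "\<forall>z\<in>Z. deg_in z r < e z" and a: "a \<in> A" for r a
    unfolding diff_reduced_def
  proof
    show "\<forall>v\<in>vars r. \<not> proper_derivative v (leader rk a)"
    proof (intro ballI notI)
      fix v assume v: "v \<in> vars r" "proper_derivative v (leader rk a)"
      then have vX: "v \<in> X" using r(1) by (auto simp: polys_def)
      then have "valid v" by (rule X(3))
      obtain \<theta> where \<theta>: "\<theta> \<noteq> 0" "v = op_var \<theta> (leader rk a)" using v(2) unfolding proper_derivative_def by blast
      then have "valid_op m \<theta>" using \<open>valid v\<close> valid_op_var by simp
      then have vZ: "v \<in> Z" using vX \<theta> a by (auto simp: Z_def leader_derivs_def)
      have "v \<notin> leader rk ` A" using leader_not_proper_derivative[OF A _ a] v(2) by auto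
      \<comment> \<open>By autoreducedness a proper derivative of a leader is not itself a leader,
        so the bound is 1 and v cannot occur in the remainder.\<close>
      then have "e v \<le> 1" using GQ[OF vZ] unfolding prod.case by blast
      then have "deg_in v r = 0" using r(2) vZ by fastforce
      then show False using v(1) by (simp add: deg_in_eq_0_iff)
    qed
    show "deg_in (leader rk a) r < deg_in (leader rk a) a"
    proof (cases "leader rk a \<in> X")
      case True
      then have "leader rk a \<in> Z" using leader_in_leader_derivs[OF a] by (simp add: Z_def)
      then have "e (leader rk a) \<le> deg_in (leader rk a) a" "deg_in (leader rk a) r < e (leader rk a)"
        using GQ[of "leader rk a"] r(2) a unfolding prod.case by blast+
      then show ?thesis by simp
    next
      case False
      then have "deg_in (leader rk a) r = 0" using r(1) by (auto simp: polys_def deg_in_eq_0_iff)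
      then show ?thesis using deg_leader_pos Ap(2,3)[OF a] by simp
    qed
  qed
  then show ?thesis using that[OF s(2,1)] r unfolding Z_def by meson
qed

end

section \<open>Saturations, generated ideals and constants\<close>

lemma saturation_singleton: "f \<in> saturation S J {h} \<longleftrightarrow> f \<in> S \<and> (\<exists>n. h ^ n * f \<in> J)"
proof -
  have "prod_list xs = h ^ length xs" if "set xs \<subseteq> {h}" for xs
    using that by (induction xs) auto
  moreover have "set (replicate n h) \<subseteq> {h}" "prod_list (replicate n h) = h ^ n" for n
    by (auto simp: prod_list_replicate)
  ultimately have "(\<exists>xs. set xs \<subseteq> {h} \<and> prod_list xs * f \<in> J) \<longleftrightarrow> (\<exists>n. h ^ n * f \<in> J)"
    by metis
  then show ?thesis unfolding saturation_def by simp
qed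

text \<open>The ideal J shows that the intersection defining \<open>ideal_gen\<close> runs over a
  nonempty family; an empty one would give the universal set.\<close>

lemma is_ideal_in_ideal_gen:
  assumes "is_ideal_in S J" "G \<subseteq> J"
  shows "is_ideal_in S (ideal_gen S G)" "ideal_gen S G \<subseteq> J" "G \<subseteq> ideal_gen S G"
  using assms unfolding is_ideal_in_def ideal_gen_def by auto

lemma is_diff_ideal_diff_ideal_gen:
  assumes "is_diff_ideal \<delta> m l J" "F \<subseteq> J"
  shows "is_diff_ideal \<delta> m l (diff_ideal_gen \<delta> m l F)" "diff_ideal_gen \<delta> m l F \<subseteq> J"
    "F \<subseteq> diff_ideal_gen \<delta> m l F"
  using assms unfolding is_diff_ideal_def is_ideal_in_def diff_ideal_gen_def by auto

lemma vars_empty_iff: "vars f = {} \<longleftrightarrow> f = Poly_Mapping.single 0 (lk f 0)"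
proof
  assume v: "vars f = {}"
  show "f = Poly_Mapping.single 0 (lk f 0)"
  proof (rule poly_mapping_eqI)
    fix k
    show "lk f k = lk (Poly_Mapping.single 0 (lk f 0)) k"
    proof (cases "k = 0")
      case False
      then have "mons k \<noteq> {}" by simp
      then have "k \<notin> mons f" using v by (auto simp: vars_def)
      then show ?thesis using False by (simp add: in_keys_iff lookup_single)
    qed simp
  qed
next
  assume "f = Poly_Mapping.single 0 (lk f 0)"
  then show "vars f = {}" using vars_single[of 0 "lk f 0"] by auto
qed

lemma ideal_const_imp_1:
  fixes f :: "'k::field dpoly"
  assumes "is_ideal_in (polys X) J" "f \<in> J" "f \<noteq> 0" "vars f = {}"
  shows "1 \<in> J"
proof -
  let ?c = "lk f 0"
  have f: "f = Poly_Mapping.single 0 ?c" using assms(4) vars_empty_iff by blast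
  then have "?c \<noteq> 0" using assms(3) by auto
  have "Poly_Mapping.single 0 (inverse ?c) * f \<in> J"
    by (rule ideal_mult[OF assms(1,2)]) (auto intro: polys_single)
  moreover have "Poly_Mapping.single 0 (inverse ?c) * f = 1"
    using \<open>?c \<noteq> 0\<close> by (subst f) (simp add: mult_single)
  ultimately show ?thesis by simp
qed

subsection \<open>Evaluation at a differential field element\<close>

definition eval_mon :: "(dvar \<Rightarrow> 'k::comm_ring_1) \<Rightarrow> (dvar \<Rightarrow>\<^sub>0 nat) \<Rightarrow> 'k" where
  "eval_mon val mon = (\<Prod>v\<in>mons mon. val v ^ lk mon v)"

definition eval_poly :: "(dvar \<Rightarrow> 'k::comm_ring_1) \<Rightarrow> 'k dpoly \<Rightarrow> 'k" where
  "eval_poly val f = (\<Sum>mon\<in>mons f. lk f mon * eval_mon val mon)"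

lemma eval_mon_superset:
  "finite S \<Longrightarrow> mons mon \<subseteq> S \<Longrightarrow> eval_mon val mon = (\<Prod>v\<in>S. val v ^ lk mon v)"
  unfolding eval_mon_def by (rule prod.mono_neutral_left) (auto simp: in_keys_iff)

lemma eval_poly_superset:
  "finite S \<Longrightarrow> mons f \<subseteq> S \<Longrightarrow> eval_poly val f = (\<Sum>mon\<in>S. lk f mon * eval_mon val mon)"
  unfolding eval_poly_def by (rule sum.mono_neutral_left) (auto simp: in_keys_iff)

lemma eval_mon_add: "eval_mon val (a + b) = eval_mon val a * eval_mon val b"
proof -
  let ?S = "mons a \<union> mons b"
  have "mons (a + b) \<subseteq> ?S" by (rule keys_add)
  then show ?thesis
    using eval_mon_superset[of ?S "a + b" val] eval_mon_superset[of ?S a val] eval_mon_superset[of ?S b val]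
    by (simp add: lookup_add power_add prod.distrib)
qed

lemma eval_poly_add: "eval_poly val (f + g) = eval_poly val f + eval_poly val g"
proof -
  let ?S = "mons f \<union> mons g"
  have "mons (f + g) \<subseteq> ?S" by (rule keys_add)
  then show ?thesis
    using eval_poly_superset[of ?S "f + g" val] eval_poly_superset[of ?S f val] eval_poly_superset[of ?S g val]
    by (simp add: lookup_add sum.distrib distrib_right)
qed

lemma eval_poly_0 [simp]: "eval_poly val 0 = 0"
  by (simp add: eval_poly_def)

lemma eval_poly_single [simp]: "eval_poly val (Poly_Mapping.single mon c) = c * eval_mon val mon"
  by (simp add: eval_poly_def)

lemma eval_poly_sum: "eval_poly val (sum f S) = (\<Sum>x\<in>S. eval_poly val (f x))"
  by (induction S rule: infinite_finite_induct) (auto simp: eval_poly_add)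

lemma eval_poly_mult: "eval_poly val (f * g) = eval_poly val f * eval_poly val g"
proof -
  have "f * g = (\<Sum>a\<in>mons f. \<Sum>b\<in>mons g. Poly_Mapping.single (a + b) (lk f a * lk g b))"
    by (subst (1) poly_eq_sum_single[of f], subst (1) poly_eq_sum_single[of g])
       (simp add: sum_product mult_single)
  then have "eval_poly val (f * g)
      = (\<Sum>a\<in>mons f. \<Sum>b\<in>mons g. (lk f a * eval_mon val a) * (lk g b * eval_mon val b))"
    by (simp add: eval_poly_sum eval_mon_add mult_ac)
  then show ?thesis by (simp add: eval_poly_def sum_product)
qed

lemma eval_poly_1 [simp]: "eval_poly val 1 = 1"
  by (simp add: eval_poly_def eval_mon_def)

lemma eval_poly_power: "eval_poly val (f ^ n) = eval_poly val f ^ n"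
  by (induction n) (auto simp: eval_poly_mult)

lemma eval_poly_prod: "eval_poly val (prod f S) = (\<Prod>x\<in>S. eval_poly val (f x))"
  by (induction S rule: infinite_finite_induct) (auto simp: eval_poly_mult)

lemma eval_poly_Var [simp]: "eval_poly val (Var v) = val v"
  by (simp add: Var_def eval_mon_def)

lemma derivation_0:
  assumes "is_derivation d" shows "d 0 = 0"
proof -
  have "d (0 + 0) = d 0 + d 0" using assms unfolding is_derivation_def by blast
  then show ?thesis by simp
qed

lemma derivation_1:
  assumes "is_derivation d" shows "d 1 = 0"
proof -
  have "d (1 * 1) = d 1 * 1 + 1 * d 1" using assms unfolding is_derivation_def by blast
  then show ?thesis by simp
qed

lemma derivation_add: "is_derivation d \<Longrightarrow> d (a + b) = d a + d b"
  by (simp add: is_derivation_def)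

lemma derivation_mult: "is_derivation d \<Longrightarrow> d (a * b) = d a * b + a * d b"
  by (simp add: is_derivation_def)

lemma derivation_sum: "is_derivation d \<Longrightarrow> d (sum f S) = (\<Sum>x\<in>S. d (f x))"
  by (induction S rule: infinite_finite_induct) (auto simp: derivation_0 derivation_add)

lemma derivation_power: "is_derivation d \<Longrightarrow> d (a ^ n) = of_nat n * a ^ (n - 1) * d a"
proof (induction n)
  case (Suc n)
  then show ?case by (cases n) (auto simp: derivation_mult derivation_1 algebra_simps)
qed (simp add: derivation_1)

lemma derivation_prod:
  assumes d: "is_derivation d"
  shows "finite S \<Longrightarrow> d (prod f S) = (\<Sum>x\<in>S. d (f x) * prod f (S - {x}))"
proof (induction S rule: finite_induct)
  case empty
  then show ?case using d by (simp add: derivation_1)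
next
  case (insert a S)
  have "(\<Sum>x\<in>S. d (f x) * prod f (insert a S - {x})) = (\<Sum>x\<in>S. f a * (d (f x) * prod f (S - {x})))"
  proof (rule sum.cong)
    fix x assume "x \<in> S"
    then have "insert a S - {x} = insert a (S - {x})" "a \<notin> S - {x}" using insert.hyps by auto
    then show "d (f x) * prod f (insert a S - {x}) = f a * (d (f x) * prod f (S - {x}))"
      using insert.hyps by (simp add: mult_ac)
  qed auto
  moreover have "insert a S - {a} = S" using insert.hyps by auto
  ultimately show ?case
    using insert d by (simp add: derivation_mult sum_distrib_left)
qed

lemma derivation_eval_mon:
  assumes d: "is_derivation d"
  shows "d (eval_mon val mon)
    = (\<Sum>v\<in>mons mon. of_nat (lk mon v) * eval_mon val (Poly_Mapping.update v (lk mon v - 1) mon) * d (val v))"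
proof -
  let ?S = "mons mon"
  have "d (eval_mon val mon) = (\<Sum>v\<in>?S. d (val v ^ lk mon v) * (\<Prod>w\<in>?S - {v}. val w ^ lk mon w))"
    unfolding eval_mon_def by (rule derivation_prod[OF d]) simp
  also have "\<dots> = (\<Sum>v\<in>?S. of_nat (lk mon v) * eval_mon val (Poly_Mapping.update v (lk mon v - 1) mon) * d (val v))"
  proof (rule sum.cong)
    fix v assume v: "v \<in> ?S"
    let ?u = "Poly_Mapping.update v (lk mon v - 1) mon"
    have "mons ?u \<subseteq> ?S" using v by (auto simp: keys_update)
    then have "eval_mon val ?u = (\<Prod>w\<in>?S. val w ^ lk ?u w)" by (intro eval_mon_superset) auto
    also have "\<dots> = val v ^ (lk mon v - 1) * (\<Prod>w\<in>?S - {v}. val w ^ lk ?u w)"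
      using v by (subst prod.remove[of ?S v]) (auto simp: lookup_update)
    also have "(\<Prod>w\<in>?S - {v}. val w ^ lk ?u w) = (\<Prod>w\<in>?S - {v}. val w ^ lk mon w)"
      by (rule prod.cong) (auto simp: lookup_update)
    finally show "d (val v ^ lk mon v) * (\<Prod>w\<in>?S - {v}. val w ^ lk mon w)
      = of_nat (lk mon v) * eval_mon val ?u * d (val v)"
      using d by (simp add: derivation_power mult_ac)
  qed auto
  finally show ?thesis .
qed

text \<open>Chain rule: if \<open>val\<close> commutes with the derivation on the variables of f,
  then so does evaluation of f.\<close>

lemma eval_poly_D:
  assumes d: "is_derivation (\<delta> i)"
    and val: "\<And>v. v \<in> vars f \<Longrightarrow> val (op_var (Poly_Mapping.single i 1) v) = \<delta> i (val v)"
  shows "eval_poly val (D \<delta> i f) = \<delta> i (eval_poly val f)"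
proof -
  let ?p = "\<lambda>v mon. of_nat (lk mon v) * eval_mon val (Poly_Mapping.update v (lk mon v - 1) mon) * \<delta> i (val v)"
  have "\<delta> i (eval_mon val mon) = (\<Sum>v\<in>vars f. ?p v mon)" if "mon \<in> mons f" for mon
    unfolding derivation_eval_mon[OF d]
    by (rule sum.mono_neutral_left) (use that in \<open>auto simp: vars_def in_keys_iff\<close>)
  then have "\<delta> i (eval_poly val f)
      = (\<Sum>mon\<in>mons f. \<delta> i (lk f mon) * eval_mon val mon) + (\<Sum>mon\<in>mons f. lk f mon * (\<Sum>v\<in>vars f. ?p v mon))"
    using d by (simp add: eval_poly_def derivation_sum derivation_mult sum.distrib)
  also have "(\<Sum>mon\<in>mons f. lk f mon * (\<Sum>v\<in>vars f. ?p v mon))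
     = (\<Sum>v\<in>vars f. \<Sum>mon\<in>mons f. lk f mon * ?p v mon)"
    unfolding sum_distrib_left by (rule sum.swap)
  also have "\<dots> = (\<Sum>v\<in>vars f. eval_poly val (pderiv_var v f * Var (op_var (Poly_Mapping.single i 1) v)))"
    by (rule sum.cong) (auto simp: eval_poly_mult val pderiv_var_def eval_poly_sum sum_distrib_left sum_distrib_right mult_ac
        simp del: One_nat_def)
  finally show ?thesis
    by (simp add: D_def eval_poly_add eval_poly_sum)
qed

text \<open>Extends values b j of the indeterminates to all derivatives by sending \<theta> y_j to
  \<theta> applied to b j in the base field.\<close>

definition derivative_values :: "(nat \<Rightarrow> 'k \<Rightarrow> 'k) \<Rightarrow> nat \<Rightarrow> (nat \<Rightarrow> 'k) \<Rightarrow> dvar \<Rightarrow> 'k" where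
  "derivative_values \<delta> m b v = List.foldr (\<lambda>i. \<delta> i ^^ lk (fst v) i) [0..<m] (b (snd v))"

text \<open>The additional derivation has to be moved from its place in the fixed product to the
  front, which is where commutativity of the derivations enters.\<close>

lemma derivative_values_op_var:
  assumes comm: "\<And>i j a. i < m \<Longrightarrow> j < m \<Longrightarrow> \<delta> i (\<delta> j a) = \<delta> j (\<delta> i a)" and i: "i < m"
  shows "derivative_values \<delta> m b (op_var (Poly_Mapping.single i 1) v) = \<delta> i (derivative_values \<delta> m b v)"
proof -
  let ?\<theta> = "fst v"
  define \<theta>' where "\<theta>' = fst (op_var (Poly_Mapping.single i 1) v)"
  have lk': "lk \<theta>' j = (if j = i then Suc (lk ?\<theta> j) else lk ?\<theta> j)" for j
    by (simp add: \<theta>'_def op_var_def lookup_add lookup_single)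
  have pow: "\<delta> i ((\<delta> j ^^ n) a) = (\<delta> j ^^ n) (\<delta> i a)" if "j < m" for j n a
    using comm[OF i that] by (induction n) auto
  have same: "List.foldr (\<lambda>i. \<delta> i ^^ lk \<theta>' i) xs c = List.foldr (\<lambda>i. \<delta> i ^^ lk ?\<theta> i) xs c"
    if "i \<notin> set xs" for xs c
    using that by (induction xs) (auto simp: lk')
  have "List.foldr (\<lambda>i. \<delta> i ^^ lk \<theta>' i) xs c = \<delta> i (List.foldr (\<lambda>i. \<delta> i ^^ lk ?\<theta> i) xs c)"
    if "set xs \<subseteq> {..<m}" "distinct xs" "i \<in> set xs" for xs c
    using that
  proof (induction xs)
    case (Cons j xs)
    show ?case
    proof (cases "j = i")
      case True
      then have "i \<notin> set xs" using Cons.prems by auto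
      then show ?thesis using True same[of xs c] by (simp add: lk')
    next
      case False
      then show ?thesis using Cons pow[of j] by (simp add: lk')
    qed
  qed simp
  moreover have "set [0..<m] \<subseteq> {..<m}" "distinct [0..<m]" "i \<in> set [0..<m]" using i by auto
  ultimately have "List.foldr (\<lambda>i. \<delta> i ^^ lk \<theta>' i) [0..<m] (b (snd v))
    = \<delta> i (List.foldr (\<lambda>i. \<delta> i ^^ lk ?\<theta> i) [0..<m] (b (snd v)))" by blast
  then show ?thesis
    unfolding derivative_values_def \<theta>'_def[symmetric] by (auto simp: op_var_def)
qed

subsection \<open>Characterizable ideals\<close>

locale characterizable_ideal = orderly_ranking m l rk
  for m l :: nat and rk :: "dvar \<Rightarrow> dvar \<Rightarrow> bool" +
  fixes \<delta> :: "nat \<Rightarrow> 'k::field \<Rightarrow> 'k" and J A :: "'k dpoly set"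
  assumes dfield: "diff_field m \<delta>"
    and characterizable: "characterizable_by \<delta> m l rk J A"
begin

lemma charset: "kolchin_charset m l rk J A"
  using characterizable unfolding characterizable_by_def by blast

lemma autoreduced: "diff_autoreduced (Rset m l) rk A"
  using charset by (simp add: kolchin_charset_def)

lemmas A_props = diff_autoreduced_props[OF autoreduced]

lemma A_subset: "A \<subseteq> J"
  using charset by (simp add: kolchin_charset_def)

lemma diff_ideal: "is_diff_ideal \<delta> m l J"
  using characterizable unfolding characterizable_by_def is_radical_diff_ideal_def by blast

lemma ideal: "is_ideal_in (Rset m l) J"
  using diff_ideal by (simp add: is_diff_ideal_def)

lemma in_J_iff: "f \<in> J \<longleftrightarrow> f \<in> Rset m l \<and> (\<exists>n. H rk A ^ n * f \<in> diff_ideal_gen \<delta> m l A)"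
proof -
  have "J = saturation (Rset m l) (diff_ideal_gen \<delta> m l A) {H rk A}"
    using characterizable unfolding characterizable_by_def by blast
  then have "f \<in> J \<longleftrightarrow> f \<in> saturation (Rset m l) (diff_ideal_gen \<delta> m l A) {H rk A}" by (rule arg_cong)
  then show ?thesis unfolding saturation_singleton .
qed

lemma J_subset: "J \<subseteq> Rset m l"
  using ideal by (simp add: is_ideal_in_def)

lemma polys_vars_A: "q \<in> polys (\<Union>(vars ` A)) \<Longrightarrow> q \<in> Rset m l"
  using A_props(2) by (fastforce simp: polys_def Rset_def)

text \<open>J is saturated with respect to \<open>H rk A\<close>, so it absorbs every multiplier
  that reduction modulo A introduces.\<close>

lemma cancel:
  assumes "divides_power A s" "f \<in> Rset m l" "s * f \<in> J"
  shows "f \<in> J"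
proof -
  obtain N q where q: "q \<in> polys (\<Union>(vars ` A))" "q * s = H rk A ^ N"
    using assms(1) unfolding divides_power_def by blast
  have "q * (s * f) \<in> J" using ideal_mult[OF ideal assms(3) polys_vars_A[OF q(1)]] .
  then obtain n where "H rk A ^ n * (q * (s * f)) \<in> diff_ideal_gen \<delta> m l A" using in_J_iff by blast
  moreover have "H rk A ^ n * (q * (s * f)) = H rk A ^ (n + N) * f"
    by (simp add: power_add q(2)[symmetric] mult_ac)
  ultimately show ?thesis using in_J_iff assms(2) by auto
qed

lemma apply_op_in_J: "a \<in> A \<Longrightarrow> valid_op m \<theta> \<Longrightarrow> apply_op \<delta> m \<theta> a \<in> J"
  using apply_op_closed[of m \<theta> a J \<delta>] A_subset diff_ideal unfolding is_diff_ideal_def by blast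

text \<open>If \<open>1 \<in> J\<close>, minimality of \<open>A\<close> forces \<open>A\<close> to consist of linear polynomials \<open>\<alpha> y\<^sub>j + \<beta>\<close> with constant
  coefficients, one for each \<open>j\<close>; then \<open>y\<^sub>j \<mapsto> - \<beta> / \<alpha>\<close> extends to a differential homomorphism to the base field
  that kills \<open>A\<close> but not \<open>H rk A\<close>.\<close>
lemma one_notin: "1 \<notin> J"
proof
  assume "1 \<in> J"
  then have all: "f \<in> J" if "f \<in> Rset m l" for f
    using ideal_mult[OF ideal \<open>1 \<in> J\<close> that] by simp
  \<comment> \<open>The indeterminate y_j lies in J, so it is not reduced with respect to some a. It
    is no proper derivative, hence the degree condition fails, which forces leader y_j and degree
    1.\<close>
  have yj: "\<exists>a\<in>A. leader rk a = (0, j) \<and> deg_in (0, j) a \<le> 1" if "j < l" for j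
  proof -
    let ?y = "Var (0, j) :: 'k dpoly"
    have vy: "vars ?y = {(0, j)}" by (simp add: Var_def vars_def)
    then have y: "?y \<in> Rset m l" using that by (simp add: Rset_def valid_var_def)
    obtain a where a: "a \<in> A" "\<not> diff_reduced rk ?y a"
      using kolchin_charset_not_reduced[OF charset all[OF y] y] vy by auto
    have "\<not> proper_derivative (0, j) u" for u
      by (auto simp: proper_derivative_def op_var_def prod_eq_iff poly_mapping_eq_iff lookup_add fun_eq_iff)
    then have deg: "deg_in (leader rk a) a \<le> deg_in (leader rk a) ?y"
      using a(2) by (simp add: diff_reduced_def vy)
    moreover have "0 < deg_in (leader rk a) a" using A_props(2,3) a(1) deg_leader_pos by blast
    ultimately have "leader rk a \<in> vars ?y" using deg_in_pos_iff[of "leader rk a" ?y] by simp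
    then have "leader rk a = (0, j)" using vy by simp
    moreover have "deg_in (0, j) ?y \<le> 1" using deg_in_Var_power[of "(0,j)" "(0,j)" 1, where 'k = 'k] by simp
    ultimately show ?thesis using a(1) deg by auto
  qed
  then obtain c where c: "\<And>j. j < l \<Longrightarrow> c j \<in> A \<and> leader rk (c j) = (0, j) \<and> deg_in (0, j) (c j) \<le> 1"
    by metis
  have op0: "op_var \<theta> (0, j) = (\<theta>, j)" for \<theta> j by (simp add: op_var_def)
  have linear: "\<exists>\<alpha> \<beta> j. \<alpha> \<noteq> 0 \<and> j < l \<and> a = c j \<and>
      a = Poly_Mapping.single 0 \<alpha> * Var (0, j) + Poly_Mapping.single 0 \<beta> \<and>
      initial rk a = Poly_Mapping.single 0 \<alpha> \<and> separant rk a = Poly_Mapping.single 0 \<alpha>" if a: "a \<in> A" for a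
  proof -
    note aR = A_props(2,3)[OF a]
    obtain \<theta> j where u: "leader rk a = (\<theta>, j)" by (cases "leader rk a")
    then have j: "j < l" using valid_leader[OF aR] by (simp add: valid_var_def)
    note cj = c[OF j]
    have "\<not> proper_derivative (\<theta>, j) (0, j)"
      using leader_not_proper_derivative[OF autoreduced a, of "c j"] cj u by simp
    then have "\<theta> = 0" using op0[of \<theta> j] unfolding proper_derivative_def by metis
    then have ac: "a = c j" using leader_inj[OF autoreduced a, of "c j"] cj u by simp
    \<comment> \<open>Derivatives of another y_j' are excluded by reducedness with respect to c j',
      proper derivatives of y_j because they outrank the leader.\<close>
    have va: "vars a \<subseteq> {(0, j)}"
    proof
      fix v assume v: "v \<in> vars a"
      obtain \<theta>' j' where v': "v = (\<theta>', j')" by (cases v)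
      have vv: "valid v" using v aR(1) by (simp add: Rset_def)
      then have j': "j' < l" using v' by (simp add: valid_var_def)
      note cj' = c[OF j']
      show "v \<in> {(0, j)}"
      proof (cases "a = c j'")
        case True
        then have jj: "j' = j" using cj' u by simp
        have "\<theta>' = 0"
        proof (rule ccontr)
          assume "\<theta>' \<noteq> 0"
          moreover have "valid (0, j)" using valid_leader[OF aR] u \<open>\<theta> = 0\<close> by simp
          moreover have "valid_op m \<theta>'" using vv v' by (simp add: valid_var_def)
          ultimately have "lt (0, j) v" using lt_op_var[of \<theta>' "(0, j)"] v' jj op0 by simp
          moreover have "rk v (0, j)" using rk_leader[OF aR v] u \<open>\<theta> = 0\<close> by simp
          ultimately show False using lt_not_rk vv \<open>valid (0, j)\<close> by blast
        qed
        then show ?thesis using v' jj by simp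
      next
        case False
        then have red: "diff_reduced rk a (c j')" using A_props(4)[OF a] cj' by simp
        then have "\<not> proper_derivative v (0, j')" using v cj' by (simp add: diff_reduced_def)
        then have "\<theta>' = 0" using v' op0[of \<theta>' j'] unfolding proper_derivative_def by metis
        moreover have "deg_in (0, j') a < 1" using red cj' by (simp add: diff_reduced_def)
        ultimately show ?thesis using v v' by (simp add: deg_in_eq_0_iff)
      qed
    qed
    have u0: "leader rk a = (0, j)" using u \<open>\<theta> = 0\<close> by simp
    have deg: "deg_in (0, j) a = 1" using deg_leader_pos[OF aR] cj ac u0 by simp
    obtain T where T: "a = initial rk a * Var (0, j) ^ deg_in (0, j) a + T" "deg_in (0, j) T < deg_in (0, j) a"
      "vars T \<subseteq> vars a"
      unfolding initial_def lcoeff_var_eq u0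
      by (rule split_coeff_var[of "(0, j)" a "deg_in (0, j) a"]) (use deg in simp_all)
    have "(0, j) \<notin> vars T" using T(2) deg by (simp add: deg_in_eq_0_iff)
    then have vT: "vars T = {}" using T(3) va by auto
    have vi: "vars (initial rk a) = {}"
      using vars_coeff_var[of "(0, j)" "deg_in (0, j) a" a] va unfolding initial_def lcoeff_var_eq u0 by auto
    have a_eq: "a = initial rk a * Var (0, j) + T" using T(1) unfolding deg power_one_right .
    have sep: "separant rk a = initial rk a"
      using pderiv_var_linear[of "(0, j)" "initial rk a" T] vT vi unfolding separant_def u0 a_eq[symmetric] by simp
    have nz: "lk (initial rk a) 0 \<noteq> 0"
    proof
      assume "lk (initial rk a) 0 = 0"
      then have "initial rk a = 0" using vi vars_empty_iff[of "initial rk a"] by simp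
      then have "a = T" using a_eq by simp
      then show False using vT aR(2) by simp
    qed
    have i: "initial rk a = Poly_Mapping.single 0 (lk (initial rk a) 0)"
      using vars_empty_iff vi by blast
    have t: "T = Poly_Mapping.single 0 (lk T 0)"
      using vars_empty_iff vT by blast
    show ?thesis
      using nz j ac a_eq i t sep by (intro exI[of _ "lk (initial rk a) 0"] exI[of _ "lk T 0"] exI[of _ j] conjI) metis+
  qed
  \<comment> \<open>The root of the linear polynomial c j; \<open>SOME\<close> is used because its
    coefficients are only known to exist.\<close>
  define b where "b j = (SOME x. \<exists>\<alpha> \<beta>. \<alpha> \<noteq> 0 \<and> c j = Poly_Mapping.single 0 \<alpha> * Var (0, j) + Poly_Mapping.single 0 \<beta>
       \<and> \<alpha> * x + \<beta> = 0)" for j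
  define val where "val = derivative_values \<delta> m b"
  have val0: "val (0, j) = b j" for j
  proof -
    have "List.foldr (\<lambda>i. \<delta> i ^^ 0) xs x = x" for xs :: "nat list" and x by (induction xs) auto
    then show ?thesis by (simp add: val_def derivative_values_def)
  qed
  have mon0: "eval_mon val 0 = 1" by (simp add: eval_mon_def)
  have eval_A: "eval_poly val a = 0" if a: "a \<in> A" for a
  proof -
    obtain \<alpha> \<beta> j where l: "\<alpha> \<noteq> 0" "j < l" "a = c j"
      "a = Poly_Mapping.single 0 \<alpha> * Var (0, j) + Poly_Mapping.single 0 \<beta>"
      using linear[OF a] by blast
    have "\<alpha> * (- \<beta> / \<alpha>) + \<beta> = 0" using l(1) by simp
    then have "\<exists>x \<alpha> \<beta>. \<alpha> \<noteq> 0 \<and> c j = Poly_Mapping.single 0 \<alpha> * Var (0, j) + Poly_Mapping.single 0 \<beta>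
       \<and> \<alpha> * x + \<beta> = 0" using l by metis
    from someI_ex[OF this] obtain \<alpha>' \<beta>' where
      "c j = Poly_Mapping.single 0 \<alpha>' * Var (0, j) + Poly_Mapping.single 0 \<beta>'" "\<alpha>' * b j + \<beta>' = 0"
      unfolding b_def by blast
    then show ?thesis using l(3) by (simp add: eval_poly_add eval_poly_mult mon0 val0)
  qed
  \<comment> \<open>The kernel of evaluation is a differential ideal containing A, hence [A], hence
    a power of \<open>H rk A\<close>. But each initial and separant evaluates to a nonzero
    \<alpha>.\<close>
  define K where "K = {f \<in> Rset m l. eval_poly val f = 0}"
  have eval_D: "eval_poly val (D \<delta> i f) = \<delta> i (eval_poly val f)" if "i < m" for i f
  proof (rule eval_poly_D)
    show "is_derivation (\<delta> i)" using dfield that by (simp add: diff_field_def)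
    show "val (op_var (Poly_Mapping.single i 1) v) = \<delta> i (val v)" for v
      unfolding val_def
      by (rule derivative_values_op_var) (use dfield that in \<open>auto simp: diff_field_def\<close>)
  qed
  have D_Rset: "D \<delta> i f \<in> Rset m l" if "i < m" "f \<in> Rset m l" for i and f :: "'k dpoly"
    unfolding Rset_eq_polys D_def
  proof (intro polys_add polys_sum polys_single polys_mult polys_Var)
    have f: "vars f \<subseteq> {v. valid v}" using that(2) by (simp add: Rset_eq_polys polys_def)
    show "mons mon \<subseteq> {v. valid v}" if "mon \<in> mons f" for mon using f that by (auto simp: vars_def)
    show "pderiv_var v f \<in> polys {v. valid v}" for v using f vars_pderiv_var[of v f] by (auto simp: polys_def)
    show "op_var (Poly_Mapping.single i 1) v \<in> {v. valid v}" if "v \<in> vars f" for v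
    proof -
      have "valid v" using that f by auto
      moreover have "valid_op m (Poly_Mapping.single i 1)" using \<open>i < m\<close> by (simp add: valid_op_def)
      ultimately show ?thesis by (simp add: valid_op_var)
    qed
  qed
  have "is_diff_ideal \<delta> m l K"
    unfolding is_diff_ideal_def is_ideal_in_def
  proof (intro conjI ballI allI impI)
    show "D \<delta> i f \<in> K" if "i < m" "f \<in> K" for i f
    proof -
      have "is_derivation (\<delta> i)" using dfield that by (simp add: diff_field_def)
      then show ?thesis using that D_Rset eval_D by (simp add: K_def derivation_0)
    qed
  qed (auto simp: K_def Rset_eq_polys eval_poly_add eval_poly_mult intro: polys_add polys_mult)
  moreover have "A \<subseteq> K" using A_props(2) eval_A by (auto simp: K_def)
  ultimately have sub: "diff_ideal_gen \<delta> m l A \<subseteq> K" by (rule is_diff_ideal_diff_ideal_gen(2))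
  obtain n where "H rk A ^ n * 1 \<in> diff_ideal_gen \<delta> m l A" using \<open>1 \<in> J\<close> in_J_iff by blast
  then have "eval_poly val (H rk A) ^ n = 0" using sub by (auto simp: K_def eval_poly_power)
  then have "eval_poly val (H rk A) = 0" by simp
  then obtain a where a: "a \<in> A" "eval_poly val (initial rk a) * eval_poly val (separant rk a) = 0"
    using A_props(1) by (auto simp: H_def eval_poly_prod eval_poly_mult)
  obtain \<alpha> where "\<alpha> \<noteq> 0" "initial rk a = Poly_Mapping.single 0 \<alpha>" "separant rk a = Poly_Mapping.single 0 \<alpha>"
    using linear[OF a(1)] by blast
  then show False using a(2) by (simp add: mon0)
qed

end

text \<open>Gaussian elimination by cross-multiplication instead of division: the coefficients stay
  in the subring S, which later is a polynomial ring in selected variables and not a field.\<close>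

lemma fraction_free_dependence:
  fixes M :: "'j \<Rightarrow> 'i \<Rightarrow> 'r::idom"
  assumes S: "0 \<in> S" "1 \<in> S" "\<And>x y. x \<in> S \<Longrightarrow> y \<in> S \<Longrightarrow> x + y \<in> S"
      "\<And>x y. x \<in> S \<Longrightarrow> y \<in> S \<Longrightarrow> x * y \<in> S" "\<And>x. x \<in> S \<Longrightarrow> - x \<in> S"
    and "finite F" "finite K" "card F < card K" "\<And>j i. j \<in> K \<Longrightarrow> i \<in> F \<Longrightarrow> M j i \<in> S"
  shows "\<exists>b. (\<forall>j\<in>K. b j \<in> S) \<and> (\<exists>j\<in>K. b j \<noteq> 0) \<and> (\<forall>i\<in>F. (\<Sum>j\<in>K. b j * M j i) = 0)"
  using assms(6-)
proof (induction F arbitrary: K M rule: finite_induct)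
  case empty
  then have "K \<noteq> {}" by auto
  then show ?case using S(2) by (intro exI[of _ "\<lambda>_. 1"]) auto
next
  case (insert i0 F)
  show ?case
  proof (cases "\<forall>j\<in>K. M j i0 = 0")
    case True
    have "\<exists>b. (\<forall>j\<in>K. b j \<in> S) \<and> (\<exists>j\<in>K. b j \<noteq> 0) \<and> (\<forall>i\<in>F. (\<Sum>j\<in>K. b j * M j i) = 0)"
      by (rule insert.IH) (use insert in auto)
    then obtain b where "\<forall>j\<in>K. b j \<in> S" "\<exists>j\<in>K. b j \<noteq> 0" "\<forall>i\<in>F. (\<Sum>j\<in>K. b j * M j i) = 0" by blast
    then show ?thesis using True by (intro exI[of _ b]) auto
  next
    case False
    then obtain p where p: "p \<in> K" "M p i0 \<noteq> 0" by blast
    define K' where "K' = K - {p}"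
    define M' where "M' j i = M p i0 * M j i + - (M j i0 * M p i)" for j i
    have K': "finite K'" "p \<notin> K'" "K = insert p K'" "card F < card K'"
      using insert.prems insert.hyps p(1) by (auto simp: K'_def)
    have "\<exists>b. (\<forall>j\<in>K'. b j \<in> S) \<and> (\<exists>j\<in>K'. b j \<noteq> 0) \<and> (\<forall>i\<in>F. (\<Sum>j\<in>K'. b j * M' j i) = 0)"
    proof (rule insert.IH)
      show "M' j i \<in> S" if "j \<in> K'" "i \<in> F" for j i
        unfolding M'_def using that p(1) K'(3) insert.prems(3) by (intro S) auto
    qed (use K' in auto)
    then obtain b' where b': "\<And>j. j \<in> K' \<Longrightarrow> b' j \<in> S" "\<exists>j\<in>K'. b' j \<noteq> 0"
      "\<And>i. i \<in> F \<Longrightarrow> (\<Sum>j\<in>K'. b' j * M' j i) = 0" by blast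
    \<comment> \<open>The entry at the pivot p is chosen to annihilate column i0; the other entries
      are scaled by the nonzero pivot, so nontriviality is inherited from b'.\<close>
    define b where "b j = (if j = p then - (\<Sum>j\<in>K'. b' j * M j i0) else M p i0 * b' j)" for j
    have sumS: "(\<Sum>j\<in>L. g j) \<in> S" if "\<And>j. j \<in> L \<Longrightarrow> g j \<in> S" for L :: "'j set" and g
      using that by (induction L rule: infinite_finite_induct) (auto simp: S)
    have "b j \<in> S" if "j \<in> K" for j
    proof (cases "j = p")
      case True
      have "(\<Sum>j\<in>K'. b' j * M j i0) \<in> S"
        using b'(1) insert.prems(3) K'(3) by (intro sumS S(4)) auto
      then show ?thesis using True by (simp add: b_def S(5))
    next
      case False
      then show ?thesis using that K'(3) b'(1) insert.prems(3) p(1) by (auto simp: b_def intro!: S(4))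
    qed
    moreover have "\<exists>j\<in>K. b j \<noteq> 0"
      using b'(2) p(2) K'(2,3) by (auto simp: b_def)
    moreover have "(\<Sum>j\<in>K. b j * M j i) = 0" if i: "i \<in> insert i0 F" for i
    proof -
      have "(\<Sum>j\<in>K'. b j * M j i) = (\<Sum>j\<in>K'. M p i0 * b' j * M j i)"
        using K'(2) by (intro sum.cong) (auto simp: b_def)
      then have "(\<Sum>j\<in>K. b j * M j i) = (\<Sum>j\<in>K'. b' j * M' j i)"
        unfolding K'(3) using K'(1,2)
        by (simp add: b_def M'_def sum_distrib_left sum_distrib_right sum_subtractf right_diff_distrib mult_ac)
      also have "\<dots> = 0"
      proof (cases "i = i0")
        case True
        then show ?thesis by (intro sum.neutral) (auto simp: M'_def mult_ac)
      next
        case False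
        then show ?thesis using i b'(3) by auto
      qed
      finally show ?thesis .
    qed
    ultimately show ?thesis by blast
  qed
qed

definition restrict_mon :: "dvar set \<Rightarrow> (dvar \<Rightarrow>\<^sub>0 nat) \<Rightarrow> (dvar \<Rightarrow>\<^sub>0 nat)" where
  "restrict_mon W mon = (\<Sum>w\<in>mons mon \<inter> W. Poly_Mapping.single w (lk mon w))"

lemma lookup_restrict_mon: "lk (restrict_mon W mon) x = (if x \<in> W then lk mon x else 0)"
proof -
  have "lk (restrict_mon W mon) x = (\<Sum>w\<in>mons mon \<inter> W. if w = x then lk mon x else 0)"
    unfolding restrict_mon_def lookup_sum by (rule sum.cong) (auto simp: lookup_single when_def)
  also have "\<dots> = (if x \<in> W then lk mon x else 0)" by (auto simp: in_keys_iff)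
  finally show ?thesis .
qed

lemma keys_restrict_mon: "mons (restrict_mon W mon) = mons mon \<inter> W"
  by (auto simp: in_keys_iff lookup_restrict_mon split: if_splits)

lemma restrict_mon_split: "restrict_mon U mon + restrict_mon (- U) mon = mon"
  by (rule poly_mapping_eqI) (simp add: lookup_add lookup_restrict_mon)

text \<open>The monomials of r are grouped by their part outside U; the parts inside U make up the
  coefficients.\<close>

lemma split_by_vars:
  fixes r :: "'k::comm_ring_1 dpoly"
  assumes "r \<in> polys X" "finite M" "restrict_mon (- U) ` mons r \<subseteq> M"
  shows "\<exists>q. (\<forall>\<mu>. q \<mu> \<in> polys (X \<inter> U)) \<and> r = (\<Sum>\<mu>\<in>M. q \<mu> * Poly_Mapping.single \<mu> 1)"
proof -
  define q where "q \<mu> = (\<Sum>mon\<in>{mon\<in>mons r. restrict_mon (- U) mon = \<mu>}.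
      Poly_Mapping.single (restrict_mon U mon) (lk r mon))" for \<mu>
  have "q \<mu> \<in> polys (X \<inter> U)" for \<mu>
    unfolding q_def using assms(1)
    by (intro polys_sum polys_single) (auto simp: keys_restrict_mon polys_def vars_def)
  moreover have "r = (\<Sum>\<mu>\<in>M. q \<mu> * Poly_Mapping.single \<mu> 1)"
  proof -
    have "q \<mu> * Poly_Mapping.single \<mu> 1
        = (\<Sum>mon\<in>{mon\<in>mons r. restrict_mon (- U) mon = \<mu>}. Poly_Mapping.single mon (lk r mon))" for \<mu>
      unfolding q_def sum_distrib_right
      by (rule sum.cong) (auto simp: mult_single restrict_mon_split)
    then have "(\<Sum>\<mu>\<in>M. q \<mu> * Poly_Mapping.single \<mu> 1) = (\<Sum>mon\<in>mons r. Poly_Mapping.single mon (lk r mon))"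
      using sum.group[OF finite_keys assms(2,3)] by simp
    then show ?thesis using poly_eq_sum_single[of r] by simp
  qed
  ultimately show ?thesis by blast
qed

text \<open>A monomial of b j0 times v^j0 cannot cancel: the b j are free of v, so the other
  summands carry a different exponent of v.\<close>

lemma sum_Var_power_neq_0:
  fixes b :: "nat \<Rightarrow> 'k::comm_ring_1 dpoly"
  assumes "finite K" "\<And>j. j \<in> K \<Longrightarrow> v \<notin> vars (b j)" "j0 \<in> K" "b j0 \<noteq> 0"
  shows "(\<Sum>j\<in>K. b j * Var v ^ j) \<noteq> 0"
proof -
  obtain mon where mon: "mon \<in> mons (b j0)" using assms(4) by fastforce
  have m0: "lk mon v = 0" using mon assms(2,3) unfolding in_vars_iff by blast
  let ?k = "mon + Poly_Mapping.single v j0"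
  have other: "lk (b j * Var v ^ j) ?k = 0" if "j \<in> K" "j \<noteq> j0" for j
  proof (rule ccontr)
    assume "lk (b j * Var v ^ j) ?k \<noteq> 0"
    then have "?k \<in> mons (b j * Var v ^ j)" by (simp add: in_keys_iff)
    then obtain x y where xy: "x \<in> mons (b j)" "y \<in> mons (Var v ^ j :: 'k dpoly)" "?k = x + y"
      using keys_mult[of "b j" "Var v ^ j"] by blast
    then have y: "y = Poly_Mapping.single v j" by (simp add: Var_power)
    have "lk x v = 0" using xy(1) assms(2) that(1) unfolding in_vars_iff by blast
    then have "lk ?k v = j" using xy(3) y by (simp add: lookup_add)
    then show False using m0 that(2) by (simp add: lookup_add)
  qed
  have "lk (\<Sum>j\<in>K. b j * Var v ^ j) ?k = lk (b j0 * Var v ^ j0) ?k"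
    unfolding lookup_sum using assms(1,3) other by (subst sum.remove[of K j0]) auto
  also have "\<dots> = lk (b j0) mon" using lookup_mult_Var_power[of v "b j0" mon j0] m0 assms(2,3) by blast
  finally have "lk (\<Sum>j\<in>K. b j * Var v ^ j) ?k \<noteq> 0" using mon by (simp add: in_keys_iff)
  then show ?thesis by auto
qed

lemma finite_bounded_mons: "finite X \<Longrightarrow> finite {\<mu> :: dvar \<Rightarrow>\<^sub>0 nat. mons \<mu> \<subseteq> X \<and> (\<forall>w. lk \<mu> w \<le> N)}"
proof -
  assume "finite X"
  then have "finite {f :: dvar \<Rightarrow> nat. \<forall>x. (x \<in> X \<longrightarrow> f x \<in> {..N}) \<and> (x \<notin> X \<longrightarrow> f x = 0)}"
    by (intro finite_set_of_finite_funs) auto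
  moreover have "lk ` {\<mu>. mons \<mu> \<subseteq> X \<and> (\<forall>w. lk \<mu> w \<le> N)} \<subseteq>
      {f. \<forall>x. (x \<in> X \<longrightarrow> f x \<in> {..N}) \<and> (x \<notin> X \<longrightarrow> f x = 0)}"
    by (auto simp: in_keys_iff)
  ultimately have "finite (lk ` {\<mu> :: dvar \<Rightarrow>\<^sub>0 nat. mons \<mu> \<subseteq> X \<and> (\<forall>w. lk \<mu> w \<le> N)})"
    by (rule finite_subset[rotated])
  then show ?thesis
    by (rule finite_imageD) (auto intro: inj_onI poly_mapping_eqI)
qed

lemma ideal_sum: "is_ideal_in S J \<Longrightarrow> (\<And>x. x \<in> A \<Longrightarrow> f x \<in> J) \<Longrightarrow> sum f A \<in> J"
  by (induction A rule: infinite_finite_induct) (auto simp: ideal_0 ideal_add)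

context orderly_ranking
begin

lemma upto_props:
  assumes "valid v"
  shows "finite (upto v)" "\<And>x. x \<in> upto v \<Longrightarrow> upto x \<subseteq> upto v" "\<And>x. x \<in> upto v \<Longrightarrow> valid x"
    "v \<in> upto v" "upto v \<subseteq> {w. valid w}"
  using finite_below[OF assms] rk_trans[OF _ _ assms] rk_refl[OF assms] assms by (auto simp: upto_def)

lemma below_props:
  assumes "valid v"
  shows "finite (below v)" "\<And>x. x \<in> below v \<Longrightarrow> upto x \<subseteq> below v" "\<And>x. x \<in> below v \<Longrightarrow> valid x"
    "v \<notin> below v" "below v \<subseteq> upto v"
proof -
  show "below v \<subseteq> upto v" by (auto simp: upto_def below_def lt_def)
  then show "finite (below v)" using upto_props(1)[OF assms] finite_subset by blast
  show "v \<notin> below v" by (auto simp: below_def lt_def)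
  show "valid x" if "x \<in> below v" for x using that by (simp add: below_def)
  show "upto x \<subseteq> below v" if "x \<in> below v" for x
    using that upto_subset_below[of x v] assms by (auto simp: below_def)
qed

lemma apply_op_in_upto:
  fixes f :: "'k::comm_ring_1 dpoly"
  assumes "f \<in> Rset m l" "vars f \<noteq> {}" "valid_op m \<theta>"
  shows "apply_op \<delta> m \<theta> f \<in> polys (upto (op_var \<theta> (leader rk f)))"
proof (cases "\<theta> = 0")
  case True
  then show ?thesis using in_polys_upto_leader[OF assms(1,2)] by (simp add: apply_op_0)
next
  case False
  let ?v = "op_var \<theta> (leader rk f)"
  have v: "valid ?v" using assms valid_leader valid_op_var by blast
  note lin = apply_op_linear(1)[OF assms False, of \<delta>] apply_op_linear(2)[OF assms False]
  then obtain T where T: "T \<in> polys (below ?v)" "apply_op \<delta> m \<theta> f = separant rk f * Var ?v + T" by blast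
  show ?thesis unfolding T(2)
    using T(1) lin(2) polys_mono[OF below_props(5)[OF v]] upto_props(4)[OF v]
    by (intro polys_add polys_mult polys_Var) auto
qed

end

section \<open>Contraction to \<open>Rh\<close> and algebraic relations for a characterizable
  ideal\<close>

context characterizable_ideal
begin

lemma ideal': "is_ideal_in (polys {v. valid v}) J"
  using ideal by (simp add: Rset_eq_polys)

text \<open>Minimality of A rules out nonconstant r; a nonzero constant is ruled out by
  \<open>one_notin\<close>.\<close>

lemma reduced_in_J:
  assumes "r \<in> J" "\<And>a. a \<in> A \<Longrightarrow> diff_reduced rk r a"
  shows "r = 0"
proof (rule ccontr)
  assume "r \<noteq> 0"
  have "r \<in> Rset m l" using assms(1) J_subset by blast
  then have "vars r = {}" using kolchin_charset_not_reduced[OF charset assms(1)] assms(2) by blast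
  then show False using ideal_const_imp_1[OF ideal' assms(1) \<open>r \<noteq> 0\<close>] one_notin by blast
qed

lemma divides_power_H: "divides_power A (H rk A ^ n)"
  unfolding divides_power_def by (intro exI[of _ n] exI[of _ 1]) simp

text \<open>For the inclusion from right to left, f is reduced modulo the truncated ideal itself.
  The remainder lies in J and is reduced, hence is 0, so s * f is in the truncated ideal, and s is
  completed to a power of \<open>H rk A\<close>.\<close>

lemma contraction:
  assumes h: "\<And>a v. a \<in> A \<Longrightarrow> v \<in> vars a \<Longrightarrow> var_ord v \<le> h"
  shows "saturation (Rh m l h) (ideal_gen (Rh m l h)
      {apply_op \<delta> m \<theta> f | \<theta> f. f \<in> A \<and> valid_op m \<theta> \<and> var_ord (op_var \<theta> (leader rk f)) \<le> h}) {H rk A}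
    = J \<inter> Rh m l h"
proof -
  define X where "X = {v. valid v \<and> var_ord v \<le> h}"
  have Rh: "Rh m l h = polys X" by (simp add: Rh_eq_polys X_def)
  let ?G = "{apply_op \<delta> m \<theta> f | \<theta> f. f \<in> A \<and> valid_op m \<theta> \<and> var_ord (op_var \<theta> (leader rk f)) \<le> h}"
  have X: "finite X" "\<And>x. x \<in> X \<Longrightarrow> upto x \<subseteq> X" "\<And>x. x \<in> X \<Longrightarrow> valid x"
  proof -
    show "finite X" unfolding X_def by (rule finite_valid_var_ord)
    show "upto x \<subseteq> X" if "x \<in> X" for x
    proof
      fix w assume "w \<in> upto x"
      then have "valid w" "var_ord w \<le> var_ord x"
        using that var_ord_mono[of w x] by (auto simp: upto_def X_def)
      then show "w \<in> X" using that by (simp add: X_def)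
    qed
    show "valid x" if "x \<in> X" for x using that by (simp add: X_def)
  qed
  have XR: "polys X \<subseteq> Rset m l" by (auto simp: Rset_eq_polys X_def polys_def)
  have "is_ideal_in (polys X) (J \<inter> polys X)"
    unfolding is_ideal_in_def
    using ideal_0[OF ideal] ideal_add[OF ideal] ideal_mult[OF ideal] polys_add polys_mult XR by auto
  moreover have "?G \<subseteq> J \<inter> polys X"
  proof
    fix g assume "g \<in> ?G"
    then obtain \<theta> a where g: "g = apply_op \<delta> m \<theta> a" "a \<in> A" "valid_op m \<theta>"
      "var_ord (op_var \<theta> (leader rk a)) \<le> h" by blast
    have aR: "a \<in> Rset m l" "vars a \<noteq> {}" using A_props(2,3) g(2) by blast+
    have "op_var \<theta> (leader rk a) \<in> X" using g(3,4) valid_leader[OF aR] by (simp add: X_def valid_op_var)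
    then have "g \<in> polys X" using polys_mono[OF X(2)] apply_op_in_upto[OF aR g(3), of \<delta>] g(1) by blast
    then show "g \<in> J \<inter> polys X" using apply_op_in_J g by blast
  qed
  ultimately have G: "is_ideal_in (polys X) (ideal_gen (polys X) ?G)"
    "ideal_gen (polys X) ?G \<subseteq> J \<inter> polys X" "?G \<subseteq> ideal_gen (polys X) ?G"
    by (rule is_ideal_in_ideal_gen)+
  show ?thesis
    unfolding Rh
  proof (intro equalityI subsetI)
    fix f assume "f \<in> saturation (polys X) (ideal_gen (polys X) ?G) {H rk A}"
    then obtain n where f: "f \<in> polys X" "H rk A ^ n * f \<in> J" using saturation_singleton G(2) by blast
    then have "f \<in> J" using cancel[OF divides_power_H] XR by blast
    then show "f \<in> J \<inter> polys X" using f(1) by blast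
  next
    fix f assume f: "f \<in> J \<inter> polys X"
    obtain s where s: "s \<in> polys X" "divides_power A s"
      "\<forall>g\<in>{f}. \<exists>r\<in>polys X. s * g - r \<in> ideal_gen (polys X) ?G \<and> (\<forall>a\<in>A. diff_reduced rk r a) \<and>
      (\<forall>x\<in>X. (\<forall>z\<in>X \<inter> leader_derivs A. lt z x) \<longrightarrow> deg_in x r \<le> deg_in x g)"
    proof (rule diff_reduction[OF autoreduced X G(1) subset_refl, where F = "{f}" and \<delta> = \<delta>])
      show "apply_op \<delta> m \<theta> a \<in> ideal_gen (polys X) ?G"
        if "a \<in> A" "valid_op m \<theta>" "op_var \<theta> (leader rk a) \<in> X" for a \<theta>
        using that G(3) unfolding X_def by blast
      show "finite {f}" "{f} \<subseteq> polys X" using f by auto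
    qed (assumption | rule that)+
    then obtain r where r: "r \<in> polys X" "s * f - r \<in> ideal_gen (polys X) ?G" "\<forall>a\<in>A. diff_reduced rk r a"
      by blast
    have "s * f \<in> J" using ideal_mult[OF ideal] f s(1) XR by blast
    then have "s * f - (s * f - r) \<in> J" using ideal_diff[OF ideal'] r(2) G(2) by blast
    then have "r = 0" using reduced_in_J r(3) by simp
    then have sf: "s * f \<in> ideal_gen (polys X) ?G" using r(2) by simp
    obtain N q where q: "q \<in> polys (\<Union>(vars ` A))" "q * s = H rk A ^ N"
      using s(2) unfolding divides_power_def by blast
    \<comment> \<open>The bound h covers all variables of A, so the cofactor q is a legitimate
      multiplier inside \<open>Rh\<close>.\<close>
    have "\<Union>(vars ` A) \<subseteq> X" using h A_props(2) by (fastforce simp: X_def Rset_def)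
    then have "q \<in> polys X" using q(1) polys_mono by blast
    then have "q * (s * f) \<in> ideal_gen (polys X) ?G" using ideal_mult[OF G(1) sf] by blast
    then have "H rk A ^ N * f \<in> ideal_gen (polys X) ?G" by (simp add: q(2)[symmetric] mult_ac)
    then show "f \<in> saturation (polys X) (ideal_gen (polys X) ?G) {H rk A}"
      using f saturation_singleton by blast
  qed
qed

lemma reduction_mod_J:
  assumes "valid v" "finite F" "F \<subseteq> polys (upto v)"
  obtains s where "s \<in> polys (upto v)" "divides_power A s"
    "\<forall>f\<in>F. \<exists>r\<in>polys (upto v). s * f - r \<in> J \<and> (\<forall>a\<in>A. diff_reduced rk r a) \<and>
      (\<forall>x\<in>upto v. (\<forall>z\<in>upto v \<inter> leader_derivs A. lt z x) \<longrightarrow> deg_in x r \<le> deg_in x f)"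
proof (rule diff_reduction[OF autoreduced upto_props(1-3)[OF assms(1)] ideal' upto_props(5)[OF assms(1)]])
  show "apply_op \<delta> m \<theta> a \<in> J" if "a \<in> A" "valid_op m \<theta>" for a \<theta>
    using that by (rule apply_op_in_J)
  show "finite F" "F \<subseteq> polys (upto v)" by fact+
qed (assumption | rule that)+

text \<open>Write c = I u^d + T and reduce I and T by a common s to p and q. Then p u^d + q lies in
  J and is reduced, so p must vanish. Hence s * I lies in J, and s can be cancelled.\<close>

lemma initial_in_J:
  assumes c: "c \<in> J" "vars c \<noteq> {}" and u: "leader rk c \<notin> leader_derivs A"
  shows "initial rk c \<in> J"
proof -
  let ?u = "leader rk c"
  define d where "d = deg_in ?u c"
  have cR: "c \<in> Rset m l" using c(1) J_subset by blast
  have vu: "valid ?u" using valid_leader[OF cR c(2)] .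
  obtain T where T: "c = initial rk c * Var ?u ^ d + T" "deg_in ?u T < d"
    "T \<in> polys (upto ?u)" "initial rk c \<in> polys (below ?u)"
    unfolding d_def by (rule initial_form[OF cR c(2)])
  have I: "initial rk c \<in> polys (upto ?u)" using T(4) polys_mono[OF below_props(5)[OF vu]] by blast
  have fam: "finite {initial rk c, T}" "{initial rk c, T} \<subseteq> polys (upto ?u)" using I T(3) by simp_all
  obtain s where s: "s \<in> polys (upto ?u)" "divides_power A s" and red:
    "\<forall>f\<in>{initial rk c, T}. \<exists>r\<in>polys (upto ?u). s * f - r \<in> J \<and> (\<forall>a\<in>A. diff_reduced rk r a) \<and>
      (\<forall>x\<in>upto ?u. (\<forall>z\<in>upto ?u \<inter> leader_derivs A. lt z x) \<longrightarrow> deg_in x r \<le> deg_in x f)"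
    by (rule reduction_mod_J[OF vu fam])
  \<comment> \<open>As u is no derivative of a leader, every divisor has its leader strictly below
    u: p stays free of u and q keeps degree less than d in u.\<close>
  have ltu: "\<forall>z\<in>upto ?u \<inter> leader_derivs A. lt z ?u" using u by (auto simp: upto_def lt_def)
  obtain p where p: "p \<in> polys (upto ?u)" "s * initial rk c - p \<in> J" "\<forall>a\<in>A. diff_reduced rk p a"
    "deg_in ?u p \<le> deg_in ?u (initial rk c)"
    using red ltu upto_props(4)[OF vu] by blast
  obtain q where q: "q \<in> polys (upto ?u)" "s * T - q \<in> J" "\<forall>a\<in>A. diff_reduced rk q a"
    "deg_in ?u q \<le> deg_in ?u T"
    using red ltu upto_props(4)[OF vu] by blast
  have "?u \<notin> vars (initial rk c)" using T(4) by (auto simp: polys_def below_def lt_def)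
  then have "?u \<notin> vars p" using p(4) by (simp add: deg_in_eq_0_iff[symmetric])
  then have pb: "p \<in> polys (below ?u)" using p(1) by (auto simp: polys_def below_def upto_def lt_def)
  define f where "f = p * Var ?u ^ d + q"
  have up_R: "g \<in> Rset m l" if "g \<in> polys (upto ?u)" for g :: "'k dpoly"
    using that upto_props(5)[OF vu] by (auto simp: Rset_eq_polys polys_def)
  have "(Var ?u ^ d :: 'k dpoly) \<in> Rset m l" 
    unfolding Rset_eq_polys by (intro polys_power polys_Var) (simp add: vu)
  then have "Var ?u ^ d * (s * initial rk c - p) + (s * T - q) \<in> J"
    using ideal_add[OF ideal] ideal_mult[OF ideal p(2)] q(2) by blast
  moreover have "s * c \<in> J" using ideal_mult[OF ideal c(1)] up_R[OF s(1)] by blast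
  ultimately have "s * c - (Var ?u ^ d * (s * initial rk c - p) + (s * T - q)) \<in> J"
    by (rule ideal_diff[OF ideal', rotated])
  moreover have "s * c - (Var ?u ^ d * (s * initial rk c - p) + (s * T - q)) = f"
  proof -
    have "s * c = s * (initial rk c * Var ?u ^ d + T)" using T(1) by (rule arg_cong)
    then show ?thesis by (simp add: f_def algebra_simps)
  qed
  ultimately have fJ: "f \<in> J" by simp
  have "p = 0"
  proof (rule ccontr)
    assume "p \<noteq> 0"
    have "deg_in ?u q < d" using q(4) T(2) by simp
    note f = leader_lead_form[OF pb q(1) this \<open>p \<noteq> 0\<close> vu, folded f_def]
    have "diff_reduced rk f a" if a: "a \<in> A" for a
      unfolding diff_reduced_def
    proof
      have pr: "\<not> proper_derivative ?u (leader rk a)"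
      proof
        assume "proper_derivative ?u (leader rk a)"
        then obtain \<theta> where "?u = op_var \<theta> (leader rk a)" unfolding proper_derivative_def by blast
        then have "?u \<in> leader_derivs A"
          using vu valid_op_var[of \<theta> "leader rk a"] a unfolding leader_derivs_def by auto
        then show False using u by blast
      qed
      show "\<forall>v\<in>vars f. \<not> proper_derivative v (leader rk a)"
        using f(6) pr p(3) q(3) a unfolding diff_reduced_def by blast
      have "leader rk a \<noteq> ?u" using leader_in_leader_derivs[OF a] u by metis
      then show "deg_in (leader rk a) f < deg_in (leader rk a) a"
        using f(5)[of "leader rk a"] p(3) q(3) a unfolding diff_reduced_def by fastforce
    qed
    then show False using kolchin_charset_not_reduced[OF charset fJ up_R[OF f(2)] f(1)] by blast
  qed
  then have "s * initial rk c \<in> J" using p(2) by simp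
  then show ?thesis using cancel[OF s(2) up_R[OF I]] by blast
qed

text \<open>Modulo \<open>J\<close>, the powers of \<open>v\<close> are, up to one common multiplier, combinations of finitely many
  monomials with coefficients in the polynomial ring of the non-derivatives of leaders; enough
  of them are therefore linearly dependent over that ring.\<close>
lemma ex_algebraic_relation:
  assumes v: "valid v" "v \<in> leader_derivs A"
  shows "\<exists>d\<in>J. d \<noteq> 0 \<and> vars d \<subseteq> insert v {w. valid w \<and> w \<notin> leader_derivs A}"
proof -
  define U where "U = - leader_derivs A"
  \<comment> \<open>A uniform bound for the degree of a reduced remainder in any leader of
    A.\<close>
  define N where "N = (\<Sum>a\<in>A. deg_in (leader rk a) a)"
  define M where "M = {\<mu> :: dvar \<Rightarrow>\<^sub>0 nat. mons \<mu> \<subseteq> upto v \<and> (\<forall>w. lk \<mu> w \<le> N)}"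
  \<comment> \<open>The exponents 0 to \<open>card M\<close> give one power of v more than there are
    monomials in M, so their remainders are linearly dependent.\<close>
  define F where "F = (\<lambda>j. Var v ^ j :: 'k dpoly) ` {..card M}"
  note up = upto_props[OF v(1)]
  have M: "finite M" unfolding M_def by (rule finite_bounded_mons[OF up(1)])
  have F: "finite F" "F \<subseteq> polys (upto v)"
    using up(4) by (auto simp: F_def intro: polys_power polys_Var)
  obtain s where s: "s \<in> polys (upto v)" "divides_power A s" and red:
    "\<forall>f\<in>F. \<exists>r\<in>polys (upto v). s * f - r \<in> J \<and> (\<forall>a\<in>A. diff_reduced rk r a) \<and>
      (\<forall>x\<in>upto v. (\<forall>z\<in>upto v \<inter> leader_derivs A. lt z x) \<longrightarrow> deg_in x r \<le> deg_in x f)"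
    by (rule reduction_mod_J[OF v(1) F])
  have "\<forall>j\<in>{..card M}. \<exists>r. r \<in> polys (upto v) \<and> s * Var v ^ j - r \<in> J \<and> (\<forall>a\<in>A. diff_reduced rk r a)"
    using red unfolding F_def by blast
  from bchoice[OF this] obtain r where r: "\<And>j. j \<in> {..card M} \<Longrightarrow> r j \<in> polys (upto v)"
    "\<And>j. j \<in> {..card M} \<Longrightarrow> s * Var v ^ j - r j \<in> J"
    "\<And>j a. j \<in> {..card M} \<Longrightarrow> a \<in> A \<Longrightarrow> diff_reduced rk (r j) a" by blast
  have ex_q: "\<exists>q. (\<forall>\<mu>. q \<mu> \<in> polys (upto v \<inter> U)) \<and> r j = (\<Sum>\<mu>\<in>M. q \<mu> * Poly_Mapping.single \<mu> 1)"
    if j: "j \<in> {..card M}" for j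
  proof (rule split_by_vars[OF r(1)[OF j] M])
    show "restrict_mon (- U) ` mons (r j) \<subseteq> M"
    proof (rule image_subsetI)
      fix mon assume mon: "mon \<in> mons (r j)"
      have "lk (restrict_mon (- U) mon) w \<le> N" for w
      proof (cases "w \<in> leader_derivs A \<and> lk mon w \<noteq> 0")
        case True
        then have w: "w \<in> vars (r j)" using mon unfolding in_vars_iff by blast
        then have "valid w" using r(1)[OF j] up(3) unfolding polys_def by blast
        \<comment> \<open>A reduced remainder contains no proper derivative of a leader, so w is
          itself a leader and its exponent is bounded.\<close>
        obtain a where a: "a \<in> A" "w = leader rk a"
        proof (rule leader_derivs_cases[OF conjunct1[OF True] \<open>valid w\<close>])
          fix a \<theta> assume a: "a \<in> A" "\<theta> \<noteq> 0" "w = op_var \<theta> (leader rk a)"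
          then have "proper_derivative w (leader rk a)" unfolding proper_derivative_def by blast
          then show thesis using r(3)[OF j a(1)] w unfolding diff_reduced_def by blast
        qed
        have "lk mon w \<le> deg_in w (r j)" using mon by (rule lookup_le_deg_in)
        also have "\<dots> \<le> deg_in (leader rk a) a" using r(3)[OF j a(1)] a(2) by (simp add: diff_reduced_def)
        also have "\<dots> \<le> N" unfolding N_def using a(1) A_props(1) by (intro member_le_sum) auto
        finally show ?thesis using True by (simp add: lookup_restrict_mon U_def)
      next
        case False
        then show ?thesis by (auto simp: lookup_restrict_mon U_def)
      qed
      moreover have "mons mon \<subseteq> upto v" using mon r(1)[OF j] by (auto simp: polys_def vars_def)
      ultimately show "restrict_mon (- U) mon \<in> M" by (auto simp: M_def keys_restrict_mon)
    qed
  qed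
  have "\<exists>q. \<forall>j\<in>{..card M}. (\<forall>\<mu>. q j \<mu> \<in> polys (upto v \<inter> U)) \<and>
      r j = (\<Sum>\<mu>\<in>M. q j \<mu> * Poly_Mapping.single \<mu> 1)"
    by (rule bchoice) (rule ballI, rule ex_q)
  then obtain q where q: "\<And>j \<mu>. j \<in> {..card M} \<Longrightarrow> q j \<mu> \<in> polys (upto v \<inter> U)"
    "\<And>j. j \<in> {..card M} \<Longrightarrow> r j = (\<Sum>\<mu>\<in>M. q j \<mu> * Poly_Mapping.single \<mu> 1)" by blast
  have "\<exists>b. (\<forall>j\<in>{..card M}. b j \<in> polys (upto v \<inter> U)) \<and> (\<exists>j\<in>{..card M}. b j \<noteq> 0) \<and>
     (\<forall>\<mu>\<in>M. (\<Sum>j\<in>{..card M}. b j * q j \<mu>) = 0)"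
    by (rule fraction_free_dependence)
       (use M q(1) in \<open>auto intro: polys_add polys_mult polys_uminus\<close>)
  then obtain b j0 where b: "\<And>j. j \<in> {..card M} \<Longrightarrow> b j \<in> polys (upto v \<inter> U)" "j0 \<in> {..card M}" "b j0 \<noteq> 0"
     "\<And>\<mu>. \<mu> \<in> M \<Longrightarrow> (\<Sum>j\<in>{..card M}. b j * q j \<mu>) = 0" by blast
  define d where "d = (\<Sum>j\<in>{..card M}. b j * Var v ^ j)"
  have "(\<Sum>j\<in>{..card M}. b j * r j) = (\<Sum>j\<in>{..card M}. \<Sum>\<mu>\<in>M. b j * q j \<mu> * Poly_Mapping.single \<mu> 1)"
    by (rule sum.cong) (simp_all only: q(2) sum_distrib_left mult.assoc)
  also have "\<dots> = (\<Sum>\<mu>\<in>M. (\<Sum>j\<in>{..card M}. b j * q j \<mu>) * Poly_Mapping.single \<mu> 1)"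
    unfolding sum_distrib_right by (rule sum.swap)
  also have "\<dots> = 0" using b(4) by simp
  finally have "(\<Sum>j\<in>{..card M}. b j * (s * Var v ^ j - r j)) = s * d"
    by (simp add: d_def sum_distrib_left right_diff_distrib sum_subtractf mult_ac)
  moreover have "b j \<in> Rset m l" if "j \<in> {..card M}" for j
    using b(1)[OF that] up(5) by (auto simp: Rset_eq_polys polys_def)
  then have "(\<Sum>j\<in>{..card M}. b j * (s * Var v ^ j - r j)) \<in> J"
    using r(2) by (intro ideal_sum[OF ideal] ideal_mult[OF ideal]) auto
  ultimately have "s * d \<in> J" by simp
  have "d \<in> polys (insert v (upto v \<inter> U))"
    unfolding d_def
  proof (intro polys_sum polys_mult polys_power polys_Var)
    show "b j \<in> polys (insert v (upto v \<inter> U))" if "j \<in> {..card M}" for j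
      using b(1)[OF that] by (rule polys_mono[rotated]) auto
  qed auto
  then have vd: "vars d \<subseteq> insert v {w. valid w \<and> w \<notin> leader_derivs A}"
    using up(5) by (auto simp: polys_def U_def)
  moreover have "d \<in> Rset m l" using vd v(1) by (auto simp: Rset_def)
  then have "d \<in> J" using cancel[OF s(2)] \<open>s * d \<in> J\<close> by blast
  moreover have "d \<noteq> 0"
    unfolding d_def
  proof (rule sum_Var_power_neq_0)
    show "j0 \<in> {..card M}" "b j0 \<noteq> 0" by fact+
    show "v \<notin> vars (b j)" if "j \<in> {..card M}" for j
      using b(1)[OF that] v(2) by (auto simp: polys_def U_def)
  qed auto
  ultimately show ?thesis by blast
qed

end

subsection \<open>Characteristic decompositions\<close>

locale characteristic_decomposition = orderly_ranking m l rk
  for m l :: nat and rk :: "dvar \<Rightarrow> dvar \<Rightarrow> bool" +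
  fixes \<delta> :: "nat \<Rightarrow> 'k::field \<Rightarrow> 'k" and n h :: nat and I :: "'k dpoly set"
    and J C :: "nat \<Rightarrow> 'k dpoly set" and C0 :: "'k dpoly set"
  assumes component: "\<And>i. i < n \<Longrightarrow> characterizable_ideal m l rk \<delta> (J i) (C i)"
    and n_pos: "0 < n" and I_eq: "I = (\<Inter>i<n. J i)"
    and diff_ideal_I: "is_diff_ideal \<delta> m l I"
    and ord_le: "\<And>i a v. i < n \<Longrightarrow> a \<in> C i \<Longrightarrow> v \<in> vars a \<Longrightarrow> var_ord v \<le> h"
    and charset0: "kolchin_charset m l rk I C0"
    and consistent: "\<And>N. H rk C0 ^ N \<notin> diff_ideal_gen \<delta> m l C0"
begin

abbreviation C0_ideal :: "'k dpoly set" where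
  "C0_ideal \<equiv> diff_ideal_gen \<delta> m l C0"

lemma autoreduced0: "diff_autoreduced (Rset m l) rk C0"
  using charset0 by (simp add: kolchin_charset_def)

lemmas C0_props = diff_autoreduced_props[OF autoreduced0]

lemma C0_subset: "C0 \<subseteq> I"
  using charset0 by (simp add: kolchin_charset_def)

lemma ideal_I: "is_ideal_in (polys {v. valid v}) I"
  using diff_ideal_I by (simp add: is_diff_ideal_def Rset_eq_polys)

lemma I_subset: "I \<subseteq> Rset m l"
  using diff_ideal_I by (simp add: is_diff_ideal_def is_ideal_in_def)

lemma C0_ideal: "is_ideal_in (polys {v. valid v}) C0_ideal" "C0_ideal \<subseteq> I"
  using is_diff_ideal_diff_ideal_gen[OF diff_ideal_I C0_subset]
  by (simp_all add: is_diff_ideal_def Rset_eq_polys)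

lemma apply_op_in_C0_ideal: "a \<in> C0 \<Longrightarrow> valid_op m \<theta> \<Longrightarrow> apply_op \<delta> m \<theta> a \<in> C0_ideal"
  using is_diff_ideal_diff_ideal_gen[OF diff_ideal_I C0_subset]
    apply_op_closed[of m \<theta> a C0_ideal \<delta>] unfolding is_diff_ideal_def by blast

lemma one_notin_I: "1 \<notin> I"
  using characterizable_ideal.one_notin[OF component[OF n_pos]] n_pos unfolding I_eq by blast

lemma reduced_in_I:
  assumes "r \<in> I" "\<And>a. a \<in> C0 \<Longrightarrow> diff_reduced rk r a"
  shows "r = 0"
proof (rule ccontr)
  assume "r \<noteq> 0"
  have "r \<in> Rset m l" using assms(1) I_subset by blast
  then have "vars r = {}" using kolchin_charset_not_reduced[OF charset0 assms(1)] assms(2) by blast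
  then show False using ideal_const_imp_1[OF ideal_I assms(1) \<open>r \<noteq> 0\<close>] one_notin_I by blast
qed

lemma polys_vars_C0: "q \<in> polys (\<Union>(vars ` C0)) \<Longrightarrow> q \<in> polys {v. valid v}"
  using C0_props(2) by (fastforce simp: polys_def Rset_def)

text \<open>If r were 0, then s, and with it a power of \<open>H rk C0\<close>, would lie in [C0].
  Consistency enters the argument through this lemma.\<close>

lemma remainder_nonzero:
  assumes "divides_power C0 s" "s - r \<in> C0_ideal"
  shows "r \<noteq> 0"
proof
  assume "r = 0"
  obtain N q where q: "q \<in> polys (\<Union>(vars ` C0))" "q * s = H rk C0 ^ N"
    using assms(1) unfolding divides_power_def by blast
  have "q * s \<in> C0_ideal"
    using ideal_mult[OF C0_ideal(1) _ polys_vars_C0[OF q(1)]] assms(2) \<open>r = 0\<close> by simp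
  then show False using consistent q(2) by simp
qed

lemma reduction_mod_C0:
  assumes X: "finite X" "\<And>x. x \<in> X \<Longrightarrow> upto x \<subseteq> X" "\<And>x. x \<in> X \<Longrightarrow> valid x"
    and F: "finite F" "F \<subseteq> polys X"
  obtains s where "s \<in> polys X" "divides_power C0 s"
    "\<forall>f\<in>F. \<exists>r\<in>polys X. s * f - r \<in> C0_ideal \<and> (\<forall>a\<in>C0. diff_reduced rk r a)"
proof (rule diff_reduction[OF autoreduced0 X C0_ideal(1)])
  show "X \<subseteq> {v. valid v}" using X(3) by blast
  show "apply_op \<delta> m \<theta> a \<in> C0_ideal" if "a \<in> C0" "valid_op m \<theta>" for a \<theta>
    using that by (rule apply_op_in_C0_ideal)
  show "finite F" "F \<subseteq> polys X" by fact+
  fix s assume s: "s \<in> polys X" "divides_power C0 s" "\<forall>f\<in>F. \<exists>r\<in>polys X. s * f - r \<in> C0_ideal \<and>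
      (\<forall>a\<in>C0. diff_reduced rk r a) \<and>
      (\<forall>x\<in>X. (\<forall>z\<in>X \<inter> leader_derivs C0. lt z x) \<longrightarrow> deg_in x r \<le> deg_in x f)"
  show thesis by (rule that[OF s(1,2)]) (use s(3) in blast)
qed assumption+

text \<open>Every c in \<open>C0\<close> lies in J i. Were its leader no derivative of a leader of C
  i, its initial would lie in J i, and hence so would \<open>H rk C0\<close>.\<close>

lemma leaders_subset:
  assumes i: "i < n" and H: "H rk C0 \<notin> J i"
  shows "leader_derivs C0 \<subseteq> leader_derivs (C i)"
proof
  interpret Ci: characterizable_ideal m l rk \<delta> "J i" "C i" by (rule component[OF i])
  fix w assume "w \<in> leader_derivs C0"
  then obtain \<theta> c where c: "w = op_var \<theta> (leader rk c)" "valid_op m \<theta>" "c \<in> C0"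
    unfolding leader_derivs_def by blast
  have "leader rk c \<in> leader_derivs (C i)"
  proof (rule ccontr)
    assume "leader rk c \<notin> leader_derivs (C i)"
    moreover have "c \<in> J i" using c(3) C0_subset i unfolding I_eq by blast
    ultimately have "initial rk c \<in> J i" using Ci.initial_in_J C0_props(3)[OF c(3)] by blast
    moreover obtain q where "q \<in> polys (\<Union>(vars ` C0))" "q * initial rk c = H rk C0"
      using initial_separant_divides_H[OF C0_props(1) c(3), of "initial rk c"] by blast
    ultimately show False using H ideal_mult[OF Ci.ideal'] polys_vars_C0 by metis
  qed
  then show "w \<in> leader_derivs (C i)" using op_var_leader_derivs c by blast
qed

text \<open>This replaces a dimension count for the prime components of \<open>I\<close>: if the leader of some \<open>c \<in> C0\<close> had
  order above \<open>h\<close>, then every \<open>J i\<close> not containing \<open>H rk C0\<close> would contain a nonzero polynomial in the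
  non-derivatives of leaders of \<open>C0\<close>. The product of these with a remainder of \<open>H rk C0\<close> is
  a nonzero reduced element of \<open>I\<close>.\<close>
lemma leader_ord_le:
  assumes c: "c \<in> C0"
  shows "var_ord (leader rk c) \<le> h"
proof (rule ccontr)
  let ?u = "leader rk c"
  assume u: "\<not> var_ord ?u \<le> h"
  define V where "V = {w. valid w \<and> w \<notin> leader_derivs C0}"
  have ex_d: "\<exists>d. d \<noteq> 0 \<and> d \<in> polys V \<and> (H rk C0 \<notin> J i \<longrightarrow> d \<in> J i)" if i: "i < n" for i
  proof (cases "H rk C0 \<in> J i")
    case True
    \<comment> \<open>No relation is required from a component containing \<open>H rk C0\<close>;
      there the remainder r below does the work.\<close>
    then show ?thesis by (intro exI[of _ 1]) simp
  next
    case False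
    interpret Ci: characterizable_ideal m l rk \<delta> "J i" "C i" by (rule component[OF i])
    note sub = leaders_subset[OF i False]
    have "?u \<in> leader_derivs (C i)" using sub leader_in_leader_derivs[OF c] by blast
    then obtain \<theta> a where a: "?u = op_var \<theta> (leader rk a)" "valid_op m \<theta>" "a \<in> C i"
      unfolding leader_derivs_def by blast
    let ?v = "leader rk a"
    note aR = Ci.A_props(2,3)[OF a(3)]
    have v: "valid ?v" "var_ord ?v \<le> h"
      using valid_leader[OF aR] ord_le[OF i a(3) leader_in_vars[OF aR]] by blast+
    have "\<theta> \<noteq> 0" using a(1) u v(2) by auto
    then have lt: "lt ?v ?u" using lt_op_var[OF a(2) v(1)] a(1) by simp
    \<comment> \<open>Otherwise u would be a proper derivative of a leader of \<open>C0\<close>,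
      against autoreducedness.\<close>
    have "?v \<notin> leader_derivs C0"
    proof
      assume "?v \<in> leader_derivs C0"
      then obtain \<theta>' c' where c': "?v = op_var \<theta>' (leader rk c')" "valid_op m \<theta>'" "c' \<in> C0"
        unfolding leader_derivs_def by blast
      have vc: "valid (leader rk c')" using valid_leader C0_props(2,3)[OF c'(3)] by blast
      then have "rk (leader rk c') ?v" using rk_op_var[OF c'(2)] c'(1) by simp
      then have "lt (leader rk c') ?u"
        using rk_lt_trans[OF vc v(1) _ _ lt] valid_leader C0_props(2,3)[OF c] by blast
      then have "?u \<noteq> leader rk c'" by (auto simp: lt_def)
      moreover have "?u = op_var (\<theta> + \<theta>') (leader rk c')" using a(1) c'(1) by (simp add: op_var_op_var)
      ultimately have "proper_derivative ?u (leader rk c')"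
        unfolding proper_derivative_def by (metis op_var_0)
      then show False using leader_not_proper_derivative[OF autoreduced0 c c'(3)] by blast
    qed
    moreover obtain d where d: "d \<in> J i" "d \<noteq> 0" "vars d \<subseteq> insert ?v {w. valid w \<and> w \<notin> leader_derivs (C i)}"
      using Ci.ex_algebraic_relation[OF v(1) leader_in_leader_derivs[OF a(3)]] by blast
    ultimately have "d \<in> polys V" using sub v(1) by (auto simp: polys_def V_def)
    then show ?thesis using d by blast
  qed
  have "\<exists>d. \<forall>i\<in>{..<n}. d i \<noteq> 0 \<and> d i \<in> polys V \<and> (H rk C0 \<notin> J i \<longrightarrow> d i \<in> J i)"
    by (rule bchoice) (use ex_d in blast)
  then obtain d where d: "\<And>i. i < n \<Longrightarrow> d i \<noteq> 0" "\<And>i. i < n \<Longrightarrow> d i \<in> polys V"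
    "\<And>i. i < n \<Longrightarrow> H rk C0 \<notin> J i \<Longrightarrow> d i \<in> J i" by blast
  define P where "P = (\<Prod>i<n. d i)"
  have P: "P \<noteq> 0" "P \<in> polys V" unfolding P_def using d(1,2) by (auto intro: polys_prod)
  \<comment> \<open>A finite initial segment of the ranking containing all variables of
    \<open>H rk C0\<close>.\<close>
  define X where "X = (\<Union>x\<in>vars (H rk C0). upto x)"
  have H1: "divides_power C0 (H rk C0)"
    unfolding divides_power_def by (intro exI[of _ 1] exI[of _ 1]) simp
  have HR: "H rk C0 \<in> polys {v. valid v}"
  proof (rule polys_vars_C0)
    have "initial rk b \<in> polys (\<Union>(vars ` C0))" "separant rk b \<in> polys (\<Union>(vars ` C0))"
      if "b \<in> C0" for b
      using that vars_coeff_var[of "leader rk b" "deg_in (leader rk b) b" b]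
        vars_pderiv_var[of "leader rk b" b]
      by (auto simp: polys_def initial_def separant_def lcoeff_var_eq)
    then show "H rk C0 \<in> polys (\<Union>(vars ` C0))"
      unfolding H_def by (intro polys_prod polys_mult)
  qed
  then have vH: "valid x" if "x \<in> vars (H rk C0)" for x using that by (auto simp: polys_def)
  have X: "finite X" "\<And>x. x \<in> X \<Longrightarrow> upto x \<subseteq> X" "\<And>x. x \<in> X \<Longrightarrow> valid x"
  proof -
    show "finite X" unfolding X_def using upto_props(1)[OF vH] by simp
    show "upto x \<subseteq> X" if "x \<in> X" for x unfolding X_def using upto_props(2)[OF vH] that X_def by blast
    show "valid x" if "x \<in> X" for x using that upto_props(3)[OF vH] unfolding X_def by blast
  qed
  have "H rk C0 \<in> polys X"
    using upto_props(4)[OF vH] unfolding polys_def X_def by blast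
  then obtain s where s: "s \<in> polys X" "divides_power C0 s"
    "\<forall>f\<in>{H rk C0}. \<exists>r\<in>polys X. s * f - r \<in> C0_ideal \<and> (\<forall>a\<in>C0. diff_reduced rk r a)"
    using reduction_mod_C0[OF X, of "{H rk C0}"] by auto
  then obtain r where r: "r \<in> polys X" "s * H rk C0 - r \<in> C0_ideal" "\<forall>a\<in>C0. diff_reduced rk r a"
    by blast
  have "r \<noteq> 0" using remainder_nonzero[OF divides_power_mult[OF s(2) H1] r(2)] .
  have XR: "g \<in> polys {v. valid v}" if "g \<in> polys X" for g :: "'k dpoly"
    using polys_mono[OF _ that] X(3) by blast
  have VR: "g \<in> polys {v. valid v}" if "g \<in> polys V" for g :: "'k dpoly"
    using polys_mono[OF _ that] V_def by blast
  \<comment> \<open>Either J i contains \<open>H rk C0\<close>, and then r because s * H - r lies in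
    I, or it contains the factor d i of P.\<close>
  have "r * P \<in> J i" if i: "i < n" for i
  proof -
    interpret Ci: characterizable_ideal m l rk \<delta> "J i" "C i" by (rule component[OF i])
    show ?thesis
    proof (cases "H rk C0 \<in> J i")
      case True
      have "s * H rk C0 - r \<in> J i" using r(2) C0_ideal(2) i unfolding I_eq by blast
      moreover have "s * H rk C0 \<in> J i" using ideal_mult[OF Ci.ideal' True XR[OF s(1)]] .
      ultimately have "s * H rk C0 - (s * H rk C0 - r) \<in> J i" by (rule ideal_diff[OF Ci.ideal', rotated])
      then have "P * r \<in> J i" using ideal_mult[OF Ci.ideal' _ VR[OF P(2)]] by simp
      then show ?thesis by (simp add: mult.commute)
    next
      case False
      have eq: "r * P = (r * (\<Prod>j\<in>{..<n} - {i}. d j)) * d i"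
        unfolding P_def using i by (subst prod.remove[of _ i]) (auto simp: mult_ac)
      have poly: "r * (\<Prod>j\<in>{..<n} - {i}. d j) \<in> polys {v. valid v}"
        by (intro polys_mult polys_prod XR[OF r(1)] VR d(2)) auto
      show ?thesis unfolding eq by (rule ideal_mult[OF Ci.ideal' d(3)[OF i False] poly])
    qed
  qed
  then have "r * P \<in> I" unfolding I_eq by blast
  \<comment> \<open>P involves no derivative of a leader of \<open>C0\<close>, so multiplying by it
    preserves the reducedness of r.\<close>
  moreover have "diff_reduced rk (r * P) a" if a: "a \<in> C0" for a
    unfolding diff_reduced_def
  proof
    have ra: "\<forall>v\<in>vars r. \<not> proper_derivative v (leader rk a)"
      "deg_in (leader rk a) r < deg_in (leader rk a) a"
      using r(3) a by (simp_all add: diff_reduced_def)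
    show "\<forall>v\<in>vars (r * P). \<not> proper_derivative v (leader rk a)"
    proof (intro ballI notI)
      fix v assume v: "v \<in> vars (r * P)" "proper_derivative v (leader rk a)"
      then have "v \<in> vars P" using vars_mult[of r P] ra(1) by blast
      then have vV: "valid v" "v \<notin> leader_derivs C0" using P(2) unfolding polys_def V_def by blast+
      obtain \<theta> where "v = op_var \<theta> (leader rk a)" using v(2) unfolding proper_derivative_def by blast
      then show False using vV a valid_op_var unfolding leader_derivs_def by blast
    qed
    have "leader rk a \<notin> vars P" using P(2) leader_in_leader_derivs[OF a] unfolding polys_def V_def by blast
    then have "deg_in (leader rk a) P = 0" by (simp add: deg_in_eq_0_iff)
    then show "deg_in (leader rk a) (r * P) < deg_in (leader rk a) a"
      using deg_in_mult[of "leader rk a" r P] ra(2) by linarith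
  qed
  ultimately have "r * P = 0" by (rule reduced_in_I)
  then show False using \<open>r \<noteq> 0\<close> P(1) by simp
qed

section \<open>Leaders of the algebraic characteristic set compared with those of
  \<open>C0\<close>\<close>

context
  fixes C' :: "'k dpoly set"
  assumes charset': "alg_charset (Rh m l h) rk (I \<inter> Rh m l h) C'"
begin

lemma autoreduced': "alg_autoreduced (Rh m l h) rk C'"
  using charset' by (simp add: alg_charset_def)

lemma Rh_subset: "Rh m l h \<subseteq> Rset m l"
  by (auto simp: Rh_def Rset_def)

lemma C'_props:
  assumes "c \<in> C'"
  shows "c \<in> Rset m l" "vars c \<noteq> {}" "c \<in> I" "c \<in> Rh m l h"
    "valid (leader rk c)" "var_ord (leader rk c) \<le> h"
proof -
  show c: "c \<in> Rset m l" "vars c \<noteq> {}" "c \<in> I" "c \<in> Rh m l h"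
    using assms charset' autoreduced' Rh_subset by (auto simp: alg_charset_def alg_autoreduced_def)
  show "valid (leader rk c)" "var_ord (leader rk c) \<le> h"
    using valid_leader[OF c(1,2)] leader_in_vars[OF c(1,2)] c(4) by (auto simp: Rh_def)
qed

lemma C'_reduced: "b \<in> C' \<Longrightarrow> c \<in> C' \<Longrightarrow> b \<noteq> c \<Longrightarrow> deg_in (leader rk c) b < deg_in (leader rk c) c"
  using autoreduced' by (auto simp: alg_autoreduced_def alg_reduced_def)

lemma C'_leader_inj: "b \<in> C' \<Longrightarrow> c \<in> C' \<Longrightarrow> leader rk b = leader rk c \<Longrightarrow> b = c"
  using autoreduced_leader_inj[of "alg_reduced rk" "Rh m l h" C'] autoreduced'
  unfolding alg_autoreduced_iff by blast

text \<open>The induction invariant at a single derivative v. Existence of elements of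
  \<open>C'\<close> at lower derivatives bounds the degrees of later elements of \<open>C'\<close>;
  absence of other leaders ensures that nothing below v obstructs the search for an element of
  \<open>C'\<close> with leader v.\<close>

definition matching :: "dvar \<Rightarrow> bool" where
  "matching v \<longleftrightarrow>
    (v \<in> leader_derivs C0 \<longrightarrow> (\<exists>c\<in>C'. leader rk c = v \<and> (\<forall>a\<in>C0. leader rk a = v \<longrightarrow> deg_in v c = deg_in v a) \<and>
        (v \<notin> leader rk ` C0 \<longrightarrow> deg_in v c = 1))) \<and>
    (\<forall>c\<in>C'. leader rk c = v \<longrightarrow> v \<in> leader_derivs C0)"

lemma proper_derivative_leader_derivs:
  assumes "a \<in> C0" "valid x" "proper_derivative x (leader rk a)"
  shows "x \<in> leader_derivs C0" "x \<notin> leader rk ` C0"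
proof -
  obtain \<theta> where "x = op_var \<theta> (leader rk a)" using assms(3) unfolding proper_derivative_def by blast
  then show "x \<in> leader_derivs C0" using assms(1,2) valid_op_var unfolding leader_derivs_def by blast
  show "x \<notin> leader rk ` C0" using leader_not_proper_derivative[OF autoreduced0 _ assms(1)] assms(3) by blast
qed

text \<open>By minimality of \<open>C'\<close>, f is not reduced with respect to some c in
  \<open>C'\<close>. A leader of c below v would, by \<open>matching\<close> and
  \<open>proper\<close>, be a leader of \<open>C0\<close> with the same degree, which
  \<open>deg\<close> excludes. So c has leader v.\<close>

lemma ex_C'_leader:
  assumes below: "\<And>w. valid w \<Longrightarrow> lt w v \<Longrightarrow> matching w"
    and v: "valid v"
    and f: "f \<in> I" "f \<in> Rh m l h" "f \<in> polys (upto v)" "vars f \<noteq> {}"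
    and deg: "\<And>a. a \<in> C0 \<Longrightarrow> lt (leader rk a) v \<Longrightarrow> deg_in (leader rk a) f < deg_in (leader rk a) a"
    and proper: "\<And>w. w \<in> vars f \<Longrightarrow> lt w v \<Longrightarrow> w \<in> leader_derivs C0 \<Longrightarrow> w \<in> leader rk ` C0"
  shows "\<exists>c\<in>C'. leader rk c = v \<and> deg_in v c \<le> deg_in v f"
proof -
  obtain c where c: "c \<in> C'" "\<not> alg_reduced rk f c"
    using alg_charset_not_reduced[OF charset' Rh_subset, of f] f by blast
  let ?w = "leader rk c"
  have le: "deg_in ?w c \<le> deg_in ?w f" using c(2) by (simp add: alg_reduced_def)
  moreover have "0 < deg_in ?w c" using deg_leader_pos C'_props(1,2)[OF c(1)] by blast
  ultimately have wf: "?w \<in> vars f" using deg_in_pos_iff[of ?w f] by linarith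
  have "\<not> lt ?w v"
  proof
    assume lt: "lt ?w v"
    have match: "matching ?w" using below lt C'_props(5)[OF c(1)] by blast
    have wL: "?w \<in> leader_derivs C0" using match c(1) unfolding matching_def by blast
    have "?w \<in> leader rk ` C0" by (rule proper[OF wf lt wL])
    then obtain a where a: "a \<in> C0" "leader rk a = ?w" by auto
    obtain c1 where "c1 \<in> C'" "leader rk c1 = ?w" "deg_in ?w c1 = deg_in ?w a"
      using match wL a unfolding matching_def by blast
    moreover from this have "c1 = c" using C'_leader_inj c(1) by blast
    ultimately show False using deg[OF a(1)] a(2) lt le by simp
  qed
  moreover have "rk ?w v" using wf f(3) unfolding polys_def upto_def by blast
  ultimately have "?w = v" by (simp add: lt_def)
  then show ?thesis using c(1) le by blast
qed

text \<open>Below its leader, c is controlled by the other elements of \<open>C'\<close>: one of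
  degree 1 at each proper derivative of a leader of \<open>C0\<close>, one of the degree of the
  element of \<open>C0\<close> at each such leader. Only the leader of c itself needs the
  assumptions \<open>np\<close> and \<open>deg\<close>.\<close>

lemma C'_diff_reduced:
  assumes below: "\<And>w. valid w \<Longrightarrow> lt w (leader rk c) \<Longrightarrow> matching w"
    and c: "c \<in> C'" and a: "a \<in> C0"
    and np: "\<not> proper_derivative (leader rk c) (leader rk a)"
    and deg: "leader rk a = leader rk c \<Longrightarrow> deg_in (leader rk c) c < deg_in (leader rk c) a"
  shows "diff_reduced rk c a"
  unfolding diff_reduced_def
proof
  let ?v = "leader rk c"
  note cp = C'_props[OF c]
  have ap: "a \<in> Rset m l" "vars a \<noteq> {}" using C0_props a by blast+
  have lt: "lt x ?v" "valid x" if "x \<in> vars c" "x \<noteq> ?v" for x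
    using that rk_leader[OF cp(1,2)] cp(1) unfolding Rset_def lt_def by blast+
  show "\<forall>x\<in>vars c. \<not> proper_derivative x (leader rk a)"
  proof (intro ballI notI)
    fix x assume x: "x \<in> vars c" "proper_derivative x (leader rk a)"
    then have xv: "x \<noteq> ?v" using np by blast
    note lx = lt[OF x(1) xv]
    have "\<exists>c1\<in>C'. leader rk c1 = x \<and> deg_in x c1 = 1"
      using below[OF lx(2,1)] proper_derivative_leader_derivs[OF a lx(2) x(2)] unfolding matching_def by blast
    then obtain c1 where c1: "c1 \<in> C'" "leader rk c1 = x" "deg_in x c1 = 1" by blast
    then have "deg_in x c < 1" using C'_reduced[OF c c1(1)] xv by auto
    then show False using x(1) by (simp add: deg_in_eq_0_iff)
  qed
  show "deg_in (leader rk a) c < deg_in (leader rk a) a"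
  proof (cases "leader rk a \<in> vars c \<and> leader rk a \<noteq> ?v")
    case True
    have "\<exists>c1\<in>C'. leader rk c1 = leader rk a \<and> deg_in (leader rk a) c1 = deg_in (leader rk a) a"
      using below[OF lt(2,1)] True leader_in_leader_derivs[OF a] a unfolding matching_def by blast
    then obtain c1 where c1: "c1 \<in> C'" "leader rk c1 = leader rk a"
      "deg_in (leader rk a) c1 = deg_in (leader rk a) a" by blast
    then have "c1 \<noteq> c" using True by metis
    then show ?thesis using C'_reduced[OF c c1(1)] c1 by simp
  next
    case False
    then show ?thesis
      using deg deg_leader_pos[OF ap] by (cases "leader rk a = ?v") (simp_all add: deg_in_eq_0_iff[symmetric])
  qed
qed

lemma upto_in_Rh: "valid v \<Longrightarrow> var_ord v \<le> h \<Longrightarrow> f \<in> polys (upto v) \<Longrightarrow> f \<in> Rh m l h"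
  using var_ord_mono[of _ v] by (fastforce simp: polys_def upto_def Rh_def)

lemma matching_step:
  assumes v: "valid v" "var_ord v \<le> h" and below: "\<And>w. valid w \<Longrightarrow> lt w v \<Longrightarrow> matching w"
  shows "matching v"
proof -
  \<comment> \<open>Such a c would be a nonconstant element of I reduced with respect to all of
    \<open>C0\<close>.\<close>
  have red: False if c: "c \<in> C'" "leader rk c = v"
    and np: "\<And>a. a \<in> C0 \<Longrightarrow> \<not> proper_derivative v (leader rk a)"
    and deg: "\<And>a. a \<in> C0 \<Longrightarrow> leader rk a = v \<Longrightarrow> deg_in v c < deg_in v a" for c
  proof -
    have "diff_reduced rk c a" if a: "a \<in> C0" for a
    proof (rule C'_diff_reduced[OF _ c(1) a])
      show "matching w" if "valid w" "lt w (leader rk c)" for w using below that c(2) by simp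
      show "\<not> proper_derivative (leader rk c) (leader rk a)" using np[OF a] c(2) by simp
      show "deg_in (leader rk c) c < deg_in (leader rk c) a" if "leader rk a = leader rk c"
        using deg[OF a] that c(2) by simp
    qed
    then have "c = 0" using reduced_in_I C'_props(3)[OF c(1)] by blast
    then show False using C'_props(2)[OF c(1)] by simp
  qed
  have second: "v \<in> leader_derivs C0" if c: "c \<in> C'" "leader rk c = v" for c
  proof (rule ccontr)
    assume nv: "v \<notin> leader_derivs C0"
    show False
    proof (rule red[OF c])
      show "\<not> proper_derivative v (leader rk a)" if "a \<in> C0" for a
        using proper_derivative_leader_derivs(1)[OF that v(1)] nv by blast
      show "deg_in v c < deg_in v a" if "a \<in> C0" "leader rk a = v" for a
        using leader_in_leader_derivs[OF that(1)] that(2) nv by simp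
    qed
  qed
  have "\<exists>c\<in>C'. leader rk c = v \<and> (\<forall>a\<in>C0. leader rk a = v \<longrightarrow> deg_in v c = deg_in v a) \<and>
        (v \<notin> leader rk ` C0 \<longrightarrow> deg_in v c = 1)" if "v \<in> leader_derivs C0"
    using that v(1)
  proof (cases rule: leader_derivs_cases)
    case (1 a)
    note ap = C0_props(2,3)[OF 1(1)]
    \<comment> \<open>The element a itself is the test polynomial: being autoreduced with the rest
      of \<open>C0\<close>, it meets the degree conditions below v.\<close>
    have "\<exists>c\<in>C'. leader rk c = v \<and> deg_in v c \<le> deg_in v a"
    proof (rule ex_C'_leader[OF below v(1)])
      show "a \<in> I" using C0_subset 1(1) by blast
      show aup: "a \<in> polys (upto v)" using in_polys_upto_leader[OF ap] 1(2) by simp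
      show "a \<in> Rh m l h" by (rule upto_in_Rh[OF v aup])
      show "vars a \<noteq> {}" by (rule ap)
      show "deg_in (leader rk b) a < deg_in (leader rk b) b" if "b \<in> C0" "lt (leader rk b) v" for b
      proof -
        have "a \<noteq> b" using that(2) 1(2) by (auto simp: lt_def)
        then show ?thesis using C0_props(4)[OF 1(1) that(1)] by (simp add: diff_reduced_def)
      qed
      show "w \<in> leader rk ` C0" if w: "w \<in> vars a" "lt w v" "w \<in> leader_derivs C0" for w
      proof -
        have "valid w" using w(1) ap(1) by (simp add: Rset_def)
        from w(3) this show ?thesis
        proof (cases rule: leader_derivs_cases)
          case (2 b \<theta>)
          then have pd: "proper_derivative w (leader rk b)" unfolding proper_derivative_def by blast
          have "b \<noteq> a"
          proof
            assume "b = a"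
            then have "lt v w" using proper_derivative_lt[OF \<open>valid w\<close> pd] 1(2) by simp
            then show False using lt_not_rk[OF v(1) \<open>valid w\<close>] w(2) lt_imp_rk by blast
          qed
          then show ?thesis using C0_props(4)[OF 1(1) 2(1)] pd w(1) unfolding diff_reduced_def by blast
        qed blast
      qed
    qed
    then obtain c where c: "c \<in> C'" "leader rk c = v" "deg_in v c \<le> deg_in v a" by blast
    have uniq: "b = a" if "b \<in> C0" "leader rk b = v" for b
      using leader_inj[OF autoreduced0 that(1) 1(1)] that(2) 1(2) by simp
    \<comment> \<open>A smaller degree would make c reduced with respect to \<open>C0\<close>,
      contradicting \<open>red\<close>.\<close>
    have "\<not> deg_in v c < deg_in v a"
    proof
      assume lt: "deg_in v c < deg_in v a"
      show False
      proof (rule red[OF c(1,2)])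
        show "\<not> proper_derivative v (leader rk b)" if "b \<in> C0" for b
          using leader_not_proper_derivative[OF autoreduced0 1(1) that] 1(2) by simp
        show "deg_in v c < deg_in v b" if "b \<in> C0" "leader rk b = v" for b
          using uniq[OF that] lt by simp
      qed
    qed
    then have eq: "deg_in v c = deg_in v a" using c(3) by simp
    have "deg_in v c = deg_in v b" if "b \<in> C0" "leader rk b = v" for b
      using uniq[OF that] eq by simp
    moreover have "v \<in> leader rk ` C0" using 1 by blast
    ultimately show ?thesis using c(1,2) by blast
  next
    case (2 a \<theta>)
    note ap = C0_props(2,3)[OF 2(1)]
    note bp = below_props[OF v(1)]
    let ?S = "separant rk a"
    obtain T where T: "T \<in> polys (below v)" "apply_op \<delta> m \<theta> a = ?S * Var v + T"
      using apply_op_linear(1)[OF ap 2(2,3), of \<delta>] 2(4) by auto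
    have S: "?S \<in> polys (below v)" using apply_op_linear(2)[OF ap 2(2,3)] 2(4) by simp
    \<comment> \<open>The derivative of a is not yet reduced below v. Its coefficient S and its tail
      T are reduced over \<open>below v\<close> only, so that no divisor with leader v interferes;
      the outcome p v + q is still linear in v.\<close>
    have fam: "finite {?S, T}" "{?S, T} \<subseteq> polys (below v)" using S T(1) by simp_all
    obtain s where s: "s \<in> polys (below v)" "divides_power C0 s"
      "\<forall>f\<in>{?S, T}. \<exists>r\<in>polys (below v). s * f - r \<in> C0_ideal \<and> (\<forall>a\<in>C0. diff_reduced rk r a)"
      by (rule reduction_mod_C0[OF bp(1,2,3) fam])
    obtain p where p: "p \<in> polys (below v)" "s * ?S - p \<in> C0_ideal" "\<forall>a\<in>C0. diff_reduced rk p a"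
      using s(3) by blast
    obtain q where q: "q \<in> polys (below v)" "s * T - q \<in> C0_ideal" "\<forall>a\<in>C0. diff_reduced rk q a"
      using s(3) by blast
    obtain S' where "S' \<in> polys (\<Union>(vars ` C0))" "S' * ?S = H rk C0"
      using initial_separant_divides_H[OF C0_props(1) 2(1), of ?S] by blast
    then have "divides_power C0 ?S"
      unfolding divides_power_def by (intro exI[of _ 1] exI[of _ S']) simp
    \<comment> \<open>The product s * S again divides a power of \<open>H rk C0\<close>, so
      consistency prevents p from vanishing.\<close>
    then have "p \<noteq> 0" using remainder_nonzero[OF divides_power_mult[OF s(2)] p(2)] by blast
    have qv: "q \<in> polys (upto v)" "deg_in v q < 1"
      using q(1) bp(4,5) by (auto simp: polys_def deg_in_eq_0_iff)
    define f where "f = p * Var v ^ 1 + q"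
    note f = leader_lead_form[OF p(1) qv \<open>p \<noteq> 0\<close> v(1), folded f_def]
    have bR: "g \<in> polys {v. valid v}" if "g \<in> polys (below v)" for g :: "'k dpoly"
      using polys_mono[OF _ that] bp(3) by blast
    have vR: "(Var v :: 'k dpoly) \<in> polys {v. valid v}" by (rule polys_Var) (simp add: v(1))
    have "s * apply_op \<delta> m \<theta> a \<in> C0_ideal"
      using ideal_mult[OF C0_ideal(1) apply_op_in_C0_ideal[OF 2(1,2)] bR[OF s(1)]] .
    moreover have "Var v * (s * ?S - p) + (s * T - q) \<in> C0_ideal"
      by (rule ideal_add[OF C0_ideal(1) ideal_mult[OF C0_ideal(1) p(2) vR] q(2)])
    ultimately have "s * apply_op \<delta> m \<theta> a - (Var v * (s * ?S - p) + (s * T - q)) \<in> C0_ideal"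
      by (rule ideal_diff[OF C0_ideal(1)])
    moreover have "s * apply_op \<delta> m \<theta> a - (Var v * (s * ?S - p) + (s * T - q)) = f"
      by (simp add: T(2) f_def algebra_simps)
    ultimately have fI: "f \<in> I" using C0_ideal(2) by auto
    have "proper_derivative v (leader rk a)"
      unfolding proper_derivative_def by (intro exI[of _ \<theta>] conjI) (rule 2)+
    then have not_leader: "v \<notin> leader rk ` C0"
      by (rule proper_derivative_leader_derivs(2)[OF 2(1) v(1)])
    have "\<exists>c\<in>C'. leader rk c = v \<and> deg_in v c \<le> deg_in v f"
    proof (rule ex_C'_leader[OF below v(1) fI upto_in_Rh[OF v f(2)] f(2,1)])
      show "deg_in (leader rk b) f < deg_in (leader rk b) b" if "b \<in> C0" "lt (leader rk b) v" for b
      proof -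
        have "leader rk b \<noteq> v" using that(2) by (auto simp: lt_def)
        then have "deg_in (leader rk b) f \<le> max (deg_in (leader rk b) p) (deg_in (leader rk b) q)"
          by (rule f(5))
        moreover have "deg_in (leader rk b) p < deg_in (leader rk b) b" "deg_in (leader rk b) q < deg_in (leader rk b) b"
          using p(3) q(3) that(1) by (simp_all add: diff_reduced_def)
        ultimately show ?thesis by linarith
      qed
      show "w \<in> leader rk ` C0" if w: "w \<in> vars f" "lt w v" "w \<in> leader_derivs C0" for w
      proof -
        have "w \<noteq> v" using w(2) by (simp add: lt_def)
        then have wpq: "w \<in> vars p \<union> vars q" using f(6) w(1) by blast
        then have "valid w" using p(1) q(1) bp(3) unfolding polys_def by blast
        from w(3) this show ?thesis
        proof (cases rule: leader_derivs_cases)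
          case (2 b \<theta>)
          then have "proper_derivative w (leader rk b)" unfolding proper_derivative_def by blast
          then show ?thesis using p(3) q(3) 2(1) wpq unfolding diff_reduced_def by blast
        qed blast
      qed
    qed
    then obtain c where c: "c \<in> C'" "leader rk c = v" "deg_in v c \<le> 1" unfolding f(4) by blast
    moreover have "0 < deg_in v c" using deg_leader_pos[OF C'_props(1,2)[OF c(1)]] unfolding c(2) .
    ultimately have "deg_in v c = 1" by linarith
    moreover have "leader rk b \<noteq> v" if "b \<in> C0" for b using not_leader that by blast
    ultimately show ?thesis using c(1,2) by (intro bexI[of _ c]) simp_all
  qed
  then show ?thesis using second unfolding matching_def by blast
qed

lemma matching: "valid v \<Longrightarrow> var_ord v \<le> h \<Longrightarrow> matching v"
proof (induction v rule: valid_induct)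
  case (less v)
  show ?case
  proof (rule matching_step[OF less.hyps less.prems])
    show "matching w" if "valid w" "lt w v" for w
      using less.IH[OF that] var_ord_mono[OF that(1) less.hyps lt_imp_rk[OF that(2)]] less.prems by simp
  qed
qed

text \<open>Here \<open>leader_ord_le\<close> is indispensable: \<open>matching\<close> is known
  only up to order h, so leaders of \<open>C0\<close> must be within reach. A proper derivative of
  such a leader is the leader of an element of \<open>C'\<close> of degree 1 and so cannot occur in
  the chosen elements.\<close>

lemma ex_equal_rank_subset:
  obtains A0 where "A0 \<subseteq> C'" "diff_autoreduced (Rset m l) rk A0" "key rk ` A0 = key rk ` C0"
proof
  define A0 where "A0 = {c \<in> C'. leader rk c \<in> leader rk ` C0}"
  show "A0 \<subseteq> C'" by (auto simp: A0_def)
  have key: "key rk c = key rk a" if ca: "c \<in> C'" "a \<in> C0" "leader rk c = leader rk a" for a c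
  proof -
    have "matching (leader rk a)" using matching C'_props(5,6)[OF ca(1)] ca(3) by simp
    then obtain c1 where c1: "c1 \<in> C'" "leader rk c1 = leader rk a"
      "deg_in (leader rk a) c1 = deg_in (leader rk a) a"
      using leader_in_leader_derivs[OF ca(2)] ca(2) unfolding matching_def by blast
    then have "c1 = c" using C'_leader_inj[OF c1(1) ca(1)] ca(3) by simp
    then show ?thesis using c1 by (simp add: key_def)
  qed
  show "key rk ` A0 = key rk ` C0"
  proof (intro equalityI image_subsetI)
    fix c assume "c \<in> A0"
    then show "key rk c \<in> key rk ` C0" using key unfolding A0_def by blast
  next
    fix a assume a: "a \<in> C0"
    have "matching (leader rk a)"
      using matching leader_ord_le[OF a] valid_leader C0_props(2,3)[OF a] by blast
    then obtain c where c: "c \<in> C'" "leader rk c = leader rk a"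
      using leader_in_leader_derivs[OF a] unfolding matching_def by blast
    then have "c \<in> A0" using a by (auto simp: A0_def)
    then show "key rk a \<in> key rk ` A0" using key[OF c(1) a c(2)] by (metis imageI)
  qed
  show "diff_autoreduced (Rset m l) rk A0"
    unfolding diff_autoreduced_def
  proof (intro conjI ballI impI)
    show "finite A0" using autoreduced' by (simp add: A0_def alg_autoreduced_def)
    show "A0 \<subseteq> Rset m l" using C'_props(1) by (auto simp: A0_def)
    show "vars c \<noteq> {}" if "c \<in> A0" for c using that C'_props(2) by (simp add: A0_def)
    fix c g assume cg: "c \<in> A0" "g \<in> A0" "c \<noteq> g"
    then obtain a where a: "a \<in> C0" "leader rk g = leader rk a" by (auto simp: A0_def)
    have C': "c \<in> C'" "g \<in> C'" using cg by (auto simp: A0_def)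
    have "\<not> proper_derivative x (leader rk g)" if x: "x \<in> vars c" for x
    proof
      assume "proper_derivative x (leader rk g)"
      then have pd: "proper_derivative x (leader rk a)" using a(2) by simp
      have xR: "valid x" "var_ord x \<le> h" using C'_props(4)[OF C'(1)] x by (auto simp: Rh_def)
      note xL = proper_derivative_leader_derivs[OF a(1) xR(1) pd]
      obtain c1 where c1: "c1 \<in> C'" "leader rk c1 = x" "deg_in x c1 = 1"
        using matching[OF xR] xL unfolding matching_def by blast
      have "c1 \<noteq> c" using c1(2) xL(2) cg(1) unfolding A0_def by blast
      then have "deg_in x c < 1" using C'_reduced[OF C'(1) c1(1)] c1(2,3) by simp
      then show False using x by (simp add: deg_in_eq_0_iff)
    qed
    then show "diff_reduced rk c g"
      using C'_reduced[OF C' cg(3)] by (simp add: diff_reduced_def)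
  qed
qed

text \<open>A set B in I lower than A would be lower than \<open>C0\<close>, or else A0, having the
  same keys as \<open>C0\<close>, would be lower than A. The first contradicts the choice of
  \<open>C0\<close>, the second the minimality of A.\<close>

theorem lowest_subset_charset:
  assumes A: "A \<subseteq> C'" "diff_autoreduced (Rset m l) rk A"
    and min: "\<And>B. B \<subseteq> C' \<Longrightarrow> diff_autoreduced (Rset m l) rk B \<Longrightarrow> \<not> set_rank_less rk B A"
  shows "kolchin_charset m l rk I A"
proof -
  have rankable: "rankable B" if "diff_autoreduced (Rset m l) rk B" for B :: "'k dpoly set"
    using that autoreduced_rankable[of "diff_reduced rk"] diff_reduced_imp_alg_reduced
    unfolding diff_autoreduced_iff by blast
  obtain A0 where A0: "A0 \<subseteq> C'" "diff_autoreduced (Rset m l) rk A0" "key rk ` A0 = key rk ` C0"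
    by (rule ex_equal_rank_subset)
  have "\<not> set_rank_less rk B A" if B: "diff_autoreduced (Rset m l) rk B" "B \<subseteq> I" for B
  proof
    assume "set_rank_less rk B A"
    then have "keys_less rk (key rk ` B) (key rk ` A)"
      using set_rank_less_iff rankable B(1) A(2) by blast
    then have "keys_less rk (key rk ` B) (key rk ` C0) \<or> keys_less rk (key rk ` C0) (key rk ` A)"
    proof (rule keys_less_cases)
      show "finite (key rk ` B)" "finite (key rk ` C0)"
        using B(1) C0_props(1) by (simp_all add: diff_autoreduced_def)
      show "valid (fst k)" if "k \<in> key rk ` B \<union> key rk ` C0 \<union> key rk ` A" for k
        using that rankable_valid rankable B(1) A(2) autoreduced0 by blast
    qed
    then have "set_rank_less rk B C0 \<or> set_rank_less rk A0 A"
      using set_rank_less_iff rankable B(1) A(2) A0(2,3) autoreduced0 by metis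
    then show False
      using min[OF A0(1,2)] charset0 B unfolding kolchin_charset_def by blast
  qed
  moreover have "A \<subseteq> I" using A(1) C'_props(3) by blast
  ultimately show ?thesis using A(2) by (simp add: kolchin_charset_def)
qed

end

end

theorem mainTheorem6:
  fixes \<delta> :: "nat \<Rightarrow> 'k::field_char_0 \<Rightarrow> 'k"
    and m l n h :: nat
    and rk :: "dvar \<Rightarrow> dvar \<Rightarrow> bool"
    and I :: "'k dpoly set"
    and C :: "nat \<Rightarrow> 'k dpoly set"
    and C' :: "'k dpoly set"
  assumes dfield: "diff_field m \<delta>"
    and orderly: "is_orderly_ranking m l rk"
    and rad: "is_radical_diff_ideal \<delta> m l I"
    and consistent: "\<exists>C0. C0 \<subseteq> I \<and> kolchin_charset m l rk I C0 \<and>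
                        1 \<notin> saturation (Rset m l) (diff_ideal_gen \<delta> m l C0) {H rk C0}"
    and n_pos: "n \<ge> 1"
    and decomp_char: "\<forall>i<n. characterizable_by \<delta> m l rk
                        (saturation (Rset m l) (diff_ideal_gen \<delta> m l (C i)) {H rk (C i)}) (C i)"
    and decomp: "I = (\<Inter>i<n. saturation (Rset m l) (diff_ideal_gen \<delta> m l (C i)) {H rk (C i)})"
    and h_def: "h = Max (insert 0 (\<Union>i<n. \<Union>f\<in>C i. var_ord ` vars f))"
    and C'_char: "alg_charset (Rh m l h) rk
        (\<Inter>i<n. saturation (Rh m l h)
            (ideal_gen (Rh m l h)
               {apply_op \<delta> m \<theta> f | \<theta> f. f \<in> C i \<and> valid_op m \<theta> \<and>
                   var_ord (op_var \<theta> (leader rk f)) \<le> h})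
            {H rk (C i)}) C'"
  shows "\<forall>A. A \<subseteq> C' \<and> diff_autoreduced (Rset m l) rk A \<and>
             (\<forall>B. B \<subseteq> C' \<and> diff_autoreduced (Rset m l) rk B \<longrightarrow> \<not> set_rank_less rk B A)
           \<longrightarrow> kolchin_charset m l rk I A"
proof (intro allI impI)
  fix A
  assume A: "A \<subseteq> C' \<and> diff_autoreduced (Rset m l) rk A \<and>
             (\<forall>B. B \<subseteq> C' \<and> diff_autoreduced (Rset m l) rk B \<longrightarrow> \<not> set_rank_less rk B A)"
  let ?J = "\<lambda>i. saturation (Rset m l) (diff_ideal_gen \<delta> m l (C i)) {H rk (C i)}"
  interpret orderly_ranking m l rk by standard (rule orderly)
  have comp: "characterizable_ideal m l rk \<delta> (?J i) (C i)" if "i < n" for i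
    by standard (use dfield decomp_char that in auto)
  have ord: "var_ord v \<le> h" if "i < n" "a \<in> C i" "v \<in> vars a" for i a v
  proof -
    have "finite (\<Union>i<n. \<Union>f\<in>C i. var_ord ` vars f)"
      using characterizable_ideal.A_props(1)[OF comp] by simp
    then show ?thesis unfolding h_def using that by (intro Max_ge) auto
  qed
  obtain C0 where C0: "kolchin_charset m l rk I C0"
    "1 \<notin> saturation (Rset m l) (diff_ideal_gen \<delta> m l C0) {H rk C0}"
    using consistent by blast
  interpret characteristic_decomposition m l rk \<delta> n h I ?J C C0
  proof
    \<comment> \<open>That 1 is outside the saturation says precisely that no power of
      \<open>H rk C0\<close> lies in [C0].\<close>
    show "H rk C0 ^ N \<notin> diff_ideal_gen \<delta> m l C0" for N
      using C0(2) by (simp add: saturation_singleton Rset_def)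
    show "is_diff_ideal \<delta> m l I" using rad by (simp add: is_radical_diff_ideal_def)
    show "characterizable_by \<delta> m l rk (?J i) (C i)" if "i < n" for i
      using decomp_char that by blast
    show "var_ord v \<le> h" if "i < n" "a \<in> C i" "v \<in> vars a" for i a v
      using that by (rule ord)
  qed (use n_pos dfield in simp, use n_pos in simp, rule decomp, rule C0(1))
  have "(\<Inter>i<n. saturation (Rh m l h)
            (ideal_gen (Rh m l h)
               {apply_op \<delta> m \<theta> f | \<theta> f. f \<in> C i \<and> valid_op m \<theta> \<and>
                   var_ord (op_var \<theta> (leader rk f)) \<le> h})
            {H rk (C i)}) = (\<Inter>i<n. ?J i \<inter> Rh m l h)"
    by (rule INF_cong[OF refl]) (use characterizable_ideal.contraction[OF comp] ord in auto)
  \<comment> \<open>Since n \<ge> 1, the index set is nonempty and \<open>Rh\<close> can be pulled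
    out of the intersection.\<close>
  also have "\<dots> = I \<inter> Rh m l h"
    using n_pos unfolding decomp by auto
  finally have "alg_charset (Rh m l h) rk (I \<inter> Rh m l h) C'" using C'_char by simp
  then show "kolchin_charset m l rk I A" using lowest_subset_charset[of C' A] A by blast
qed

end
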